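(* Let $T$ be a locally finite, rooted tree with root $o$ and forward degrees $\ge2$. Consider an ultra-metric element $\phi$ on $T$ and a fully supported probability measure $\mu$ on $\partial T$. Then there are a unique constant $C>0$ and a unique transient nearest neighbour random walk on $T$ that satisfies $$F(v,v^-)<1\quad\text{for every }v\in T\setminus\{o\}\qquad\text{and}\qquad\lim_{v\to\infty}G(v,o)=0$$ with the following properties: 1. $\mu=\nu_o$ is the limit distribution of the random walk (started at $o$). 2. The associated boundary process coincides with the standard process on $\partial T$ induced by the ultra-metric element $C\cdot\phi$ and the given measure $\mu$.
   Context: Tree. $v^-$ is the neighbour of $v\ne o$ on the geodesic from $o$ to $v$; the forward degree of $u$ is $\#\{v:v^-=u\}$, assumed finite and $\ge2$ for every $u$. $\partial T$ is the (compact) space of ends of $T$. For $u\in T$, $T_u=\{v:u\in\pi(o,v)\}$ ($\pi(o,v)$ the geodesic) and $\partial T_u$ is the set of ends with a representing ray in $T_u$. For distinct ends $x,y$, $x\wedge y$ is the last common vertex of the rays from $o$ to $x$ and $y$. Random walk. A nearest neighbour random walk $(Z_n)$ has stochastic transition matrix $\mathcal{P}=(p(u,v))$ with $p(u,v)>0$ iff $u\sim v$. $G(u,v)=\sum_{n\ge0}p^{(n)}(u,v)$ is finite (transience), $F(u,v)=\mathbb{P}_u[Z_n=v\text{ for some }n\ge0]$. "$\lim_{v\to\infty}G(v,o)=0$" means that for every $\varepsilon>0$, $G(v,o)<\varepsilon$ for all $v$ outside some finite set. $Z_n$ converges almost surely to a random end $Z_\infty$; $\nu_u(B)=\mathbb{P}_u[Z_\infty\in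 B]$ for Borel $B\subset\partial T$. Boundary process. Let $\mathsf{m}(o)=1$ and $\mathsf{m}(v)=\prod_{i=1}^k\frac{p(v_{i-1},v_i)}{p(v_i,v_{i-1})}$ if $\pi(o,v)=[v_0,\dots,v_k]$; $a(v^-,v)=\mathsf{m}(v)p(v,v^-)$. For $f,g:T\to\mathbb{R}$, $\mathcal{E}_T(f,g)=\sum_{v\ne o}(f(v)-f(v^-))(g(v)-g(v^-))a(v^-,v)$. For $\varphi\in L^1(\partial T,\nu_o)$ let $h_\varphi(u)=\int_{\partial T}\varphi\,d\nu_u$. Set $\mathcal{D}(\partial T,\mathcal{P})=\{\varphi\in L^1(\partial T,\nu_o):\mathcal{E}_T(h_\varphi,h_\varphi)<\infty\}$ and $\mathcal{E}_{\mathcal{HD}}(\varphi,\psi)=\mathcal{E}_T(h_\varphi,h_\psi)$ for $\varphi,\psi$ in it. The boundary process is the symmetric Markov process on $\partial T$ determined by this Dirichlet form on $L^2(\partial T,\nu_o)$. Standard process. An ultra-metric element is a function $\phi:T\to(0,\infty)$ with $\phi(v)<\phi(v^-)$ for $v\ne o$ and $\phi(v_n)\to0$ along every geodesic ray; it induces the ultra-metric $d_\phi(x,y)=\phi(x\wedge y)$ for $x\ne y$, $d_\phi(x,x)=0$, on $\partial T$, whose closed balls are the sets $\partial T_u$. Given a fully supported probability measure $\mu$ on $\partial T$, the standard process associated with $(\phi,\mu)$ is the symmetric Markov process with semigroup $P^t=\int_{[0,\infty)}\mathrm{Q}_r\,d\sigma_*^t(r)$, $\sigma_*(r)=e^{-1/r}$,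 where $\mathrm{Q}_rf(x)=\frac1{\mu(B_r(x))}\int_{B_r(x)}f\,d\mu$ and $B_r(x)$ is the closed $d_\phi$-ball. Its Dirichlet form on $L^2(\partial T,\mu)$ is $\mathcal{E}(f,g)=\frac12\iint(f(x)-f(y))(g(x)-g(y))J(x,y)\,d\mu(x)d\mu(y)$ with domain $\{f\in L^2:\mathcal{E}(f,f)<\infty\}$, where $J(x,y)=\int_0^{1/d_\phi(x,y)}\frac{d\tau}{\mu(B_{1/\tau}(x))}$. Two processes coincide if they have the same Dirichlet form (equivalently, the same transition semigroup). *)

theory Defs
  imports "HOL-Probability.Probability"
begin

section \<open>Rooted trees\<close>

text \<open>A graph is given by its adjacency relation \<open>E\<close>; every element of the type \<open>'v\<close> is a vertex.\<close>

definition is_tree :: "('v \<Rightarrow> 'v \<Rightarrow> bool) \<Rightarrow> bool" where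
  "is_tree E \<longleftrightarrow>
     (\<forall>u v. E u v \<longrightarrow> E v u) \<and> (\<forall>u. \<not> E u u) \<and> (\<forall>u v. E\<^sup>*\<^sup>* u v) \<and>
     \<not> (\<exists>xs. 3 \<le> length xs \<and> distinct xs \<and> successively E xs \<and> E (last xs) (hd xs))"

definition is_path :: "('v \<Rightarrow> 'v \<Rightarrow> bool) \<Rightarrow> 'v \<Rightarrow> 'v \<Rightarrow> 'v list \<Rightarrow> bool" where
  "is_path E u v xs \<longleftrightarrow>
     xs \<noteq> [] \<and> hd xs = u \<and> last xs = v \<and> distinct xs \<and> successively E xs"

text \<open>In a tree there is exactly one path without repeated vertices between two vertices.\<close>

definition geodesic :: "('v \<Rightarrow> 'v \<Rightarrow> bool) \<Rightarrow> 'v \<Rightarrow> 'v \<Rightarrow> 'v list" where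
  "geodesic E u v = (THE xs. is_path E u v xs)"

definition parent :: "('v \<Rightarrow> 'v \<Rightarrow> bool) \<Rightarrow> 'v \<Rightarrow> 'v \<Rightarrow> 'v" where
  "parent E base v = (THE w. E w v \<and> w \<in> set (geodesic E base v))"

definition locally_finite :: "('v \<Rightarrow> 'v \<Rightarrow> bool) \<Rightarrow> bool" where
  "locally_finite E \<longleftrightarrow> (\<forall>u. finite {v. E u v})"

text \<open>\<open>parent E base base\<close> is meaningless, so the root is excluded from the sets of children.\<close>

definition children :: "('v \<Rightarrow> 'v \<Rightarrow> bool) \<Rightarrow> 'v \<Rightarrow> 'v \<Rightarrow> 'v set" where
  "children E base u = {v. v \<noteq> base \<and> parent E base v = u}"

definition branch :: "('v \<Rightarrow> 'v \<Rightarrow> bool) \<Rightarrow> 'v \<Rightarrow> 'v \<Rightarrow> 'v set" where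
  "branch E base u = {v. u \<in> set (geodesic E base v)}"


section \<open>The space of ends\<close>

definition is_ray :: "('v \<Rightarrow> 'v \<Rightarrow> bool) \<Rightarrow> (nat \<Rightarrow> 'v) \<Rightarrow> bool" where
  "is_ray E r \<longleftrightarrow> inj r \<and> (\<forall>n. E (r n) (r (Suc n)))"

type_synonym 'v tree_end = "(nat \<Rightarrow> 'v) set"

text \<open>An end is an equivalence class of geodesic rays, two rays being equivalent if they differ only
  by finite initial pieces.\<close>

definition ray_equiv :: "('v \<Rightarrow> 'v \<Rightarrow> bool) \<Rightarrow> ((nat \<Rightarrow> 'v) \<times> (nat \<Rightarrow> 'v)) set" where
  "ray_equiv E =
     {(r, s). is_ray E r \<and> is_ray E s \<and> (\<exists>i j. \<forall>k. r (i + k) = s (j + k))}"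

definition ends :: "('v \<Rightarrow> 'v \<Rightarrow> bool) \<Rightarrow> 'v tree_end set" where
  "ends E = {r. is_ray E r} // ray_equiv E"

definition end_branch :: "('v \<Rightarrow> 'v \<Rightarrow> bool) \<Rightarrow> 'v \<Rightarrow> 'v \<Rightarrow> 'v tree_end set" where
  "end_branch E base u = {x \<in> ends E. \<exists>r\<in>x. range r \<subseteq> branch E base u}"

definition ray_from :: "'v \<Rightarrow> 'v tree_end \<Rightarrow> nat \<Rightarrow> 'v" where
  "ray_from base x = (THE r. r \<in> x \<and> r 0 = base)"

definition confluent :: "'v \<Rightarrow> 'v tree_end \<Rightarrow> 'v tree_end \<Rightarrow> 'v" where
  "confluent base x y =
     ray_from base x (GREATEST n. ray_from base x n \<in> range (ray_from base y))"

definition end_topology :: "('v \<Rightarrow> 'v \<Rightarrow> bool) \<Rightarrow> 'v \<Rightarrow> 'v tree_end topology" where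
  "end_topology E base = topology_generated_by (range (end_branch E base))"

definition end_borel :: "('v \<Rightarrow> 'v \<Rightarrow> bool) \<Rightarrow> 'v \<Rightarrow> 'v tree_end measure" where
  "end_borel E base = sigma (ends E) {U. openin (end_topology E base) U}"

definition fully_supported :: "('v \<Rightarrow> 'v \<Rightarrow> bool) \<Rightarrow> 'v \<Rightarrow> 'v tree_end measure \<Rightarrow> bool" where
  "fully_supported E base \<mu> \<longleftrightarrow>
     (\<forall>U. openin (end_topology E base) U \<and> U \<noteq> {} \<longrightarrow> 0 < emeasure \<mu> U)"


section \<open>Nearest neighbour random walks\<close>

definition nearest_neighbour_walk :: "('v \<Rightarrow> 'v \<Rightarrow> bool) \<Rightarrow> ('v \<Rightarrow> 'v \<Rightarrow> real) \<Rightarrow> bool" where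
  "nearest_neighbour_walk E p \<longleftrightarrow>
     (\<forall>u v. 0 \<le> p u v) \<and> (\<forall>u. (p u has_sum 1) UNIV) \<and> (\<forall>u v. 0 < p u v \<longleftrightarrow> E u v)"

primrec n_step :: "('v \<Rightarrow> 'v \<Rightarrow> real) \<Rightarrow> nat \<Rightarrow> 'v \<Rightarrow> 'v \<Rightarrow> real" where
  "n_step p 0 u v = of_bool (u = v)"
| "n_step p (Suc n) u v = (\<Sum>\<^sub>\<infinity>w. p u w * n_step p n w v)"

definition transient :: "('v \<Rightarrow> 'v \<Rightarrow> real) \<Rightarrow> bool" where
  "transient p \<longleftrightarrow> (\<forall>u v. summable (\<lambda>n. n_step p n u v))"

definition Green :: "('v \<Rightarrow> 'v \<Rightarrow> real) \<Rightarrow> 'v \<Rightarrow> 'v \<Rightarrow> real" where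
  "Green p u v = (\<Sum>n. n_step p n u v)"

text \<open>The law of the trajectory \<open>(Z\<^sub>n)\<close> of the walk started at \<open>u\<close>, on the space of all
  sequences of vertices, obtained from the Ionescu-Tulcea theorem: \<open>Z\<^sub>0 = u\<close>, and given the past the
  distribution of \<open>Z\<^sub>n\<close> is the row of \<open>p\<close> at \<open>Z\<^bsub>n-1\<^esub>\<close>. Lemma \<open>walk_law_cylinder\<close> below
  gives the probabilities of cylinder sets.\<close>

definition walk_kernel :: "('v \<Rightarrow> 'v \<Rightarrow> real) \<Rightarrow> 'v \<Rightarrow> nat \<Rightarrow> (nat \<Rightarrow> 'v) \<Rightarrow> 'v measure" where
  "walk_kernel p u n \<omega> =
     measure_pmf (if n = 0 then return_pmf u else embed_pmf (p (\<omega> (n - 1))))"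

definition walk_law :: "('v \<Rightarrow> 'v \<Rightarrow> real) \<Rightarrow> 'v \<Rightarrow> (nat \<Rightarrow> 'v) measure" where
  "walk_law p u =
     projective_family.lim UNIV
       (Ionescu_Tulcea.CI (walk_kernel p u) (\<lambda>_. count_space UNIV)) (\<lambda>_. count_space UNIV)"

lemma pmf_row:
  assumes "\<And>u v. 0 \<le> p u v" "\<And>u. (p u has_sum (1::real)) UNIV"
  shows "pmf (embed_pmf (p u)) v = p u v"
proof (rule pmf_embed_pmf)
  show "(\<integral>\<^sup>+x. ennreal (p u x) \<partial>count_space UNIV) = 1"
  proof -
    have s: "p u summable_on UNIV" using assms(2) has_sum_imp_summable by blast
    hence "(\<lambda>x. norm (p u x)) summable_on UNIV" using summable_on_iff_abs_summable_on_real by blast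
    hence i: "Infinite_Set_Sum.abs_summable_on (p u) UNIV"
      by (simp only: abs_summable_equivalent)
    hence i': "integrable (count_space UNIV) (p u)"
      by (simp add: Infinite_Set_Sum.abs_summable_on_def)
    have "(\<integral>\<^sup>+x. ennreal (p u x) \<partial>count_space UNIV) = ennreal (\<integral>x. p u x \<partial>count_space UNIV)"
      using i' assms(1) by (intro nn_integral_eq_integral) auto
    also have "(\<integral>x. p u x \<partial>count_space UNIV) = infsum (p u) UNIV"
      using infsetsum_infsum[OF i] by (simp add: infsetsum_def)
    also have "\<dots> = 1" using assms(2) infsumI by blast
    finally show ?thesis by simp
  qed
qed (use assms in auto)

lemma walk_IT:
  fixes p :: "'v \<Rightarrow> 'v \<Rightarrow> real"
  shows "Ionescu_Tulcea (walk_kernel p u) (\<lambda>_. count_space UNIV)"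
proof (rule Ionescu_Tulcea.intro)
  fix i :: nat
  show "walk_kernel p u i \<in> Pi\<^sub>M {0..<i} (\<lambda>_. count_space UNIV) \<rightarrow>\<^sub>M subprob_algebra (count_space UNIV)"
  proof (cases i)
    case 0
    have "(\<lambda>\<omega>. measure_pmf (return_pmf u)) \<in> Pi\<^sub>M {0..<i} (\<lambda>_. count_space UNIV) \<rightarrow>\<^sub>M subprob_algebra (count_space UNIV)"
      by (intro measurable_const) (auto simp: space_subprob_algebra intro!: measure_pmf.subprob_space_axioms)
    then show ?thesis using 0 by (simp add: walk_kernel_def cong: measurable_cong)
  next
    case (Suc k)
    have "(\<lambda>w. measure_pmf (embed_pmf (p w))) \<in> count_space UNIV \<rightarrow>\<^sub>M subprob_algebra (count_space UNIV)"
      by (auto simp: space_subprob_algebra intro!: measure_pmf.subprob_space_axioms)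
    moreover have "(\<lambda>\<omega>. \<omega> k) \<in> Pi\<^sub>M {0..<i} (\<lambda>_. count_space UNIV) \<rightarrow>\<^sub>M count_space UNIV"
      using Suc by (intro measurable_component_singleton) auto
    ultimately show ?thesis unfolding Suc walk_kernel_def
      by (auto intro: measurable_compose[rotated])
  qed
  show "prob_space (walk_kernel p u i x)" for x
    by (auto simp: walk_kernel_def intro: measure_pmf.prob_space_axioms)
qed

lemma walk_law_cylinder:
  fixes p :: "'v \<Rightarrow> 'v \<Rightarrow> real"
  assumes "\<And>u v. 0 \<le> p u v" "\<And>u. (p u has_sum 1) UNIV"
  shows "measure (walk_law p u) {\<omega> \<in> space (walk_law p u). \<forall>i\<le>n. \<omega> i = z i} =
     (if z 0 = u then \<Prod>i<n. p (z i) (z (Suc i)) else 0)"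
proof -
  interpret IT: Ionescu_Tulcea "walk_kernel p u" "\<lambda>_. count_space UNIV" by (rule walk_IT)
  let ?M = "\<lambda>_::nat. count_space (UNIV :: 'v set)"
  have setsC: "sets (IT.C 0 k (\<lambda>_. undefined)) = sets (PiM {0..<k} ?M)" for k
    using IT.sets_C[of "\<lambda>_. undefined" 0 k] by (simp add: space_PiM)
  have spaceC: "space (IT.C 0 k (\<lambda>_. undefined)) = space (PiM {0..<k} ?M)" for k
    using setsC by (rule sets_eq_imp_space_eq)
  define X where "X n = {restrict z {0..<n}}" for n :: nat
  have X: "X n \<in> sets (PiM {0..<n} ?M)" for n
  proof -
    have "X n = PiE {0..<n} (\<lambda>i. {z i})"
      unfolding X_def by (auto simp: PiE_iff extensional_def restrict_def fun_eq_iff)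
    also have "\<dots> \<in> sets (PiM {0..<n} ?M)" by (intro sets_PiM_I_finite) auto
    finally show ?thesis .
  qed
  have C: "emeasure (IT.C 0 (Suc n) (\<lambda>_. undefined)) (X (Suc n)) =
       ennreal (if z 0 = u then \<Prod>i<n. p (z i) (z (Suc i)) else 0)" for n
  proof -
    have step: "emeasure (IT.C 0 (Suc k) (\<lambda>_. undefined)) (X (Suc k)) =
       emeasure (IT.C 0 k (\<lambda>_. undefined)) (X k) * 
       emeasure (walk_kernel p u k (restrict z {0..<k})) {z k}" for k
    proof -
      have m: "IT.eP k \<in> IT.C 0 k (\<lambda>_. undefined) \<rightarrow>\<^sub>M subprob_algebra (PiM {0..<Suc k} ?M)"
        using IT.measurable_eP[of k] by (simp only: measurable_cong_sets[OF setsC refl])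
      have "emeasure (IT.C 0 (Suc k) (\<lambda>_. undefined)) (X (Suc k)) =
         (\<integral>\<^sup>+\<omega>. emeasure (IT.eP k \<omega>) (X (Suc k)) \<partial>IT.C 0 k (\<lambda>_. undefined))"
        by (simp, rule emeasure_bind[OF _ m X]) (simp add: spaceC)
      also have "\<dots> = (\<integral>\<^sup>+\<omega>. emeasure (walk_kernel p u k (restrict z {0..<k})) {z k} * indicator (X k) \<omega>
              \<partial>IT.C 0 k (\<lambda>_. undefined))"
      proof (intro nn_integral_cong)
        fix \<omega> assume "\<omega> \<in> space (IT.C 0 k (\<lambda>_. undefined))"
        hence w: "\<omega> \<in> space (PiM {0..<k} ?M)" by (simp add: spaceC)
        have "emeasure (IT.eP k \<omega>) (X (Suc k)) =
             emeasure (walk_kernel p u k \<omega>) ((\<lambda>x. fun_upd \<omega> k x) -` X (Suc k) \<inter> UNIV)"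
          using IT.emeasure_eP[OF w X] by simp
        also have "(\<lambda>x. fun_upd \<omega> k x) -` X (Suc k) = (if \<omega> \<in> X k then {z k} else {})"
        proof -
          have "fun_upd \<omega> k x = restrict z {0..<Suc k} \<longleftrightarrow> x = z k \<and> \<omega> = restrict z {0..<k}" for x
          proof
            assume a: "fun_upd \<omega> k x = restrict z {0..<Suc k}"
            have "\<omega> i = restrict z {0..<k} i" for i
              using fun_cong[OF a, of i] w by (cases "i = k") (auto simp: space_PiM PiE_iff extensional_def restrict_def split: if_splits)
            with fun_cong[OF a, of k] show "x = z k \<and> \<omega> = restrict z {0..<k}" by auto
          qed (auto simp: fun_eq_iff restrict_def)
          thus ?thesis unfolding vimage_def X_def by simp
        qed
        finally have fin: "emeasure (IT.eP k \<omega>) (X (Suc k)) =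
           emeasure (walk_kernel p u k \<omega>) (if \<omega> \<in> X k then {z k} else {})"
          by (simp only: Int_UNIV_right)
        show "emeasure (IT.eP k \<omega>) (X (Suc k)) =
           emeasure (walk_kernel p u k (restrict z {0..<k})) {z k} * indicator (X k) \<omega>"
        proof (cases "\<omega> \<in> X k")
          case True
          hence "\<omega> = restrict z {0..<k}" unfolding X_def by (rule singletonD)
          thus ?thesis unfolding fin using True by (simp only: if_True indicator_simps mult_1_right)
        qed (simp add: fin)
      qed
      also have "\<dots> = emeasure (walk_kernel p u k (restrict z {0..<k})) {z k} *
           emeasure (IT.C 0 k (\<lambda>_. undefined)) (X k)"
        by (intro nn_integral_cmult_indicator) (use X in \<open>simp add: setsC\<close>)
      finally show ?thesis by (simp add: mult.commute)
    qed
    show ?thesis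
    proof (induction n)
      case 0
      have "X 0 = {\<lambda>_. undefined}" by (auto simp: X_def restrict_def)
      hence "emeasure (IT.C 0 0 (\<lambda>_. undefined)) (X 0) = 1"
        using X[of 0] by simp
      moreover have "emeasure (walk_kernel p u 0 (restrict z {0..<0})) {z 0} = (if z 0 = u then 1 else 0)"
        by (simp add: walk_kernel_def emeasure_pmf_single)
      ultimately show ?case using step[of 0] by (simp del: IT.C.simps)
    next
      case (Suc n)
      have "emeasure (walk_kernel p u (Suc n) (restrict z {0..<Suc n})) {z (Suc n)} = ennreal (p (z n) (z (Suc n)))"
        by (simp add: walk_kernel_def emeasure_pmf_single pmf_row[OF assms])
      thus ?case using step[of "Suc n"] Suc assms(1)
        by (simp add: ennreal_mult' prod_nonneg del: IT.C.simps)
    qed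
  qed
  have law: "walk_law p u = IT.PF.lim" by (simp add: walk_law_def)
  have eq: "{\<omega> \<in> space (walk_law p u). \<forall>i\<le>n. \<omega> i = z i} = prod_emb UNIV ?M {0..<Suc n} (X (Suc n))"
    unfolding law IT.PF.space_lim
    by (auto simp: prod_emb_def X_def space_PiM restrict_def fun_eq_iff less_Suc_eq_le split: if_splits)
  have "emeasure (walk_law p u) {\<omega> \<in> space (walk_law p u). \<forall>i\<le>n. \<omega> i = z i} = emeasure (IT.CI {0..<Suc n}) (X (Suc n))"
    by (subst eq, subst law, rule IT.lim) (use X in auto)
  also have "\<dots> = emeasure (IT.C 0 (Suc n) (\<lambda>_. undefined)) (prod_emb {0..<Suc n} ?M {0..<Suc n} (X (Suc n)))"
    by (rule IT.emeasure_CI) (use X in auto)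
  also have "prod_emb {0..<Suc n} ?M {0..<Suc n} (X (Suc n)) = X (Suc n)"
    using sets.sets_into_space[OF X[of "Suc n"]] by (intro prod_emb_id) (auto simp: space_PiM)
  finally show ?thesis using C[of n] assms(1)
    by (simp add: measure_def prod_nonneg del: IT.C.simps)
qed

lemma sets_walk_law: "sets (walk_law p u) = sets (PiM UNIV (\<lambda>_. count_space UNIV))"
proof -
  interpret IT: Ionescu_Tulcea "walk_kernel p u" "\<lambda>_. count_space UNIV" by (rule walk_IT)
  show ?thesis by (simp add: walk_law_def IT.PF.sets_lim)
qed

definition hit_prob :: "('v \<Rightarrow> 'v \<Rightarrow> real) \<Rightarrow> 'v \<Rightarrow> 'v \<Rightarrow> real" where
  "hit_prob p u v = measure (walk_law p u) {\<omega> \<in> space (walk_law p u). \<exists>n. \<omega> n = v}"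

text \<open>Convergence in the end compactification: the sets \<open>branch E base u\<close> together with
  \<open>end_branch E base u\<close>, for those \<open>u\<close> with \<open>x \<in> end_branch E base u\<close>, form a neighbourhood base
  of the end \<open>x\<close>.\<close>

definition converges_to_end ::
    "('v \<Rightarrow> 'v \<Rightarrow> bool) \<Rightarrow> 'v \<Rightarrow> (nat \<Rightarrow> 'v) \<Rightarrow> 'v tree_end \<Rightarrow> bool" where
  "converges_to_end E base z x \<longleftrightarrow>
     x \<in> ends E \<and>
     (\<forall>u. x \<in> end_branch E base u \<longrightarrow> (\<forall>\<^sub>F n in sequentially. z n \<in> branch E base u))"

text \<open>For a transient walk the limit exists almost surely; the value on the exceptional null set is an
  arbitrary end, so that \<open>limit_end\<close> is a map into the space of ends.\<close>

definition limit_end :: "('v \<Rightarrow> 'v \<Rightarrow> bool) \<Rightarrow> 'v \<Rightarrow> (nat \<Rightarrow> 'v) \<Rightarrow> 'v tree_end" where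
  "limit_end E base z =
     (if \<exists>x. converges_to_end E base z x then THE x. converges_to_end E base z x
      else SOME x. x \<in> ends E)"

definition limit_law ::
    "('v \<Rightarrow> 'v \<Rightarrow> bool) \<Rightarrow> 'v \<Rightarrow> ('v \<Rightarrow> 'v \<Rightarrow> real) \<Rightarrow> 'v \<Rightarrow> 'v tree_end measure" where
  "limit_law E base p u = distr (walk_law p u) (end_borel E base) (limit_end E base)"


section \<open>Dirichlet forms\<close>

text \<open>A form is a domain together with a bilinear form on it. Functions are not identified when they
  agree almost everywhere.\<close>

type_synonym 'x form = "('x \<Rightarrow> real) set \<times> (('x \<Rightarrow> real) \<Rightarrow> ('x \<Rightarrow> real) \<Rightarrow> real)"

definition same_form :: "'x form \<Rightarrow> 'x form \<Rightarrow> bool" where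
  "same_form A B \<longleftrightarrow> fst A = fst B \<and> (\<forall>f\<in>fst A. \<forall>g\<in>fst A. snd A f g = snd B f g)"


subsection \<open>The boundary process\<close>

definition rev_measure ::
    "('v \<Rightarrow> 'v \<Rightarrow> bool) \<Rightarrow> 'v \<Rightarrow> ('v \<Rightarrow> 'v \<Rightarrow> real) \<Rightarrow> 'v \<Rightarrow> real" where
  "rev_measure E base p v =
     (let xs = geodesic E base v
      in \<Prod>i<length xs - 1. p (xs ! i) (xs ! Suc i) / p (xs ! Suc i) (xs ! i))"

definition conductance ::
    "('v \<Rightarrow> 'v \<Rightarrow> bool) \<Rightarrow> 'v \<Rightarrow> ('v \<Rightarrow> 'v \<Rightarrow> real) \<Rightarrow> 'v \<Rightarrow> real" where
  "conductance E base p v = rev_measure E base p v * p v (parent E base v)"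

definition tree_form_term ::
    "('v \<Rightarrow> 'v \<Rightarrow> bool) \<Rightarrow> 'v \<Rightarrow> ('v \<Rightarrow> 'v \<Rightarrow> real) \<Rightarrow> ('v \<Rightarrow> real) \<Rightarrow> ('v \<Rightarrow> real) \<Rightarrow> 'v \<Rightarrow> real"
  where
  "tree_form_term E base p f g v =
     (f v - f (parent E base v)) * (g v - g (parent E base v)) * conductance E base p v"

definition tree_form ::
    "('v \<Rightarrow> 'v \<Rightarrow> bool) \<Rightarrow> 'v \<Rightarrow> ('v \<Rightarrow> 'v \<Rightarrow> real) \<Rightarrow> ('v \<Rightarrow> real) \<Rightarrow> ('v \<Rightarrow> real) \<Rightarrow> real"
  where
  "tree_form E base p f g = (\<Sum>\<^sub>\<infinity>v\<in>- {base}. tree_form_term E base p f g v)"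

definition harmonic_ext ::
    "('v \<Rightarrow> 'v \<Rightarrow> bool) \<Rightarrow> 'v \<Rightarrow> ('v \<Rightarrow> 'v \<Rightarrow> real) \<Rightarrow> ('v tree_end \<Rightarrow> real) \<Rightarrow> 'v \<Rightarrow> real"
  where
  "harmonic_ext E base p \<phi> u = (\<integral>x. \<phi> x \<partial>limit_law E base p u)"

text \<open>The summands of \<open>tree_form E base p h h\<close> are nonnegative, so summability expresses that the
  energy is finite.\<close>

definition boundary_domain ::
    "('v \<Rightarrow> 'v \<Rightarrow> bool) \<Rightarrow> 'v \<Rightarrow> ('v \<Rightarrow> 'v \<Rightarrow> real) \<Rightarrow> ('v tree_end \<Rightarrow> real) set" where
  "boundary_domain E base p =
     {\<phi>. integrable (limit_law E base p base) \<phi> \<and>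
          (let h = harmonic_ext E base p \<phi> in tree_form_term E base p h h summable_on - {base})}"

definition boundary_form ::
    "('v \<Rightarrow> 'v \<Rightarrow> bool) \<Rightarrow> 'v \<Rightarrow> ('v \<Rightarrow> 'v \<Rightarrow> real) \<Rightarrow> 'v tree_end form" where
  "boundary_form E base p =
     (boundary_domain E base p,
      \<lambda>\<phi> \<psi>. tree_form E base p (harmonic_ext E base p \<phi>) (harmonic_ext E base p \<psi>))"


subsection \<open>The standard process of an ultra-metric element\<close>

definition ultrametric_element :: "('v \<Rightarrow> 'v \<Rightarrow> bool) \<Rightarrow> 'v \<Rightarrow> ('v \<Rightarrow> real) \<Rightarrow> bool" where
  "ultrametric_element E base \<phi> \<longleftrightarrow>
     (\<forall>v. 0 < \<phi> v) \<and> (\<forall>v. v \<noteq> base \<longrightarrow> \<phi> v < \<phi> (parent E base v)) \<and>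
     (\<forall>r. is_ray E r \<longrightarrow> (\<lambda>n. \<phi> (r n)) \<longlonglongrightarrow> 0)"

definition end_dist :: "'v \<Rightarrow> ('v \<Rightarrow> real) \<Rightarrow> 'v tree_end \<Rightarrow> 'v tree_end \<Rightarrow> real" where
  "end_dist base \<phi> x y = (if x = y then 0 else \<phi> (confluent base x y))"

definition end_ball ::
    "('v \<Rightarrow> 'v \<Rightarrow> bool) \<Rightarrow> 'v \<Rightarrow> ('v \<Rightarrow> real) \<Rightarrow> 'v tree_end \<Rightarrow> real \<Rightarrow> 'v tree_end set" where
  "end_ball E base \<phi> x r = {y \<in> ends E. end_dist base \<phi> x y \<le> r}"

text \<open>On the diagonal \<open>1 / 0 = 0\<close> gives the value \<open>0\<close>; this is immaterial, since the kernel only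
  occurs multiplied by \<open>(f x - f y) * (g x - g y)\<close>.\<close>

definition jump_kernel ::
    "('v \<Rightarrow> 'v \<Rightarrow> bool) \<Rightarrow> 'v \<Rightarrow> ('v \<Rightarrow> real) \<Rightarrow> 'v tree_end measure \<Rightarrow>
     'v tree_end \<Rightarrow> 'v tree_end \<Rightarrow> real" where
  "jump_kernel E base \<phi> \<mu> x y =
     (LINT \<tau>:{0<..<1 / end_dist base \<phi> x y}|lborel. 1 / measure \<mu> (end_ball E base \<phi> x (1 / \<tau>)))"

definition standard_integrand ::
    "('v \<Rightarrow> 'v \<Rightarrow> bool) \<Rightarrow> 'v \<Rightarrow> ('v \<Rightarrow> real) \<Rightarrow> 'v tree_end measure \<Rightarrow>
     ('v tree_end \<Rightarrow> real) \<Rightarrow> ('v tree_end \<Rightarrow> real) \<Rightarrow> 'v tree_end \<times> 'v tree_end \<Rightarrow> real" where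
  "standard_integrand E base \<phi> \<mu> f g =
     (\<lambda>(x, y). (f x - f y) * (g x - g y) * jump_kernel E base \<phi> \<mu> x y)"

definition standard_domain ::
    "('v \<Rightarrow> 'v \<Rightarrow> bool) \<Rightarrow> 'v \<Rightarrow> ('v \<Rightarrow> real) \<Rightarrow> 'v tree_end measure \<Rightarrow>
     ('v tree_end \<Rightarrow> real) set" where
  "standard_domain E base \<phi> \<mu> =
     {f. f \<in> borel_measurable \<mu> \<and> integrable \<mu> (\<lambda>x. (f x)\<^sup>2) \<and>
         integrable (\<mu> \<Otimes>\<^sub>M \<mu>) (standard_integrand E base \<phi> \<mu> f f)}"

definition standard_form ::
    "('v \<Rightarrow> 'v \<Rightarrow> bool) \<Rightarrow> 'v \<Rightarrow> ('v \<Rightarrow> real) \<Rightarrow> 'v tree_end measure \<Rightarrow> 'v tree_end form" where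
  "standard_form E base \<phi> \<mu> =
     (standard_domain E base \<phi> \<mu>,
      \<lambda>f g. 1 / 2 * (\<integral>z. standard_integrand E base \<phi> \<mu> f g z \<partial>(\<mu> \<Otimes>\<^sub>M \<mu>)))"

end

theory Submission
  imports Defs
begin

text \<open>Everything is read off from the Green potential \<open>g = G(\<cdot>, o)\<close>. It is superharmonic with Laplacian
  \<open>\<delta>\<^sub>o\<close>, so \<open>a(v\<^sup>-, v) (g(v\<^sup>-) - g(v))\<close> is a unit flow from the root, and this flow is the limit
  distribution \<open>\<nu>\<^sub>o(\<partial>T\<^sub>v)\<close>. For the harmonic extension \<open>h\<close> of a function with branch averages \<open>A\<close>
  one has \<open>h(v) = F h(v\<^sup>-) + (1 - F) A(v)\<close> with \<open>F = g(v) / g(v\<^sup>-)\<close>. Summation by levels turns the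
  energy of \<open>h\<close> into \<open>\<Sum>\<^sub>u (1 / g(u)) \<Sum>\<^bsub>w\<^sup>- = u\<^esub> \<mu>(\<partial>T\<^sub>w) (A(w) - A(u))\<^sup>2\<close>, which is also the form of the
  standard process of the ultra-metric element \<open>g\<close>; hence the boundary process is the standard
  process for \<open>g\<close>. The form determines \<open>g\<close>, so the walk must satisfy \<open>g = C \<phi>\<close>; then the flow identity
  gives its conductances, and \<open>m(o) = 1\<close> gives \<open>C\<close>. Conversely the walk with these conductances has
  Green function \<open>C \<phi>\<close>, by the maximum principle and because \<open>\<phi>\<close> vanishes at infinity.\<close>

section \<open>Rooted trees and their ends\<close>

text \<open>Both forms are infinite sums, and cutting them at level \<open>N\<close> leaves a
  remainder; the delicate point is that finiteness on either side forces it on the other. The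
  remainders are nonnegative, which gives one inequality at once; for the other they must be
  dominated by tails. On the tree the remainder at \<open>v\<close> is the least energy of a flow of
  given strength through the branch, so finite energy controls it. On the boundary it is a variance
  divided by the ultra-metric element \<open>\<psi>\<close>, controlled by the later terms because
  \<open>1 / \<psi>\<close> grows down the tree. The domains differ as well: the boundary form
  starts from integrable functions, the standard form from square integrable ones. Fatou's lemma
  along an almost everywhere convergent sequence of branch averages closes this gap. Harmonic
  measures are found without decomposing paths: the candidate harmonic function differs from the
  indicator of a branch by at most a multiple of \<open>g\<close>, and the iterates of the
  transition operator send \<open>g\<close> to \<open>0\<close>. That the form determines
  \<open>g\<close> is seen on functions of mean zero living on the children of a single vertex
  \<open>v\<close>, where it acts as multiplication by \<open>1 / g(v)\<close>.\<close>

lemma tree_path_unique: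
  assumes t: "is_tree E" and "is_path E u v xs" "is_path E u v ys"
  shows "xs = ys"
  using assms(2,3)
proof (induction xs arbitrary: u ys)
  case Nil
  then show ?case by (simp add: is_path_def)
next
  case (Cons a xs)
  have a: "a = u" using Cons.prems(1) by (simp add: is_path_def)
  obtain ys' where ys: "ys = u # ys'"
    using Cons.prems(2) by (cases ys) (auto simp: is_path_def)
  show ?case
  proof (cases "xs = [] \<or> ys' = []")
    case True
    then show ?thesis using Cons.prems a ys by (auto simp: is_path_def split: if_splits)
  next
    case False
    have px: "is_path E (hd xs) v xs" and py: "is_path E (hd ys') v ys'"
      using False Cons.prems ys by (auto simp: is_path_def successively_Cons)
    have Eu: "E u (hd xs)" "E u (hd ys')" "u \<notin> set xs" "u \<notin> set ys'"
      using False Cons.prems ys a by (auto simp: is_path_def successively_Cons)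
    show ?thesis
    proof (cases "hd xs = hd ys'")
      case True
      then show ?thesis using Cons.IH[OF px] py ys a by auto
    next
      case ne: False
      have sym: "\<And>u v. E u v \<Longrightarrow> E v u" using t by (auto simp: is_tree_def)
      have "v \<in> set xs" "v \<in> set ys'"
        using px py last_in_set unfolding is_path_def by metis+
      then have "\<exists>z\<in>set xs. z \<in> set ys'" by blast
      from split_list_first_prop[OF this]
      obtain P z R where xs: "xs = P @ z # R" "z \<in> set ys'" "\<forall>p\<in>set P. p \<notin> set ys'"
        by blast
      then obtain Q S where ys': "ys' = Q @ z # S" by (meson split_list)
      \<comment> \<open>The paths leave \<open>u\<close> along different edges, and \<open>z\<close>
        is the first vertex of \<open>xs\<close> lying on \<open>ys'\<close>. Following
        \<open>xs\<close> to \<open>z\<close> and returning along \<open>ys'\<close> gives a cycle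
        through \<open>u\<close>.\<close>
      let ?c = "u # P @ z # rev Q"
      have "distinct ?c"
        using px py Eu xs ys' by (auto simp: is_path_def)
      moreover have "successively E ?c"
      proof -
        have "successively E (u # xs)" "successively E (u # ys')"
          using Cons.prems a ys by (auto simp: is_path_def)
        then have "successively E (u # P @ [z])" "successively E (Q @ [z])"
          by (auto simp: xs ys' successively_append_iff successively_Cons hd_append split: if_splits)
        moreover from this(2) have "successively E (rev (Q @ [z]))"
          by (subst successively_rev, elim successively_mono) (use sym in auto)
        ultimately show ?thesis
          by (auto simp: successively_append_iff successively_Cons hd_append split: if_splits)
      qed
      moreover have "E (last ?c) (hd ?c)"
        using Eu(2) sym ys' by (cases Q) auto
      \<comment> \<open>Were \<open>P\<close> and \<open>Q\<close> both empty, both paths would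
        continue with \<open>z\<close>, contrary to \<open>ne\<close>.\<close>
      moreover have "3 \<le> length ?c"
        using ne xs ys' by (cases P; cases Q) auto
      ultimately show ?thesis using t unfolding is_tree_def by metis
    qed
  qed
qed

lemma is_path_prefix: "is_path E u v (P @ z # R) \<Longrightarrow> is_path E u z (P @ [z])"
proof -
  assume a: "is_path E u v (P @ z # R)"
  then have "successively E ((P @ [z]) @ R)" by (simp add: is_path_def)
  then have "successively E (P @ [z])" using successively_append_iff by blast
  with a show ?thesis by (auto simp: is_path_def hd_append)
qed

text \<open>Extending a path by a vertex that it already contains is answered by cutting back to
  that vertex, so no repetition arises.\<close>

lemma path_exists:
  assumes "E\<^sup>*\<^sup>* u v"
  shows "\<exists>xs. is_path E u v xs"
  using assms
proof (induction rule: rtranclp_induct)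
  case base
  have "is_path E u u [u]" by (simp add: is_path_def)
  then show ?case by blast
next
  case (step y z)
  then obtain xs where xs: "is_path E u y xs" by blast
  show ?case
  proof (cases "z \<in> set xs")
    case True
    then obtain P R where "xs = P @ z # R" by (meson split_list)
    then have "is_path E u z (P @ [z])"
      using xs is_path_prefix by metis
    then show ?thesis by blast
  next
    case False
    then have "is_path E u z (xs @ [z])"
      using xs step by (auto simp: is_path_def successively_append_iff)
    then show ?thesis by blast
  qed
qed

locale rooted_tree =
  fixes E :: "'v \<Rightarrow> 'v \<Rightarrow> bool" and base :: 'v
  assumes tree: "is_tree E" and loc_fin: "locally_finite E"
    and forward_degree: "finite (children E base u) \<and> 2 \<le> card (children E base u)"
begin

abbreviation "par \<equiv> parent E base"
abbreviation "ch \<equiv> children E base"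
abbreviation "geo \<equiv> geodesic E base"
abbreviation "bd \<equiv> end_branch E base"

definition lev :: "'v \<Rightarrow> nat" where "lev v = length (geo v) - 1"

definition desc :: "'v \<Rightarrow> nat \<Rightarrow> 'v set" where
  "desc u k = {v. u \<in> set (geo v) \<and> lev v = lev u + k}"

lemma E_sym: "E u v \<Longrightarrow> E v u"
  using tree by (auto simp: is_tree_def)

lemma E_irrefl: "\<not> E u u"
  using tree by (auto simp: is_tree_def)

lemma geo_path: "is_path E base v (geo v)"
proof -
  have "E\<^sup>*\<^sup>* base v" using tree by (auto simp: is_tree_def)
  then obtain xs where "is_path E base v xs" using path_exists by metis
  then show ?thesis unfolding geodesic_def
    by (rule theI) (use tree_path_unique[OF tree] \<open>is_path E base v xs\<close> in blast)
qed

lemma last_geo [simp]: "last (geo v) = v"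
  using geo_path[of v] by (simp add: is_path_def)

lemma geo_eqI: "is_path E base v xs \<Longrightarrow> geo v = xs"
  using geo_path tree_path_unique[OF tree] by blast

lemma geo_base [simp]: "geo base = [base]"
  by (rule geo_eqI) (simp add: is_path_def)

lemma self_in_geo [simp]: "v \<in> set (geo v)"
  using geo_path[of v] last_in_set unfolding is_path_def by metis

text \<open>The initial piece up to \<open>w\<close>, extended by \<open>v\<close>, is itself a
  path, so by uniqueness nothing lies between \<open>w\<close> and \<open>v\<close>.\<close>

lemma geo_neighbour:
  assumes "E w v" "w \<in> set (geo v)"
  shows "geo v = geo w @ [v]"
proof -
  obtain P R where g: "geo v = P @ w # R" using assms(2) by (meson split_list)
  have p: "is_path E base v (P @ w # R)" using geo_path[of v] g by simp
  have "w \<noteq> v" using assms E_irrefl by auto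
  then have R: "v \<in> set R" "v \<notin> set P"
    using p by (auto simp: is_path_def split: if_splits)
  have w: "is_path E base w (P @ [w])"
    using p by (rule is_path_prefix)
  have "is_path E base v ((P @ [w]) @ [v])"
    using w R \<open>w \<noteq> v\<close> assms(1)
    by (auto simp: is_path_def successively_append_iff hd_append split: if_splits)
  then show ?thesis using w geo_eqI by metis
qed

lemma geo_par:
  assumes "v \<noteq> base"
  shows "geo v = geo (par v) @ [v]" "E (par v) v"
proof -
  have p: "is_path E base v (geo v)" by (rule geo_path)
  obtain xs where xs: "geo v = xs @ [v]"
    using p by (metis append_butlast_last_id is_path_def)
  have "xs \<noteq> []" using p xs assms by (auto simp: is_path_def)
  then have l: "E (last xs) v" "last xs \<in> set (geo v)"
    using p xs by (auto simp: is_path_def successively_append_iff)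
  have "par v = last xs" unfolding parent_def
  proof (rule the_equality)
    fix w assume "E w v \<and> w \<in> set (geo v)"
    then have "geo v = geo w @ [v]" using geo_neighbour by blast
    then have "geo w = xs" using xs by simp
    then show "w = last xs" using geo_path[of w] by (auto simp: is_path_def)
  qed (use l in auto)
  then show "geo v = geo (par v) @ [v]" "E (par v) v" using l geo_neighbour[OF l] by simp_all
qed

lemma ch_iff: "v \<in> ch u \<longleftrightarrow> v \<noteq> base \<and> par v = u"
  by (simp add: children_def)

lemma par_ch: "v \<noteq> base \<Longrightarrow> v \<in> ch (par v)"
  by (simp add: ch_iff)

lemma ch_finite [simp]: "finite (ch u)" and ch_card: "2 \<le> card (ch u)"
  using forward_degree by auto

lemma ch_nonempty: "ch u \<noteq> {}"
  using ch_card[of u] by auto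

lemma geo_ch: "v \<in> ch u \<Longrightarrow> geo v = geo u @ [v]"
  using geo_par(1)[of v] unfolding ch_iff by metis

text \<open>A neighbour of \<open>u\<close> off the geodesic of \<open>u\<close> can be appended to
  it, and a neighbour on it is its penultimate vertex. From here on adjacency is replaced by the
  parent relation.\<close>

lemma E_iff: "E u v \<longleftrightarrow> v \<in> ch u \<or> u \<in> ch v"
proof
  assume e: "E u v"
  show "v \<in> ch u \<or> u \<in> ch v"
  proof (cases "v \<in> set (geo u)")
    case True
    then have "geo u = geo v @ [u]" using geo_neighbour E_sym e by blast
    moreover from this have "u \<noteq> base" using geo_path[of v] by (auto simp: is_path_def)
    ultimately have "geo (par u) = geo v" using geo_par[of u] by simp
    then have "par u = v" by (metis last_geo)
    then show ?thesis using \<open>u \<noteq> base\<close> by (auto simp: ch_iff)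
  next
    case False
    then have "is_path E base v (geo u @ [v])"
      using geo_path[of u] e by (auto simp: is_path_def successively_append_iff)
    then have g: "geo v = geo u @ [v]" by (rule geo_eqI)
    moreover from this have "v \<noteq> base" using geo_path[of u] by (auto simp: is_path_def)
    ultimately have "geo (par v) = geo u" using geo_par[of v] by simp
    then have "par v = u" by (metis last_geo)
    then show ?thesis using \<open>v \<noteq> base\<close> by (auto simp: ch_iff)
  qed
next
  assume "v \<in> ch u \<or> u \<in> ch v"
  then show "E u v" using geo_par(2) E_sym by (auto simp: ch_iff)
qed

lemma geo_nonempty [simp]: "geo v \<noteq> []"
  using geo_path[of v] by (auto simp: is_path_def)

lemma length_geo [simp]: "length (geo v) = Suc (lev v)"
  by (simp add: lev_def)

lemma lev_base [simp]: "lev base = 0"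
  by (simp add: lev_def)

lemma lev_ch: "v \<in> ch u \<Longrightarrow> lev v = Suc (lev u)"
  using arg_cong[OF geo_ch, of v u length] by simp

lemma ch_ne: "v \<in> ch u \<Longrightarrow> v \<noteq> u"
  using lev_ch[of v u] by auto

lemma tree_induct [case_names root child]:
  assumes "P base" "\<And>u v. v \<in> ch u \<Longrightarrow> P u \<Longrightarrow> P v"
  shows "P v"
proof (induction "lev v" arbitrary: v rule: less_induct)
  case less
  show ?case
  proof (cases "v = base")
    case False
    then have "v \<in> ch (par v)" by (rule par_ch)
    then show ?thesis using assms(2) less lev_ch by (metis lessI)
  qed (use assms in auto)
qed

lemma anc_ch: "v \<in> ch u \<Longrightarrow> set (geo v) = insert v (set (geo u))"
  by (simp add: geo_ch)

text \<open>Levels are positions on geodesics; hence a vertex has at most one ancestor of each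
  level, and ancestry reduces to comparing levels.\<close>

lemma anc_lev: "u \<in> set (geo v) \<Longrightarrow> lev u \<le> lev v \<and> geo v ! lev u = u \<and> set (geo u) \<subseteq> set (geo v)"
proof (induction v rule: tree_induct)
  case root
  then show ?case by auto
next
  case (child w v)
  show ?case
  proof (cases "u = v")
    case True
    then show ?thesis using lev_ch[OF child.hyps] geo_ch[OF child.hyps] by (simp add: nth_append)
  next
    case False
    then have "u \<in> set (geo w)" using child.prems anc_ch[OF child.hyps] by blast
    then have "lev u \<le> lev w" "geo w ! lev u = u" "set (geo u) \<subseteq> set (geo w)" using child.IH by auto
    then show ?thesis using lev_ch[OF child.hyps] anc_ch[OF child.hyps]
      by (auto simp: geo_ch[OF child.hyps] nth_append)
  qed
qed

lemma anc_trans: "u \<in> set (geo w) \<Longrightarrow> w \<in> set (geo v) \<Longrightarrow> u \<in> set (geo v)"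
  using anc_lev by blast

lemma anc_unique: "u \<in> set (geo v) \<Longrightarrow> u' \<in> set (geo v) \<Longrightarrow> lev u = lev u' \<Longrightarrow> u = u'"
  using anc_lev by metis

lemma anc_antisym: "u \<in> set (geo v) \<Longrightarrow> v \<in> set (geo u) \<Longrightarrow> u = v"
  using anc_lev anc_unique by (metis le_antisym self_in_geo)

lemma anc_linear:
  "u \<in> set (geo v) \<Longrightarrow> u' \<in> set (geo v) \<Longrightarrow> lev u \<le> lev u' \<Longrightarrow> u \<in> set (geo u')"
proof (induction v rule: tree_induct)
  case root
  then show ?case by auto
next
  case (child w v)
  have s: "set (geo v) = insert v (set (geo w))" using child.hyps by (rule anc_ch)
  show ?case
  proof (cases "u' = v")
    case True
    then show ?thesis using child.prems(1) by simp
  next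
    case False
    then have u': "u' \<in> set (geo w)" using child.prems(2) s by blast
    then have "lev u' < lev v" using anc_lev lev_ch[OF child.hyps] by (metis less_Suc_eq_le)
    then have "u \<noteq> v" using child.prems(3) by auto
    then have "u \<in> set (geo w)" using child.prems(1) s by blast
    then show ?thesis using child.IH u' child.prems(3) by blast
  qed
qed

lemma anc_total:
  "u \<in> set (geo v) \<Longrightarrow> u' \<in> set (geo v) \<Longrightarrow> u \<in> set (geo u') \<or> u' \<in> set (geo u)"
  using anc_linear[of u v u'] anc_linear[of u' v u] nat_le_linear[of "lev u" "lev u'"] by blast

lemma anc_in_ch: "v \<in> ch u \<Longrightarrow> u \<in> set (geo v)"
  by (simp add: geo_ch)

lemma ch_notin_geo: "v \<in> ch u \<Longrightarrow> v \<notin> set (geo u)"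
  using anc_lev[of v u] lev_ch[of v u] by auto

lemma base_anc [simp]: "base \<in> set (geo v)"
  using geo_path[of v] hd_in_set[of "geo v"] by (simp add: is_path_def)

lemma par_anc: "w \<in> set (geo v) \<Longrightarrow> w \<noteq> v \<Longrightarrow> w \<in> set (geo (par v)) \<and> v \<noteq> base"
  using anc_ch[OF par_ch[of v]] by (cases "v = base") auto

lemma descI: "u \<in> set (geo v) \<Longrightarrow> v \<in> desc u (lev v - lev u)"
  using anc_lev[of u v] by (simp add: desc_def)

lemma desc_0 [simp]: "desc u 0 = {u}"
  using anc_unique[of u _ u] anc_unique[of _ _ _] by (auto simp: desc_def dest: anc_unique[OF _ self_in_geo])

lemma desc_Suc: "desc u (Suc k) = (\<Union>v\<in>desc u k. ch v)"
proof (intro equalityI subsetI)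
  fix w assume w: "w \<in> desc u (Suc k)"
  then have "u \<noteq> w" by (auto simp: desc_def)
  then have "u \<in> set (geo (par w))" "w \<noteq> base" using w par_anc by (auto simp: desc_def)
  then show "w \<in> (\<Union>v\<in>desc u k. ch v)"
    using w lev_ch[OF par_ch[of w]] par_ch[of w] by (auto simp: desc_def)
qed (auto simp: desc_def anc_ch lev_ch)

lemma desc_1: "desc u (Suc 0) = ch u"
  by (simp add: desc_Suc)

lemma finite_desc [simp]: "finite (desc u k)"
  by (induction k) (auto simp: desc_Suc)

lemma sum_desc_Suc: "(\<Sum>w\<in>desc u (Suc k). f w) = (\<Sum>v\<in>desc u k. \<Sum>w\<in>ch v. f w)"
  unfolding desc_Suc by (rule sum.UNION_disjoint) (auto simp: ch_iff)

lemma desc_add: "desc u (n + k) = (\<Union>v\<in>desc u n. desc v k)"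
proof (induction k)
  case 0
  then show ?case by auto
next
  case (Suc k)
  then show ?case by (simp add: desc_Suc)
qed

lemma sum_desc_add: "(\<Sum>w\<in>desc u (n + k). f w) = (\<Sum>v\<in>desc u n. \<Sum>w\<in>desc v k. f w)"
  unfolding desc_add
proof (rule sum.UNION_disjoint)
  have "v = v'" if "v \<in> desc u n" "v' \<in> desc u n" "w \<in> desc v k" "w \<in> desc v' k" for v v' w
    using that anc_unique[of v w v'] by (auto simp: desc_def)
  then show "\<forall>i\<in>desc u n. \<forall>j\<in>desc u n. i \<noteq> j \<longrightarrow> desc i k \<inter> desc j k = {}" by blast
qed auto

lemma desc_base: "v \<in> desc base n \<longleftrightarrow> lev v = n"
  by (simp add: desc_def)

lemma UN_desc_base: "(\<Union>n. desc base n) = UNIV"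
  by (auto simp: desc_base)

lemma countable_V: "countable (UNIV :: 'v set)"
  by (subst UN_desc_base[symmetric]) (rule countable_UN, auto intro: countable_finite)

lemma finite_set_levels: "finite S \<Longrightarrow> \<exists>N. \<forall>v\<in>S. lev v < N"
  by (metis finite_imageI finite_nat_set_iff_bounded imageI)

lemma desc_nonempty: "desc u k \<noteq> {}"
  using ch_nonempty by (induction k) (auto simp: desc_Suc)

lemma infinite_below: "infinite {v. u \<in> set (geo v)}"
proof
  assume "finite {v. u \<in> set (geo v)}"
  then obtain N where N: "\<forall>v\<in>{v. u \<in> set (geo v)}. lev v < N" using finite_set_levels by blast
  obtain v where "v \<in> desc u N" using desc_nonempty by blast
  then show False using N by (auto simp: desc_def)
qed

section \<open>Rays from the root as normal forms of ends\<close>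

lemma geo_nth_ch: "k < lev u \<Longrightarrow> geo u ! Suc k \<in> ch (geo u ! k)"
proof (induction u rule: tree_induct)
  case (child u v)
  have "geo u ! lev u = u" using anc_lev[OF self_in_geo[of u]] by simp
  with child show ?case
    by (cases "k = lev u") (auto simp: geo_ch lev_ch nth_append)
qed auto

text \<open>Every end contains exactly one ray that starts at the root, and such a ray always
  descends; it serves as the coordinate of the end, with index equal to level.\<close>

definition rays :: "(nat \<Rightarrow> 'v) set" where
  "rays = {s. s 0 = base \<and> (\<forall>k. s (Suc k) \<in> ch (s k))}"

lemma rays_Suc: "s \<in> rays \<Longrightarrow> s (Suc n) \<in> ch (s n)"
  and rays_0: "s \<in> rays \<Longrightarrow> s 0 = base"
  by (auto simp: rays_def)

lemma rays_lev: "s \<in> rays \<Longrightarrow> lev (s n) = n"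
  by (induction n) (simp_all add: rays_0 lev_ch[OF rays_Suc])

lemma rays_geo: "s \<in> rays \<Longrightarrow> geo (s n) = map s [0..<Suc n]"
proof (induction n)
  case (Suc n)
  then have "s (Suc n) \<in> ch (s n)" by (auto simp: rays_def)
  then show ?case using Suc geo_ch by auto
qed (auto simp: rays_def)

lemma rays_anc: "s \<in> rays \<Longrightarrow> u \<in> set (geo (s n)) \<longleftrightarrow> lev u \<le> n \<and> s (lev u) = u"
  by (auto simp: rays_geo rays_lev image_iff less_Suc_eq_le simp del: upt_Suc) (metis atLeast0LessThan atLeastLessThan_iff atMost_iff less_Suc_eq_le zero_le)

lemma rays_is_ray: "s \<in> rays \<Longrightarrow> is_ray E s"
  unfolding is_ray_def using rays_lev E_iff by (auto simp: inj_def rays_def) metis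

text \<open>After a descending step the only neighbour that is not a child is the vertex just left,
  and injectivity forbids returning to it.\<close>

lemma is_ray_rays:
  assumes "is_ray E s" "s 0 = base"
  shows "s \<in> rays"
proof -
  have "s (Suc k) \<in> ch (s k)" for k
  proof (induction k)
    case 0
    then show ?case using assms E_iff[of base "s 1"] by (auto simp: is_ray_def ch_iff)
  next
    case (Suc k)
    have "s (Suc (Suc k)) \<noteq> s k"
      using assms injD[of s "Suc (Suc k)" k] by (auto simp: is_ray_def)
    then show ?case using Suc assms E_iff[of "s (Suc k)" "s (Suc (Suc k))"]
      by (auto simp: is_ray_def ch_iff)
  qed
  then show ?thesis using assms by (auto simp: rays_def)
qed

lemma ray_shift: "is_ray E s \<Longrightarrow> is_ray E (\<lambda>k. s (n + k))"
  by (auto simp: is_ray_def inj_def) (metis add_left_imp_eq)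

lemma equiv_ray: "equiv {r. is_ray E r} (ray_equiv E)"
proof (rule equivI)
  show "ray_equiv E \<subseteq> {r. is_ray E r} \<times> {r. is_ray E r}"
    by (auto simp: ray_equiv_def)
  show "refl_on {r. is_ray E r} (ray_equiv E)"
    by (auto simp: refl_on_def ray_equiv_def)
  show "sym (ray_equiv E)"
    by (auto simp: sym_def ray_equiv_def) metis+
  show "trans (ray_equiv E)"
  proof (rule transI)
    fix x y z assume "(x, y) \<in> ray_equiv E" "(y, z) \<in> ray_equiv E"
    then obtain i j i' j' where "is_ray E x" "is_ray E z"
      and e: "\<And>k. x (i + k) = y (j + k)" "\<And>k. y (i' + k) = z (j' + k)"
      by (auto simp: ray_equiv_def)
    moreover have "x (i + i' + k) = z (j' + j + k)" for k
      using e(1)[of "i' + k"] e(2)[of "j + k"] by (simp add: ac_simps)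
    ultimately show "(x, z) \<in> ray_equiv E" by (auto simp: ray_equiv_def)
  qed
qed

text \<open>Index equals level on both rays, so the two shifts agree; the geodesic of a late common
  vertex then recovers all earlier vertices.\<close>

lemma rays_equiv_eq:
  assumes "r \<in> rays" "s \<in> rays" "(r, s) \<in> ray_equiv E"
  shows "r = s"
proof
  fix n
  obtain i j where ij: "\<And>k. r (i + k) = s (j + k)" using assms by (auto simp: ray_equiv_def)
  then have "i = j" using rays_lev assms by (metis add_0_right)
  then have "r (i + n) = s (i + n)" using ij by simp
  then have "map r [0..<Suc (i + n)] = map s [0..<Suc (i + n)]"
    using rays_geo assms by metis
  then show "r n = s n" by (simp del: upt_Suc)
qed

text \<open>A ray can climb towards the root only finitely often, since the level drops each time,
  and after one descending step it descends forever. Its descending part is completed by the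
  geodesic from the root.\<close>

lemma ray_in_rays:
  assumes "is_ray E r"
  shows "\<exists>s\<in>rays. (r, s) \<in> ray_equiv E"
proof -
  have inj: "inj r" and adj: "\<And>n. E (r n) (r (Suc n))" using assms by (auto simp: is_ray_def)
  have "\<exists>n0. r (Suc n0) \<in> ch (r n0)"
  proof (rule ccontr)
    assume "\<not> ?thesis"
    then have "r n \<in> ch (r (Suc n))" for n using adj E_iff by blast
    then have l: "lev (r n) = Suc (lev (r (Suc n)))" for n by (rule lev_ch)
    have "lev (r n) + n = lev (r 0)" for n
    proof (induction n)
      case (Suc n)
      then show ?case using l[of n] by simp
    qed simp
    then have "Suc (lev (r 0)) \<le> lev (r 0)" by (metis le_add2)
    then show False by simp
  qed
  then obtain n0 where n0: "r (Suc n0) \<in> ch (r n0)" by blast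
  have c: "r (Suc (n0 + k)) \<in> ch (r (n0 + k))" for k
  proof (induction k)
    case (Suc k)
    have "r (Suc (Suc (n0 + k))) \<noteq> r (n0 + k)"
      using injD[OF inj, of "Suc (Suc (n0 + k))" "n0 + k"] by auto
    then show ?case
      using Suc adj[of "Suc (n0 + k)"] E_iff[of "r (Suc (n0 + k))" "r (Suc (Suc (n0 + k)))"]
      by (auto simp: ch_iff)
  qed (use n0 in auto)
  define l where "l = lev (r n0)"
  define s where "s k = (if k \<le> l then geo (r n0) ! k else r (n0 + (k - l)))" for k
  have gl: "geo (r n0) ! l = r n0"
    using anc_lev[OF self_in_geo[of "r n0"]] by (simp add: l_def)
  have tail: "s (l + k) = r (n0 + k)" for k
    using gl by (auto simp: s_def)
  have g0: "geo (r n0) ! 0 = base"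
    using anc_lev[OF base_anc[of "r n0"]] by simp
  have "s (Suc k) \<in> ch (s k)" for k
  proof (cases "k < l")
    case True
    then show ?thesis using geo_nth_ch by (simp add: s_def l_def)
  next
    case False
    then obtain m where "k = l + m" by (metis le_add_diff_inverse not_le)
    then show ?thesis using tail[of m] tail[of "Suc m"] c[of m] by simp
  qed
  then have "s \<in> rays" using g0 by (simp add: rays_def s_def)
  moreover have "(r, s) \<in> ray_equiv E"
    using assms rays_is_ray[OF \<open>s \<in> rays\<close>] tail by (auto simp: ray_equiv_def) metis
  ultimately show ?thesis by blast
qed

abbreviation ray :: "'v tree_end \<Rightarrow> nat \<Rightarrow> 'v" where "ray \<equiv> ray_from base"

definition end_of :: "(nat \<Rightarrow> 'v) \<Rightarrow> 'v tree_end" where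
  "end_of s = ray_equiv E `` {s}"

lemma end_of_ends: "s \<in> rays \<Longrightarrow> end_of s \<in> ends E"
  using rays_is_ray by (auto simp: ends_def end_of_def quotient_def)

lemma ray_end_of:
  assumes "s \<in> rays"
  shows "ray (end_of s) = s"
  unfolding ray_from_def
proof (rule the_equality)
  show "s \<in> end_of s \<and> s 0 = base"
    using assms rays_is_ray by (auto simp: end_of_def ray_equiv_def rays_def)
  fix r assume "r \<in> end_of s \<and> r 0 = base"
  then have "(s, r) \<in> ray_equiv E" "r \<in> rays" using is_ray_rays by (auto simp: end_of_def ray_equiv_def)
  then show "r = s" using rays_equiv_eq assms by blast
qed

lemma ends_cases:
  assumes "x \<in> ends E"
  obtains s where "s \<in> rays" "x = end_of s"
proof -
  obtain r where r: "is_ray E r" "x = ray_equiv E `` {r}"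
    using assms by (auto simp: ends_def quotient_def)
  then obtain s where "s \<in> rays" "(r, s) \<in> ray_equiv E" using ray_in_rays by blast
  then show ?thesis using that r equiv_class_eq[OF equiv_ray] by (metis end_of_def)
qed

lemma ray_rays: "x \<in> ends E \<Longrightarrow> ray x \<in> rays"
  by (metis ends_cases ray_end_of)

lemma end_of_ray: "x \<in> ends E \<Longrightarrow> end_of (ray x) = x"
  by (metis ends_cases ray_end_of)

lemma ray_0 [simp]: "x \<in> ends E \<Longrightarrow> ray x 0 = base"
  using ray_rays by (auto simp: rays_def)

lemma ray_Suc: "x \<in> ends E \<Longrightarrow> ray x (Suc n) \<in> ch (ray x n)"
  using ray_rays by (auto simp: rays_def)

lemma lev_ray [simp]: "x \<in> ends E \<Longrightarrow> lev (ray x n) = n"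
  using ray_rays rays_lev by blast

text \<open>The representing ray in the definition may start anywhere in the branch. Its late
  vertices also lie on the ray from the root, and their ancestor \<open>u\<close> must sit there at
  position \<open>lev u\<close>.\<close>

lemma bd_iff: "x \<in> bd u \<longleftrightarrow> x \<in> ends E \<and> ray x (lev u) = u"
proof
  assume "x \<in> bd u"
  then obtain r where r: "x \<in> ends E" "r \<in> x" "range r \<subseteq> branch E base u"
    by (auto simp: end_branch_def)
  have rr: "ray x \<in> rays" using ray_rays r by auto
  have "r \<in> end_of (ray x)" using end_of_ray r by auto
  then obtain i j where ij: "\<And>k. ray x (i + k) = r (j + k)" by (auto simp: end_of_def ray_equiv_def)
  have "u \<in> set (geo (ray x (i + lev u)))" unfolding ij using r by (auto simp: branch_def)
  then show "x \<in> ends E \<and> ray x (lev u) = u" using rays_anc[OF rr] r by auto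
next
  assume a: "x \<in> ends E \<and> ray x (lev u) = u"
  have rr: "ray x \<in> rays" using ray_rays a by auto
  let ?r = "\<lambda>k. ray x (lev u + k)"
  have "\<exists>i j. \<forall>k. ray x (i + k) = ?r (j + k)"
    by (intro exI[of _ "lev u"] exI[of _ 0]) simp
  then have "(ray x, ?r) \<in> ray_equiv E"
    using rays_is_ray[OF rr] ray_shift[OF rays_is_ray[OF rr]] unfolding ray_equiv_def by auto
  then have "?r \<in> x" using end_of_ray a by (metis Image_singleton_iff end_of_def)
  moreover have "range ?r \<subseteq> branch E base u"
    using a rays_anc[OF rr] by (auto simp: branch_def)
  ultimately show "x \<in> bd u" using a by (auto simp: end_branch_def)
qed

lemma ray_anc: "x \<in> ends E \<Longrightarrow> u \<in> set (geo (ray x n)) \<longleftrightarrow> lev u \<le> n \<and> x \<in> bd u"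
  using rays_anc[OF ray_rays] bd_iff by auto

lemma ends_eqI: "x \<in> ends E \<Longrightarrow> y \<in> ends E \<Longrightarrow> (\<And>n. ray x n = ray y n) \<Longrightarrow> x = y"
  by (metis end_of_ray ext)

lemma bd_subset_ends: "bd u \<subseteq> ends E"
  by (auto simp: bd_iff)

lemma bd_base: "bd base = ends E"
  by (auto simp: bd_iff)

lemma bd_ray: "x \<in> ends E \<Longrightarrow> x \<in> bd (ray x n)"
  by (simp add: bd_iff)

lemma bd_anc_mono:
  assumes "u \<in> set (geo v)"
  shows "bd v \<subseteq> bd u"
proof
  fix x assume "x \<in> bd v"
  then have x: "x \<in> ends E" "v = ray x (lev v)" by (auto simp: bd_iff)
  then show "x \<in> bd u" using assms ray_anc by metis
qed

lemma bd_common: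
  assumes "x \<in> bd u" "x \<in> bd v" "lev u \<le> lev v"
  shows "u \<in> set (geo v)"
  using assms ray_anc[of x u "lev v"] by (auto simp: bd_iff)

lemma bd_inter_cases:
  "bd u \<inter> bd v = (if u \<in> set (geo v) then bd v else if v \<in> set (geo u) then bd u else {})"
  using bd_anc_mono bd_common by (auto dest: nat_le_linear[THEN disjE]) (meson nat_le_linear)+

lemma bd_disjoint_level: "u \<noteq> v \<Longrightarrow> lev u = lev v \<Longrightarrow> bd u \<inter> bd v = {}"
  by (auto simp: bd_iff)

lemma bd_children: "bd u = (\<Union>w\<in>ch u. bd w)"
proof (intro equalityI subsetI)
  fix x assume "x \<in> bd u"
  then have "x \<in> ends E" "ray x (lev u) = u" by (auto simp: bd_iff)
  then have "ray x (Suc (lev u)) \<in> ch u" "x \<in> bd (ray x (Suc (lev u)))"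
    using ray_Suc[of x "lev u"] bd_ray by auto
  then show "x \<in> (\<Union>w\<in>ch u. bd w)" by blast
qed (use bd_anc_mono anc_in_ch in blast)

lemma bd_nonempty: "bd u \<noteq> {}"
proof -
  have "\<forall>v. \<exists>w. w \<in> ch v" using ch_nonempty by blast
  then obtain c where c: "\<And>v. c v \<in> ch v" by metis
  define s where "s k = (if k \<le> lev u then geo u ! k else (c ^^ (k - lev u)) u)" for k
  have gl: "geo u ! lev u = u" using anc_lev[OF self_in_geo[of u]] by simp
  have "s (Suc k) \<in> ch (s k)" for k
  proof -
    consider "k < lev u" | "k = lev u" | "lev u < k" by linarith
    then show ?thesis using geo_nth_ch[of k u] c gl by cases (auto simp: s_def Suc_diff_le)
  qed
  moreover have "s 0 = base" using anc_lev[OF base_anc[of u]] by (simp add: s_def)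
  ultimately have "s \<in> rays" by (simp add: rays_def)
  moreover have "s (lev u) = u" using gl by (simp add: s_def)
  ultimately have "end_of s \<in> bd u" using bd_iff end_of_ends ray_end_of by auto
  then show ?thesis by blast
qed

section \<open>Topology and Borel sets of the space of ends\<close>

lemma bd_open: "openin (end_topology E base) (bd u)"
  unfolding end_topology_def by (rule topology_generated_by_Basis) auto

text \<open>Two branches sharing an end are nested, so passing to finite intersections in the
  generated topology needs no new basic sets.\<close>

lemma open_local_base:
  assumes "openin (end_topology E base) U" "x \<in> U"
  shows "\<exists>v. x \<in> bd v \<and> bd v \<subseteq> U"
proof -
  have "generate_topology_on (range bd) U"
    using assms(1) by (simp add: end_topology_def openin_topology_generated_by_iff)
  then show ?thesis using assms(2)
  proof (induction)
    case (Int a b)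
    then obtain v w where vw: "x \<in> bd v" "bd v \<subseteq> a" "x \<in> bd w" "bd w \<subseteq> b" by blast
    then have "bd v \<subseteq> bd w \<or> bd w \<subseteq> bd v"
      using bd_common bd_anc_mono by (meson nat_le_linear)
    then show ?case using vw by blast
  qed blast+
qed

text \<open>There are only countably many vertices, so every open set is a countable union of
  branches.\<close>

lemma sets_end_borel: "sets (end_borel E base) = sigma_sets (ends E) (range bd)"
  and space_end_borel: "space (end_borel E base) = ends E"
proof -
  have sub: "U \<subseteq> ends E" if "openin (end_topology E base) U" for U
    using open_local_base[OF that] bd_subset_ends by blast
  then have "{U. openin (end_topology E base) U} \<subseteq> Pow (ends E)" by blast
  then have s: "sets (end_borel E base) = sigma_sets (ends E) {U. openin (end_topology E base) U}"
    and sp: "space (end_borel E base) = ends E"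
    unfolding end_borel_def by (rule sets_measure_of, rule space_measure_of)
  have "U \<in> sigma_sets (ends E) (range bd)" if U: "openin (end_topology E base) U" for U
  proof -
    have "U = (\<Union>v\<in>{v. bd v \<subseteq> U}. bd v)" using open_local_base[OF U] by blast
    moreover have "(\<Union>v\<in>{v. bd v \<subseteq> U}. bd v) \<in> sigma_sets (ends E) (range bd)"
      using countable_subset[OF subset_UNIV countable_V]
      by (intro sigma_algebra.countable_UN'[OF sigma_algebra_sigma_sets])
         (use bd_subset_ends in fastforce)+
    ultimately show ?thesis by simp
  qed
  then have "sigma_sets (ends E) {U. openin (end_topology E base) U} = sigma_sets (ends E) (range bd)"
    by (intro sigma_sets_eqI) (auto intro: bd_open)
  then show "sets (end_borel E base) = sigma_sets (ends E) (range bd)"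
    "space (end_borel E base) = ends E" using s sp by auto
qed

lemma bd_meas: "bd u \<in> sets (end_borel E base)"
  by (auto simp: sets_end_borel)

text \<open>The intersection of two branches may be empty, hence the extra element of the generator.\<close>

lemma bd_Int_stable: "Int_stable (insert {} (range bd))"
  by (auto simp: Int_stable_def bd_inter_cases)

lemma sigma_sets_insert_bd:
  "sigma_sets (ends E) (insert {} (range bd)) = sigma_sets (ends E) (range bd)"
  by (intro sigma_sets_eqI) (auto intro: sigma_sets.Empty)

text \<open>Dynkin's uniqueness theorem; it later recognises \<open>limit_law\<close> from its
  values on branches.\<close>

lemma end_measure_eqI:
  assumes "sets M = sets (end_borel E base)" "sets N = sets (end_borel E base)"
    and "\<And>u. emeasure M (bd u) = emeasure N (bd u)" and "emeasure M (ends E) \<noteq> \<infinity>"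
  shows "M = N"
proof (rule measure_eqI_generator_eq[where A = "\<lambda>_. ends E" and E = "insert {} (range bd)"])
  show "Int_stable (insert {} (range bd))" by (rule bd_Int_stable)
  show "insert {} (range bd) \<subseteq> Pow (ends E)" using bd_subset_ends by auto
  show "sets M = sigma_sets (ends E) (insert {} (range bd))"
    "sets N = sigma_sets (ends E) (insert {} (range bd))"
    using assms sets_end_borel sigma_sets_insert_bd by auto
qed (use assms bd_base in auto)

end

section \<open>Nearest neighbour walks on the tree\<close>

text \<open>The whole space is the cylinder over the coordinate \<open>0\<close>, so its mass is
  that of a finite-dimensional marginal.\<close>

lemma prob_space_walk_law: "prob_space (walk_law p u)"
proof -
  interpret IT: Ionescu_Tulcea "walk_kernel p u" "\<lambda>_. count_space UNIV" by (rule walk_IT)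
  let ?M = "\<lambda>_::nat. count_space (UNIV :: 'a set)"
  let ?X = "space (PiM {0::nat} ?M)"
  have P: "prob_space (IT.CI {0})" by (rule IT.PF.prob_space_P) auto
  have "sets (IT.CI {0}) = sets (PiM {0} ?M)" by (rule IT.PF.sets_P) auto
  then have sp: "space (IT.CI {0}) = ?X" by (rule sets_eq_imp_space_eq)
  have "emeasure IT.PF.lim (prod_emb UNIV ?M {0} ?X) = emeasure (IT.CI {0}) ?X"
    by (rule IT.lim) auto
  also have "prod_emb UNIV ?M {0} ?X = space IT.PF.lim"
    by (auto simp: prod_emb_def IT.PF.space_lim space_PiM PiE_def)
  also have "emeasure (IT.CI {0}) ?X = 1"
    using prob_space.emeasure_space_1[OF P] sp by simp
  finally show ?thesis unfolding walk_law_def by (rule prob_spaceI)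
qed

lemma space_walk_law [simp]: "space (walk_law p u) = UNIV"
  using sets_eq_imp_space_eq[OF sets_walk_law, of p u] by (simp add: space_PiM)

lemma walk_coord_measurable [measurable]:
  "(\<lambda>\<omega>. \<omega> n) \<in> walk_law p u \<rightarrow>\<^sub>M count_space UNIV"
  unfolding measurable_cong_sets[OF sets_walk_law refl] by measurable

locale tree_walk = rooted_tree E base for E :: "'v \<Rightarrow> 'v \<Rightarrow> bool" and base :: 'v +
  fixes p :: "'v \<Rightarrow> 'v \<Rightarrow> real"
  assumes walk: "nearest_neighbour_walk E p"
begin

definition nbr :: "'v \<Rightarrow> 'v set" where "nbr u = {v. E u v}"

definition step :: "('v \<Rightarrow> real) \<Rightarrow> 'v \<Rightarrow> real" where
  "step f u = (\<Sum>w\<in>nbr u. p u w * f w)"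

lemma finite_nbr [simp]: "finite (nbr u)"
  using loc_fin by (simp add: nbr_def locally_finite_def)

lemma p_nonneg [simp]: "0 \<le> p u v"
  using walk by (simp add: nearest_neighbour_walk_def)

lemma p_pos_iff: "0 < p u v \<longleftrightarrow> v \<in> nbr u"
  using walk by (simp add: nearest_neighbour_walk_def nbr_def)

lemma p_zero: "v \<notin> nbr u \<Longrightarrow> p u v = 0"
  using p_pos_iff[of u v] p_nonneg[of u v] by linarith

lemma p_has_sum: "(p u has_sum 1) UNIV"
  using walk by (simp add: nearest_neighbour_walk_def)

lemma infsum_p: "(\<Sum>\<^sub>\<infinity>w. p u w * f w) = (\<Sum>w\<in>nbr u. p u w * f w)"
proof -
  have "(\<Sum>\<^sub>\<infinity>w. p u w * f w) = (\<Sum>\<^sub>\<infinity>w\<in>nbr u. p u w * f w)"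
    by (rule infsum_cong_neutral) (auto simp: p_zero)
  then show ?thesis by simp
qed

lemma sum_p: "(\<Sum>w\<in>nbr u. p u w) = 1"
  using infsum_p[of u "\<lambda>_. 1"] infsumI[OF p_has_sum[of u]] by simp

definition K :: "'v \<Rightarrow> 'v pmf" where "K u = embed_pmf (p u)"

lemma pmf_K [simp]: "pmf (K u) v = p u v"
  unfolding K_def by (rule pmf_row) (auto intro: p_has_sum)

lemma set_K: "set_pmf (K u) = nbr u"
  using p_pos_iff p_zero by (auto simp: set_pmf_eq) (metis less_irrefl)

lemma nn_integral_K: "(\<And>w. 0 \<le> f w) \<Longrightarrow> (\<integral>\<^sup>+w. ennreal (f w) \<partial>K u) = ennreal (step f u)"
  by (subst nn_integral_measure_pmf_finite)
     (auto simp: set_K step_def ennreal_mult'' [symmetric] sum_nonneg mult.commute)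

section \<open>Path events and the Markov property\<close>

abbreviation M :: "'v \<Rightarrow> (nat \<Rightarrow> 'v) measure" where "M u \<equiv> walk_law p u"

lemma M_eq_cylinder:
  "emeasure (M u) {\<omega>. \<forall>i\<le>n. \<omega> i = z i} = (if z 0 = u then \<Prod>i<n. p (z i) (z (Suc i)) else 0)"
proof -
  interpret prob_space "M u" by (rule prob_space_walk_law)
  show ?thesis
    using walk_law_cylinder[of p u n z] p_has_sum by (simp add: emeasure_eq_measure)
qed

lemma cyl_sets: "{\<omega>. \<forall>i\<le>n. \<omega> i = z i} \<in> sets (M u)"
proof -
  have "{\<omega> \<in> space (M u). \<forall>i\<le>n. \<omega> i = z i} \<in> sets (M u)" by measurable
  then show ?thesis by simp
qed

text \<open>Events of the natural filtration, described by insensitivity to later coordinates. Since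
  there are countably many vertices, each is a countable union of cylinders and therefore
  measurable.\<close>

definition past :: "nat \<Rightarrow> (nat \<Rightarrow> 'v) set \<Rightarrow> bool" where
  "past n A \<longleftrightarrow> (\<forall>\<omega> \<omega>'. (\<forall>i\<le>n. \<omega> i = \<omega>' i) \<longrightarrow> \<omega> \<in> A \<longrightarrow> \<omega>' \<in> A)"

text \<open>Functions in \<open>PiE\<close> are \<open>undefined\<close> beyond \<open>n\<close>,
  which selects one index per cylinder; whether such a function lies in \<open>A\<close> depends on
  its values up to \<open>n\<close> only.\<close>

lemma past_decomp:
  assumes "past n A"
  defines "I \<equiv> {s \<in> PiE {..n} (\<lambda>_. UNIV). s \<in> A}"
  shows "countable I" "A = (\<Union>s\<in>I. {\<omega>. \<forall>i\<le>n. \<omega> i = s i})"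
    "disjoint_family_on (\<lambda>s. {\<omega>. \<forall>i\<le>n. \<omega> i = s i}) I"
proof -
  have "countable (PiE {..n} (\<lambda>_. UNIV :: 'v set))"
    using countable_V by (intro countable_PiE) auto
  then show "countable I" unfolding I_def by (rule countable_subset[rotated]) auto
  show "A = (\<Union>s\<in>I. {\<omega>. \<forall>i\<le>n. \<omega> i = s i})"
  proof (intro equalityI subsetI)
    fix \<omega> assume "\<omega> \<in> A"
    then have "restrict \<omega> {..n} \<in> A" using assms(1) unfolding past_def by (metis atMost_iff restrict_apply')
    then have "restrict \<omega> {..n} \<in> I" by (auto simp: I_def)
    moreover have "\<forall>i\<le>n. \<omega> i = restrict \<omega> {..n} i" by simp
    ultimately show "\<omega> \<in> (\<Union>s\<in>I. {\<omega>. \<forall>i\<le>n. \<omega> i = s i})" by blast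
  next
    fix \<omega> assume "\<omega> \<in> (\<Union>s\<in>I. {\<omega>. \<forall>i\<le>n. \<omega> i = s i})"
    then obtain s where "s \<in> A" "\<forall>i\<le>n. \<omega> i = s i" by (auto simp: I_def)
    then show "\<omega> \<in> A" using assms(1) unfolding past_def by metis
  qed
  have "s = s'" if "s \<in> I" "s' \<in> I" "\<forall>i\<le>n. \<omega> i = s i" "\<forall>i\<le>n. \<omega> i = s' i" for s s' \<omega>
  proof
    fix i show "s i = s' i" using that by (cases "i \<le> n") (auto simp: I_def PiE_def extensional_def)
  qed
  then show "disjoint_family_on (\<lambda>s. {\<omega>. \<forall>i\<le>n. \<omega> i = s i}) I"
    by (auto simp: disjoint_family_on_def)
qed

lemma past_sets:
  assumes "past n A"
  shows "A \<in> sets (M u)"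
  by (subst past_decomp(2)[OF assms], rule sets.countable_UN'[OF past_decomp(1)[OF assms]]) (use cyl_sets in auto)

lemma past_emeasure:
  assumes "past n A" "B \<in> sets (M u)"
  shows "emeasure (M u) (A \<inter> B) =
    (\<integral>\<^sup>+s. emeasure (M u) ({\<omega>. \<forall>i\<le>n. \<omega> i = s i} \<inter> B) \<partial>count_space {s \<in> PiE {..n} (\<lambda>_. UNIV). s \<in> A})"
proof -
  let ?I = "{s \<in> PiE {..n} (\<lambda>_. UNIV). s \<in> A}"
  have "A \<inter> B = (\<Union>s\<in>?I. {\<omega>. \<forall>i\<le>n. \<omega> i = s i} \<inter> B)"
    by (subst past_decomp(2)[OF assms(1)]) auto
  moreover have "emeasure (M u) (\<Union>s\<in>?I. {\<omega>. \<forall>i\<le>n. \<omega> i = s i} \<inter> B) =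
    (\<integral>\<^sup>+s. emeasure (M u) ({\<omega>. \<forall>i\<le>n. \<omega> i = s i} \<inter> B) \<partial>count_space ?I)"
  proof (rule emeasure_UN_countable)
    show "countable ?I" by (rule past_decomp(1)[OF assms(1)])
    show "disjoint_family_on (\<lambda>s. {\<omega>. \<forall>i\<le>n. \<omega> i = s i} \<inter> B) ?I"
      using past_decomp(3)[OF assms(1)] unfolding disjoint_family_on_def by blast
  qed (intro sets.Int cyl_sets assms(2))
  ultimately show ?thesis by simp
qed

text \<open>On a single cylinder the step to \<open>y\<close> contributes one more factor
  \<open>p x y\<close>; summation over the countably many cylinders of \<open>A\<close> gives the
  general case.\<close>

lemma markov_point:
  assumes "past n A"
  shows "emeasure (M u) (A \<inter> {\<omega>. \<omega> n = x} \<inter> {\<omega>. \<omega> (Suc n) = y}) =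
    emeasure (M u) (A \<inter> {\<omega>. \<omega> n = x}) * ennreal (p x y)"
proof -
  let ?A = "A \<inter> {\<omega>. \<omega> n = x}"
  have pA: "past n ?A" using assms by (auto simp: past_def)
  let ?I = "{s \<in> PiE {..n} (\<lambda>_. UNIV). s \<in> ?A}"
  let ?c = "\<lambda>s. {\<omega>. \<forall>i\<le>n. \<omega> i = s i}"
  have B: "{\<omega>. \<omega> (Suc n) = y} \<in> sets (M u)"
  proof -
    have "{\<omega> \<in> space (M u). \<omega> (Suc n) = y} \<in> sets (M u)" by measurable
    then show ?thesis by simp
  qed
  have s: "emeasure (M u) (?c s \<inter> {\<omega>. \<omega> (Suc n) = y}) = emeasure (M u) (?c s) * ennreal (p x y)"
    if "s \<in> ?I" for s
  proof -
    let ?s = "s(Suc n := y)"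
    have e: "?c s \<inter> {\<omega>. \<omega> (Suc n) = y} = {\<omega>. \<forall>i\<le>Suc n. \<omega> i = ?s i}"
      by (auto simp: le_Suc_eq)
    have "(\<Prod>i<n. p (?s i) (?s (Suc i))) = (\<Prod>i<n. p (s i) (s (Suc i)))"
      by (rule prod.cong) auto
    moreover have "s n = x" using that by simp
    ultimately have "(\<Prod>i<Suc n. p (?s i) (?s (Suc i))) = (\<Prod>i<n. p (s i) (s (Suc i))) * p x y"
      by simp
    moreover have "?s 0 = s 0" by simp
    ultimately show ?thesis unfolding e M_eq_cylinder
      by (simp add: ennreal_mult' prod_nonneg del: prod.lessThan_Suc fun_upd_apply)
  qed
  have "emeasure (M u) (?A \<inter> {\<omega>. \<omega> (Suc n) = y}) =
     (\<integral>\<^sup>+s. emeasure (M u) (?c s) * ennreal (p x y) \<partial>count_space ?I)"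
    unfolding past_emeasure[OF pA B] by (rule nn_integral_cong) (use s in auto)
  also have "\<dots> = (\<integral>\<^sup>+s. emeasure (M u) (?c s) \<partial>count_space ?I) * ennreal (p x y)"
    by (rule nn_integral_multc) simp
  also have "(\<integral>\<^sup>+s. emeasure (M u) (?c s) \<partial>count_space ?I) = emeasure (M u) ?A"
    using past_emeasure[OF pA sets.top[of "M u"]] by simp
  finally show ?thesis .
qed

lemma coord_set [measurable]: "{\<omega>. \<omega> n \<in> B} \<in> sets (M u)"
  using measurable_sets[OF walk_coord_measurable[of n p u], of B]
  by (simp add: vimage_def)

lemma coord_eq_set [measurable]: "{\<omega>. \<omega> n = x} \<in> sets (M u)"
  using coord_set[of n "{x}"] by simp

lemma nn_split_coord:
  assumes [measurable]: "A \<in> sets (M u)"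
  shows "(\<integral>\<^sup>+\<omega>. indicator A \<omega> * f (\<omega> n) \<partial>M u) =
    (\<integral>\<^sup>+x. emeasure (M u) (A \<inter> {\<omega>. \<omega> n = x}) * f x \<partial>count_space UNIV)"
proof -
  have "(\<integral>\<^sup>+\<omega>. indicator A \<omega> * f (\<omega> n) \<partial>M u) =
     (\<integral>\<^sup>+\<omega>. \<integral>\<^sup>+x. indicator (A \<inter> {\<omega>. \<omega> n = x}) \<omega> * f x \<partial>count_space UNIV \<partial>M u)"
  proof (rule nn_integral_cong)
    fix \<omega>
    have "(\<integral>\<^sup>+x. indicator (A \<inter> {\<omega>. \<omega> n = x}) \<omega> * f x \<partial>count_space UNIV) =
      (\<integral>\<^sup>+x. (indicator A \<omega> * f x) * indicator {\<omega> n} x \<partial>count_space UNIV)"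
      by (rule nn_integral_cong) (auto split: split_indicator)
    also have "\<dots> = indicator A \<omega> * f (\<omega> n)" by simp
    finally show "indicator A \<omega> * f (\<omega> n) =
      (\<integral>\<^sup>+x. indicator (A \<inter> {\<omega>. \<omega> n = x}) \<omega> * f x \<partial>count_space UNIV)" by simp
  qed
  also have "\<dots> = (\<integral>\<^sup>+x. \<integral>\<^sup>+\<omega>. indicator (A \<inter> {\<omega>. \<omega> n = x}) \<omega> * f x \<partial>M u \<partial>count_space UNIV)"
    by (rule nn_integral_count_space_nn_integral[OF countable_V]) measurable
  also have "\<dots> = (\<integral>\<^sup>+x. emeasure (M u) (A \<inter> {\<omega>. \<omega> n = x}) * f x \<partial>count_space UNIV)"
    by (rule nn_integral_cong) (simp add: nn_integral_multc)
  finally show ?thesis .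
qed

text \<open>\<open>markov_point\<close> summed over the values of \<open>\<omega> n\<close> and
  \<open>\<omega> (Suc n)\<close>; nonnegativity permits every exchange of sums.\<close>

lemma markov:
  assumes A: "past n A"
  shows "(\<integral>\<^sup>+\<omega>. indicator A \<omega> * f (\<omega> (Suc n)) \<partial>M u) =
    (\<integral>\<^sup>+\<omega>. indicator A \<omega> * (\<integral>\<^sup>+y. f y \<partial>K (\<omega> n)) \<partial>M u)"
proof -
  have [measurable]: "A \<in> sets (M u)" using past_sets[OF A] .
  have e: "emeasure (M u) (A \<inter> {\<omega>. \<omega> (Suc n) = y}) =
     (\<integral>\<^sup>+x. emeasure (M u) (A \<inter> {\<omega>. \<omega> n = x}) * ennreal (p x y) \<partial>count_space UNIV)" for y
  proof -
    have "emeasure (M u) (A \<inter> {\<omega>. \<omega> (Suc n) = y}) =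
       (\<integral>\<^sup>+\<omega>. indicator (A \<inter> {\<omega>. \<omega> (Suc n) = y}) \<omega> * 1 \<partial>M u)" by simp
    also have "\<dots> = (\<integral>\<^sup>+x. emeasure (M u) (A \<inter> {\<omega>. \<omega> (Suc n) = y} \<inter> {\<omega>. \<omega> n = x}) \<partial>count_space UNIV)"
      by (subst nn_split_coord[where f = "\<lambda>_. 1" and n = n]) auto
    also have "\<dots> = (\<integral>\<^sup>+x. emeasure (M u) (A \<inter> {\<omega>. \<omega> n = x}) * ennreal (p x y) \<partial>count_space UNIV)"
      by (rule nn_integral_cong) (subst markov_point[OF A, symmetric], simp add: Int_ac)
    finally show ?thesis .
  qed
  have "(\<integral>\<^sup>+\<omega>. indicator A \<omega> * f (\<omega> (Suc n)) \<partial>M u) =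
    (\<integral>\<^sup>+y. (\<integral>\<^sup>+x. emeasure (M u) (A \<inter> {\<omega>. \<omega> n = x}) * ennreal (p x y) \<partial>count_space UNIV) * f y
       \<partial>count_space UNIV)"
    by (subst nn_split_coord) (simp_all add: e)
  also have "\<dots> = (\<integral>\<^sup>+y. \<integral>\<^sup>+x. emeasure (M u) (A \<inter> {\<omega>. \<omega> n = x}) * (ennreal (p x y) * f y) \<partial>count_space UNIV
       \<partial>count_space UNIV)"
    by (rule nn_integral_cong, subst nn_integral_multc[symmetric]) (simp_all add: mult.assoc)
  also have "\<dots> = (\<integral>\<^sup>+x. \<integral>\<^sup>+y. emeasure (M u) (A \<inter> {\<omega>. \<omega> n = x}) * (ennreal (p x y) * f y) \<partial>count_space UNIV
       \<partial>count_space UNIV)"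
    by (rule nn_integral_count_space_nn_integral[OF countable_V]) simp
  also have "\<dots> = (\<integral>\<^sup>+x. emeasure (M u) (A \<inter> {\<omega>. \<omega> n = x}) * (\<integral>\<^sup>+y. f y \<partial>K x) \<partial>count_space UNIV)"
    by (rule nn_integral_cong, subst nn_integral_cmult) (simp_all add: nn_integral_measure_pmf)
  also have "\<dots> = (\<integral>\<^sup>+\<omega>. indicator A \<omega> * (\<integral>\<^sup>+y. f y \<partial>K (\<omega> n)) \<partial>M u)"
    by (subst nn_split_coord) simp_all
  finally show ?thesis .
qed

lemma AE_start: "AE \<omega> in M u. \<omega> 0 = u"
proof -
  interpret prob_space "M u" by (rule prob_space_walk_law)
  have "emeasure (M u) {\<omega>. \<omega> 0 = u} = 1"
    using M_eq_cylinder[of u 0 "\<lambda>_. u"] by simp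
  then show ?thesis by (intro AE_I_eq_1) (auto simp: emeasure_eq_measure)
qed

lemma AE_step: "AE \<omega> in M u. \<forall>n. E (\<omega> n) (\<omega> (Suc n))"
proof -
  have "AE \<omega> in M u. \<not> (\<omega> n = x \<and> \<omega> (Suc n) = y)" if "\<not> E x y" for n x y
  proof -
    have "emeasure (M u) {\<omega>. \<omega> n = x \<and> \<omega> (Suc n) = y} = 0"
      using markov_point[of n UNIV u x y] that p_zero[of y x]
      by (simp add: past_def nbr_def Int_def)
    then show ?thesis by (intro AE_I[where N = "{\<omega>. \<omega> n = x \<and> \<omega> (Suc n) = y}"])
       (use sets.Int[OF coord_eq_set[of n x u] coord_eq_set[of "Suc n" y u]] in \<open>auto simp: Int_def\<close>)
  qed
  then have "AE \<omega> in M u. \<forall>x\<in>UNIV. \<forall>y\<in>UNIV. \<not> E x y \<longrightarrow> \<not> (\<omega> n = x \<and> \<omega> (Suc n) = y)" for n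
    by (intro AE_ball_countable[THEN iffD2] countable_V ballI) (auto intro: AE_mp)
  then have "AE \<omega> in M u. \<forall>n. \<forall>x\<in>UNIV. \<forall>y\<in>UNIV. \<not> E x y \<longrightarrow> \<not> (\<omega> n = x \<and> \<omega> (Suc n) = y)"
    by (simp add: AE_all_countable)
  then show ?thesis by (rule AE_mp) auto
qed

section \<open>Iterates of the transition operator\<close>

lemma step_mono: "(\<And>w. f w \<le> g w) \<Longrightarrow> step f u \<le> step g u"
  unfolding step_def by (intro sum_mono mult_left_mono) auto

lemma step_nonneg: "(\<And>w. 0 \<le> f w) \<Longrightarrow> 0 \<le> step f u"
  unfolding step_def by (intro sum_nonneg mult_nonneg_nonneg) auto

lemma step_const: "step (\<lambda>_. c) u = c"
  using sum_p[of u] by (simp add: step_def flip: sum_distrib_right)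

lemma step_diff: "step (\<lambda>w. f w - g w) u = step f u - step g u"
  by (simp add: step_def right_diff_distrib sum_subtractf)

lemma step_cmult: "step (\<lambda>w. c * f w) u = c * step f u"
  by (simp add: step_def sum_distrib_left mult.left_commute)

lemma iter_nonneg: "(\<And>w. 0 \<le> f w) \<Longrightarrow> 0 \<le> (step ^^ n) f u"
  by (induction n arbitrary: u) (auto intro: step_nonneg)

lemma iter_mono: "(\<And>w. f w \<le> g w) \<Longrightarrow> (step ^^ n) f u \<le> (step ^^ n) g u"
  by (induction n arbitrary: u) (auto intro: step_mono)

lemma iter_diff: "(step ^^ n) (\<lambda>w. f w - g w) u = (step ^^ n) f u - (step ^^ n) g u"
proof (induction n arbitrary: u)
  case (Suc n)
  then have "(step ^^ n) (\<lambda>w. f w - g w) = (\<lambda>w. (step ^^ n) f w - (step ^^ n) g w)" by auto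
  then show ?case by (simp add: step_diff)
qed simp

lemma iter_cmult: "(step ^^ n) (\<lambda>w. c * f w) u = c * (step ^^ n) f u"
proof (induction n arbitrary: u)
  case (Suc n)
  then have "(step ^^ n) (\<lambda>w. c * f w) = (\<lambda>w. c * (step ^^ n) f w)" by auto
  then show ?case by (simp add: step_cmult)
qed simp

lemma iter_harmonic: "(\<And>u. step f u = f u) \<Longrightarrow> (step ^^ n) f u = f u"
proof (induction n arbitrary: u)
  case (Suc n)
  then have "(step ^^ n) f = f" by auto
  then show ?case using Suc.prems by simp
qed simp

text \<open>Rows have finite support, so the infinite sums of \<open>n_step\<close> become powers of
  the finite operator \<open>step\<close>.\<close>

lemma n_step_eq: "n_step p n u v = (step ^^ n) (\<lambda>w. of_bool (w = v)) u"
  by (induction n arbitrary: u) (auto simp: infsum_p step_def)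

lemma nn_expectation_coord:
  assumes "\<And>w. 0 \<le> f w"
  shows "(\<integral>\<^sup>+\<omega>. ennreal (f (\<omega> n)) \<partial>M u) = ennreal ((step ^^ n) f u)"
  using assms
proof (induction n arbitrary: f)
  case 0
  interpret prob_space "M u" by (rule prob_space_walk_law)
  have "(\<integral>\<^sup>+\<omega>. ennreal (f (\<omega> 0)) \<partial>M u) = (\<integral>\<^sup>+\<omega>. ennreal (f u) \<partial>M u)"
    using AE_start[of u] by (intro nn_integral_cong_AE) auto
  then show ?case by (simp add: emeasure_space_1[simplified])
next
  case (Suc n)
  have "(\<integral>\<^sup>+\<omega>. ennreal (f (\<omega> (Suc n))) \<partial>M u) = (\<integral>\<^sup>+\<omega>. ennreal (step f (\<omega> n)) \<partial>M u)"
    using markov[where n = n and A = UNIV and f = "\<lambda>x. ennreal (f x)" and u = u] nn_integral_K[of f] Suc.prems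
    by (simp add: past_def)
  also have "\<dots> = ennreal ((step ^^ n) (step f) u)"
    by (rule Suc.IH) (auto intro: step_nonneg Suc.prems)
  finally show ?case by (simp add: funpow_swap1)
qed

lemma measure_coord: "measure (M u) {\<omega>. \<omega> n \<in> B} = (step ^^ n) (indicator B) u"
proof -
  have "emeasure (M u) {\<omega>. \<omega> n \<in> B} = (\<integral>\<^sup>+\<omega>. ennreal (indicator B (\<omega> n)) \<partial>M u)"
    by (subst nn_integral_indicator[symmetric], simp, intro nn_integral_cong) (auto split: split_indicator)
  also have "\<dots> = ennreal ((step ^^ n) (indicator B) u)"
    by (rule nn_expectation_coord) simp
  finally show ?thesis by (simp add: measure_def iter_nonneg)
qed

text \<open>Optional stopping for the nonnegative supermartingale \<open>g (Z\<^sub>n)\<close>, stopped at the first visit to \<open>t\<close>.\<close>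

lemma hit_prob_superharmonic:
  assumes g: "\<And>w. 0 \<le> g w" and super: "\<And>w. step g w \<le> g w"
  shows "hit_prob p v t * g t \<le> g v"
proof -
  interpret prob_space "M v" by (rule prob_space_walk_law)
  define A where "A n = {\<omega>. \<forall>k\<le>n. \<omega> k \<noteq> t}" for n :: nat
  define B where "B n = {\<omega>. \<exists>k\<le>n. \<omega> k = t}" for n :: nat
  have pA: "past n (A n)" and pB: "past n (B n)" for n by (auto simp: past_def A_def B_def)
  have [measurable]: "(\<lambda>\<omega>. ennreal (g (\<omega> n))) \<in> borel_measurable (M v)" for n
    by (rule measurable_compose[OF walk_coord_measurable]) simp
  note [measurable] = past_sets[OF pA] past_sets[OF pB]
  \<comment> \<open>The stopped mass valued at \<open>g t\<close> plus the contribution of the paths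
    not yet stopped: the expectation of the stopped process at time \<open>n\<close>.\<close>
  have main: "emeasure (M v) (B n) * ennreal (g t) + (\<integral>\<^sup>+\<omega>. indicator (A n) \<omega> * ennreal (g (\<omega> n)) \<partial>M v)
      \<le> ennreal (g v)" for n
  proof (induction n)
    case 0
    have "emeasure (M v) (B 0) * ennreal (g t) = (\<integral>\<^sup>+\<omega>. indicator (B 0) \<omega> * ennreal (g t) \<partial>M v)"
      by (simp add: nn_integral_multc)
    then have "emeasure (M v) (B 0) * ennreal (g t) + (\<integral>\<^sup>+\<omega>. indicator (A 0) \<omega> * ennreal (g (\<omega> 0)) \<partial>M v)
       = (\<integral>\<^sup>+\<omega>. indicator (B 0) \<omega> * ennreal (g t) + indicator (A 0) \<omega> * ennreal (g (\<omega> 0)) \<partial>M v)"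
      by (simp add: nn_integral_add)
    also have "\<dots> = (\<integral>\<^sup>+\<omega>. ennreal (g (\<omega> 0)) \<partial>M v)"
      by (rule nn_integral_cong) (auto simp: A_def B_def split: split_indicator)
    also have "\<dots> = ennreal (g v)" using nn_expectation_coord[where f = g and n = 0 and u = v] g by simp
    finally show ?case by simp
  next
    case (Suc n)
    let ?N = "A n \<inter> {\<omega>. \<omega> (Suc n) = t}"
    have "B (Suc n) = B n \<union> ?N" "B n \<inter> ?N = {}" by (auto simp: A_def B_def le_Suc_eq)
    then have b: "emeasure (M v) (B (Suc n)) = emeasure (M v) (B n) + emeasure (M v) ?N"
      by (simp add: plus_emeasure)
    have "emeasure (M v) ?N * ennreal (g t) + (\<integral>\<^sup>+\<omega>. indicator (A (Suc n)) \<omega> * ennreal (g (\<omega> (Suc n))) \<partial>M v)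
      = (\<integral>\<^sup>+\<omega>. indicator ?N \<omega> * ennreal (g t) + indicator (A (Suc n)) \<omega> * ennreal (g (\<omega> (Suc n))) \<partial>M v)"
      by (simp add: nn_integral_add nn_integral_multc)
    also have "\<dots> = (\<integral>\<^sup>+\<omega>. indicator (A n) \<omega> * ennreal (g (\<omega> (Suc n))) \<partial>M v)"
      by (rule nn_integral_cong) (auto simp: A_def le_Suc_eq split: split_indicator)
    also have "\<dots> = (\<integral>\<^sup>+\<omega>. indicator (A n) \<omega> * ennreal (step g (\<omega> n)) \<partial>M v)"
      using markov[OF pA, where f = "\<lambda>x. ennreal (g x)"] nn_integral_K[of g] g by simp
    also have "\<dots> \<le> (\<integral>\<^sup>+\<omega>. indicator (A n) \<omega> * ennreal (g (\<omega> n)) \<partial>M v)"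
      by (intro nn_integral_mono mult_left_mono ennreal_leI super) auto
    finally have "emeasure (M v) (B n) * ennreal (g t) + (emeasure (M v) ?N * ennreal (g t)
        + (\<integral>\<^sup>+\<omega>. indicator (A (Suc n)) \<omega> * ennreal (g (\<omega> (Suc n))) \<partial>M v))
      \<le> emeasure (M v) (B n) * ennreal (g t) + (\<integral>\<^sup>+\<omega>. indicator (A n) \<omega> * ennreal (g (\<omega> n)) \<partial>M v)"
      by (rule add_left_mono)
    also note Suc.IH
    finally show ?case unfolding b distrib_right add.assoc .
  qed
  have "emeasure (M v) (B n) * ennreal (g t) \<le> ennreal (g v)" for n
    by (rule order_trans[OF _ main[of n]]) (rule add_increasing2, simp_all)
  then have "ennreal (measure (M v) (B n) * g t) \<le> ennreal (g v)" for n
    by (simp add: emeasure_eq_measure ennreal_mult'' g)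
  then have le: "measure (M v) (B n) * g t \<le> g v" for n using g by (simp add: ennreal_le_iff)
  have "(\<lambda>n. measure (M v) (B n)) \<longlonglongrightarrow> measure (M v) (\<Union>n. B n)"
  proof (rule finite_Lim_measure_incseq)
    show "range B \<subseteq> sets (M v)" using past_sets[OF pB] by blast
    show "incseq B" unfolding incseq_def B_def using order_trans by blast
  qed
  then have "(\<lambda>n. measure (M v) (B n) * g t) \<longlonglongrightarrow> measure (M v) (\<Union>n. B n) * g t"
    by (intro tendsto_mult tendsto_const)
  moreover have "(\<Union>n. B n) = {\<omega>. \<exists>n. \<omega> n = t}" by (auto simp: B_def)
  ultimately have "(\<lambda>n. measure (M v) (B n) * g t) \<longlonglongrightarrow> hit_prob p v t * g t"
    by (simp add: hit_prob_def)
  then show ?thesis by (rule LIMSEQ_le_const2) (use le in auto)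
qed

end

section \<open>Convergence to the boundary\<close>

context rooted_tree
begin

lemma lev_0_iff: "lev v = 0 \<longleftrightarrow> v = base"
  using anc_unique[OF self_in_geo[of v] base_anc] by auto

lemma geo_nth:
  assumes "n \<le> lev v"
  shows "geo v ! n \<in> set (geo v)" "lev (geo v ! n) = n"
proof -
  show "geo v ! n \<in> set (geo v)" using assms by simp
  show "lev (geo v ! n) = n" using assms
  proof (induction v rule: tree_induct)
    case (child u v)
    show ?case
    proof (cases "n = lev v")
      case True
      then show ?thesis using anc_lev[OF self_in_geo[of v]] by simp
    next
      case False
      then have "n \<le> lev u" using child.prems lev_ch[OF child.hyps] by simp
      then show ?thesis using child.IH by (simp add: geo_ch[OF child.hyps] nth_append)
    qed
  qed simp
qed

definition eventually_below :: "'v \<Rightarrow> (nat \<Rightarrow> 'v) \<Rightarrow> bool" where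
  "eventually_below u z \<longleftrightarrow> (\<forall>\<^sub>F k in sequentially. u \<in> set (geo (z k)))"

lemma eventually_below_unique:
  assumes "eventually_below u z" "eventually_below v z" "lev u = lev v"
  shows "u = v"
proof -
  have "\<forall>\<^sub>F k in sequentially. u \<in> set (geo (z k)) \<and> v \<in> set (geo (z k))"
    using assms by (auto simp: eventually_below_def eventually_conj_iff)
  then obtain k where "u \<in> set (geo (z k))" "v \<in> set (geo (z k))"
    by (auto simp: eventually_sequentially)
  then show ?thesis using anc_unique assms(3) by blast
qed

lemma converges_iff:
  "converges_to_end E base z x \<longleftrightarrow> x \<in> ends E \<and> (\<forall>n. eventually_below (ray x n) z)"
proof
  assume "converges_to_end E base z x"
  then show "x \<in> ends E \<and> (\<forall>n. eventually_below (ray x n) z)"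
    using bd_ray by (auto simp: converges_to_end_def branch_def eventually_below_def)
next
  assume a: "x \<in> ends E \<and> (\<forall>n. eventually_below (ray x n) z)"
  have "eventually_below u z" if "x \<in> bd u" for u
    using a that bd_iff by metis
  then show "converges_to_end E base z x"
    using a by (auto simp: converges_to_end_def branch_def eventually_below_def)
qed

lemma converges_unique:
  assumes "converges_to_end E base z x" "converges_to_end E base z y"
  shows "x = y"
proof (rule ends_eqI)
  show x: "x \<in> ends E" and y: "y \<in> ends E" using assms by (auto simp: converges_iff)
  fix n
  have "eventually_below (ray x n) z" "eventually_below (ray y n) z"
    using assms by (auto simp: converges_iff)
  then show "ray x n = ray y n"
    by (rule eventually_below_unique) (simp add: x y)
qed

text \<open>Convergence expressed by countably many events, one choice of vertex per level, so that
  measurability needs no reference to ends.\<close>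

definition convergent_walks :: "(nat \<Rightarrow> 'v) set" where
  "convergent_walks = {z. \<forall>n. \<exists>v\<in>desc base n. eventually_below v z}"

text \<open>The selected vertices of consecutive levels are ancestors of one late position of the
  walk, hence nested, and so they form a ray.\<close>

lemma converges_exists:
  assumes "z \<in> convergent_walks"
  shows "\<exists>x. converges_to_end E base z x"
proof -
  have "\<forall>n. \<exists>v. lev v = n \<and> eventually_below v z"
    using assms desc_base[THEN iffD1] unfolding convergent_walks_def by blast
  then obtain s where s: "\<And>n. lev (s n) = n" "\<And>n. eventually_below (s n) z" by metis
  have "s (Suc n) \<in> ch (s n)" for n
  proof -
    have "\<forall>\<^sub>F k in sequentially. s n \<in> set (geo (z k)) \<and> s (Suc n) \<in> set (geo (z k))"
      using s(2)[of n] s(2)[of "Suc n"] by (auto simp: eventually_below_def eventually_conj_iff)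
    then obtain k where "s n \<in> set (geo (z k))" "s (Suc n) \<in> set (geo (z k))"
      by (auto simp: eventually_sequentially)
    then have "s n \<in> set (geo (s (Suc n)))" by (rule anc_linear) (simp add: s)
    then have "s (Suc n) \<in> desc (s n) (Suc 0)" by (simp add: desc_def s)
    then show ?thesis by (simp add: desc_1)
  qed
  moreover have "s 0 = base" using s(1)[of 0] lev_0_iff by blast
  ultimately have "s \<in> rays" by (simp add: rays_def)
  then have "converges_to_end E base z (end_of s)"
    using s by (simp add: converges_iff end_of_ends ray_end_of)
  then show ?thesis by blast
qed

lemma converges_convergent_walks: "converges_to_end E base z x \<Longrightarrow> z \<in> convergent_walks"
  unfolding convergent_walks_def converges_iff using desc_base lev_ray by blast

lemma limit_end_converges:
  assumes "z \<in> convergent_walks"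
  shows "converges_to_end E base z (limit_end E base z)"
proof -
  obtain x where x: "converges_to_end E base z x" using converges_exists assms by blast
  then have "limit_end E base z = (THE x. converges_to_end E base z x)"
    by (auto simp: limit_end_def)
  also have "\<dots> = x" using x converges_unique by (intro the_equality) auto
  finally show ?thesis using x by simp
qed

lemma limit_end_bd_iff:
  assumes "z \<in> convergent_walks"
  shows "limit_end E base z \<in> bd u \<longleftrightarrow> eventually_below u z"
proof
  let ?x = "limit_end E base z"
  have c: "?x \<in> ends E" "eventually_below (ray ?x n) z" for n
    using limit_end_converges[OF assms] by (auto simp: converges_iff)
  show "eventually_below u z" if "?x \<in> bd u" using c(2)[of "lev u"] that by (simp add: bd_iff)
  assume "eventually_below u z"
  with c(2)[of "lev u"] have "ray ?x (lev u) = u"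
    by (rule eventually_below_unique) (simp add: c)
  then show "?x \<in> bd u" using c(1) by (simp add: bd_iff)
qed

lemma limit_end_default:
  "z \<notin> convergent_walks \<Longrightarrow> limit_end E base z = (SOME x. x \<in> ends E)"
  using converges_convergent_walks by (auto simp: limit_end_def)

lemma ends_nonempty: "ends E \<noteq> {}"
  using bd_nonempty[of base] bd_base by simp

lemma limit_end_in_ends: "limit_end E base z \<in> ends E"
  using limit_end_converges[of z] limit_end_default[of z] ends_nonempty
  by (cases "z \<in> convergent_walks") (auto simp: converges_iff some_in_eq)

end

lemma UNIV_sets_walk_law [simp]: "UNIV \<in> sets (walk_law p u)"
  using sets.top[of "walk_law p u"] by simp

context tree_walk
begin

lemma eventually_below_sets [measurable]: "{z. eventually_below w z} \<in> sets (M u)"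
proof -
  have "{z. eventually_below w z} = (\<Union>N. \<Inter>k\<in>{N..}. {\<omega>. \<omega> k \<in> {v. w \<in> set (geo v)}})"
    by (auto simp: eventually_below_def eventually_sequentially)
  also have "\<dots> \<in> sets (M u)"
    by (intro sets.countable_UN'' sets.countable_INT'') (auto simp del: mem_Collect_eq)
  finally show ?thesis .
qed

lemma convergent_walks_sets [measurable]: "convergent_walks \<in> sets (M u)"
proof -
  have "convergent_walks = (\<Inter>n. \<Union>v\<in>desc base n. {z. eventually_below v z})"
    by (auto simp: convergent_walks_def)
  also have "\<dots> \<in> sets (M u)"
    by (intro sets.countable_INT'' sets.finite_UN) auto
  finally show ?thesis .
qed

lemma limit_end_measurable [measurable]: "limit_end E base \<in> M u \<rightarrow>\<^sub>M end_borel E base"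
proof (rule measurable_sigma_sets[OF sets_end_borel])
  show "range bd \<subseteq> Pow (ends E)" using bd_subset_ends by auto
  show "limit_end E base \<in> space (M u) \<rightarrow> ends E" using limit_end_in_ends by simp
  fix B assume "B \<in> range bd"
  then obtain w where B: "B = bd w" by blast
  \<comment> \<open>Off \<open>convergent_walks\<close> the map \<open>limit_end\<close> is
    constant, so that part of the preimage is all or nothing.\<close>
  have "limit_end E base -` bd w \<inter> space (M u) = (convergent_walks \<inter> {z. eventually_below w z})
      \<union> (if (SOME x. x \<in> ends E) \<in> bd w then - convergent_walks else {})" (is "_ = ?R")
  proof (rule set_eqI)
    fix z
    show "z \<in> limit_end E base -` bd w \<inter> space (M u) \<longleftrightarrow> z \<in> ?R"
      by (cases "z \<in> convergent_walks") (simp_all add: limit_end_bd_iff limit_end_default)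
  qed
  also have "?R \<in> sets (M u)"
    using sets.compl_sets[OF convergent_walks_sets[of u]]
    by (intro sets.Un sets.Int) (auto simp: Compl_eq_Diff_UNIV)
  finally show "limit_end E base -` B \<inter> space (M u) \<in> sets (M u)" using B by simp
qed

lemma sets_limit_law [simp]: "sets (limit_law E base p u) = sets (end_borel E base)"
  by (simp add: limit_law_def)

lemma prob_space_limit_law: "prob_space (limit_law E base p u)"
  unfolding limit_law_def by (rule prob_space.prob_space_distr[OF prob_space_walk_law]) measurable

lemma finite_levels: "finite {v. lev v < n}"
proof -
  have "{v. lev v < n} = (\<Union>m<n. desc base m)" by (auto simp: desc_base)
  then show ?thesis by simp
qed

text \<open>By Borel-Cantelli each vertex is visited finitely often, so the walk finally stays at
  levels at least \<open>n\<close>. A step between two such vertices does not change the ancestor at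
  level \<open>n\<close>, which therefore stabilises.\<close>

lemma AE_convergent:
  assumes "transient p"
  shows "AE \<omega> in M u. \<omega> \<in> convergent_walks"
proof -
  interpret prob_space "M u" by (rule prob_space_walk_law)
  have "AE \<omega> in M u. \<forall>\<^sub>F n in sequentially. \<omega> \<in> space (M u) - {\<omega>. \<omega> n = v}" for v
  proof (rule borel_cantelli_AE1)
    have "measure (M u) {\<omega>. \<omega> n = v} = n_step p n u v" for n
      using measure_coord[of u n "{v}"] by (simp add: n_step_eq indicator_def[abs_def])
    then show "summable (\<lambda>n. measure (M u) {\<omega>. \<omega> n = v})"
      using assms by (simp add: transient_def)
  qed (auto simp: emeasure_eq_measure)
  then have "AE \<omega> in M u. \<forall>v\<in>UNIV. \<forall>\<^sub>F n in sequentially. \<omega> n \<noteq> v"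
    by (intro AE_ball_countable[THEN iffD2] countable_V ballI) simp
  with AE_step[of u] show ?thesis
  proof eventually_elim
    fix \<omega> assume st: "\<forall>n. E (\<omega> n) (\<omega> (Suc n))" and ev: "\<forall>v\<in>UNIV. \<forall>\<^sub>F n in sequentially. \<omega> n \<noteq> v"
    have "\<exists>v\<in>desc base n. eventually_below v \<omega>" for n
    proof -
      have "\<forall>\<^sub>F k in sequentially. \<forall>v\<in>{v. lev v < n}. \<omega> k \<noteq> v"
        using ev by (intro eventually_ball_finite finite_levels) auto
      then obtain N where N: "\<And>k. k \<ge> N \<Longrightarrow> n \<le> lev (\<omega> k)"
        unfolding eventually_sequentially by (metis linorder_not_less mem_Collect_eq)
      have same: "geo x ! n = geo y ! n" if "E x y" "n \<le> lev x" "n \<le> lev y" for x y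
        using that E_iff[of x y] geo_ch[of y x] geo_ch[of x y] by (auto simp: nth_append)
      let ?v = "geo (\<omega> N) ! n"
      have "geo (\<omega> (N + k)) ! n = ?v" for k
      proof (induction k)
        case (Suc k)
        have "E (\<omega> (N + k)) (\<omega> (N + Suc k))" using st by simp
        then have "geo (\<omega> (N + k)) ! n = geo (\<omega> (N + Suc k)) ! n"
          by (rule same) (auto intro: N)
        then show ?case using Suc by simp
      qed simp
      then have "?v \<in> set (geo (\<omega> k))" if "N \<le> k" for k
        using geo_nth(1)[OF N[OF that]] that by (metis le_add_diff_inverse)
      then have "eventually_below ?v \<omega>"
        unfolding eventually_below_def eventually_sequentially by blast
      moreover have "?v \<in> desc base n" using geo_nth(2)[OF N[of N]] by (simp add: desc_base)
      ultimately show ?thesis by blast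
    qed
    then show "\<omega> \<in> convergent_walks" by (simp add: convergent_walks_def)
  qed
qed

text \<open>Almost surely the walk is finally inside or finally outside the branch, according to its
  limit; dominated convergence expresses harmonic measure by the iterates of
  \<open>step\<close>.\<close>

lemma limit_law_bd_tendsto:
  assumes "transient p"
  shows "(\<lambda>n. (step ^^ n) (indicator {v. w \<in> set (geo v)}) u)
    \<longlonglongrightarrow> measure (limit_law E base p u) (bd w)"
proof -
  interpret prob_space "M u" by (rule prob_space_walk_law)
  let ?T = "{v. w \<in> set (geo v)}"
  let ?L = "limit_end E base -` bd w \<inter> space (M u)"
  have L: "?L \<in> sets (M u)" using bd_meas by (rule measurable_sets[OF limit_end_measurable])
  have "(\<lambda>n. \<integral>\<omega>. indicator {\<omega>. \<omega> n \<in> ?T} \<omega> \<partial>M u) \<longlonglongrightarrow> (\<integral>\<omega>. (indicator ?L \<omega> :: real) \<partial>M u)"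
  proof (rule integral_dominated_convergence[where w = "\<lambda>_. 1"])
    show "AE \<omega> in M u. (\<lambda>n. indicator {\<omega>. \<omega> n \<in> ?T} \<omega>) \<longlonglongrightarrow> (indicator ?L \<omega> :: real)"
      using AE_convergent[OF assms, of u]
    proof eventually_elim
      fix \<omega> assume c: "\<omega> \<in> convergent_walks"
      have "\<forall>\<^sub>F n in sequentially. indicator {\<omega>. \<omega> n \<in> ?T} \<omega> = (indicator ?L \<omega> :: real)"
      proof (cases "limit_end E base \<omega> \<in> bd w")
        case True
        then have "eventually_below w \<omega>" using limit_end_bd_iff[OF c] by simp
        then show ?thesis unfolding eventually_below_def
          by (rule eventually_mono) (use True in \<open>simp add: indicator_def\<close>)
      next
        case False
        let ?x = "limit_end E base \<omega>"
        have x: "?x \<in> ends E" "eventually_below (ray ?x (lev w)) \<omega>"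
          using limit_end_converges[OF c] by (auto simp: converges_iff)
        then have ne: "ray ?x (lev w) \<noteq> w" using False by (auto simp: bd_iff)
        \<comment> \<open>The walk is finally below another vertex of the same level, which excludes
          being below \<open>w\<close>.\<close>
        have "w \<notin> set (geo v)" if "ray ?x (lev w) \<in> set (geo v)" for v
          using anc_unique[OF that, of w] ne x by auto
        with x(2) show ?thesis unfolding eventually_below_def
          by (elim eventually_mono) (use False in \<open>auto simp: indicator_def\<close>)
      qed
      then show "(\<lambda>n. indicator {\<omega>. \<omega> n \<in> ?T} \<omega>) \<longlonglongrightarrow> (indicator ?L \<omega> :: real)"
        by (rule tendsto_eventually)
    qed
  qed (use L coord_set in \<open>auto intro!: borel_measurable_indicator simp del: mem_Collect_eq\<close>)
  moreover have "(\<integral>\<omega>. indicator {\<omega>. \<omega> n \<in> ?T} \<omega> \<partial>M u) = (step ^^ n) (indicator ?T) u" for n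
    using measure_coord[of u n ?T] by simp
  moreover have "(\<integral>\<omega>. (indicator ?L \<omega> :: real) \<partial>M u) = measure (limit_law E base p u) (bd w)"
    using L bd_meas by (simp add: limit_law_def measure_distr)
  ultimately show ?thesis by simp
qed

end

section \<open>Conductances and Green potentials\<close>

context tree_walk
begin

abbreviation m :: "'v \<Rightarrow> real" where "m \<equiv> rev_measure E base p"
abbreviation a :: "'v \<Rightarrow> real" where "a \<equiv> conductance E base p"

lemma m_base [simp]: "m base = 1"
  by (simp add: rev_measure_def)

lemma m_ch:
  assumes w: "w \<in> ch v"
  shows "m w = m v * (p v w / p w v)"
proof -
  have l: "length (geo w) - 1 = Suc (lev v)" "length (geo v) - 1 = lev v"
    using lev_ch[OF w] by simp_all
  have "geo v ! lev v = v" using anc_lev[OF self_in_geo[of v]] by simp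
  then have g: "geo w ! lev v = v" "geo w ! Suc (lev v) = w" and i: "\<And>i. i \<le> lev v \<Longrightarrow> geo w ! i = geo v ! i"
    by (auto simp: geo_ch[OF w] nth_append)
  have "m w = (\<Prod>i<Suc (lev v). p (geo w ! i) (geo w ! Suc i) / p (geo w ! Suc i) (geo w ! i))"
    unfolding rev_measure_def Let_def l ..
  also have "\<dots> = (\<Prod>i<lev v. p (geo w ! i) (geo w ! Suc i) / p (geo w ! Suc i) (geo w ! i)) * (p v w / p w v)"
    by (simp add: g)
  also have "(\<Prod>i<lev v. p (geo w ! i) (geo w ! Suc i) / p (geo w ! Suc i) (geo w ! i)) = m v"
    unfolding rev_measure_def Let_def l by (rule prod.cong) (auto simp: i)
  finally show ?thesis .
qed

lemma p_ch_pos: "w \<in> ch v \<Longrightarrow> 0 < p v w" "w \<in> ch v \<Longrightarrow> 0 < p w v"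
  by (simp_all add: p_pos_iff nbr_def E_iff)

lemma m_pos [simp]: "0 < m v"
  by (induction v rule: tree_induct) (simp_all add: m_ch p_ch_pos)

lemma par_of_ch: "w \<in> ch v \<Longrightarrow> par w = v"
  by (simp add: ch_iff)

text \<open>Detailed balance across an edge: its weight can be computed from either
  endpoint.\<close>

lemma a_ch:
  assumes "w \<in> ch v"
  shows "a w = m w * p w v" "a w = m v * p v w"
proof -
  show *: "a w = m w * p w v" using par_of_ch[OF assms] by (simp add: conductance_def)
  show "a w = m v * p v w"
    unfolding * m_ch[OF assms] using p_ch_pos[OF assms] by simp
qed

lemma a_pos: "w \<in> ch v \<Longrightarrow> 0 < a w"
  by (simp add: a_ch(1) p_ch_pos)

lemma par_notin_ch: "u \<noteq> base \<Longrightarrow> par u \<notin> ch u"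
  using lev_ch[OF par_ch, of u] lev_ch[of "par u" u] by auto

lemma nbr_eq: "nbr u = (if u = base then ch u else insert (par u) (ch u))"
  by (auto simp: nbr_def E_iff ch_iff)

lemma m_step:
  "m u * step f u = (\<Sum>w\<in>ch u. a w * f w) + (if u = base then 0 else a u * f (par u))"
proof -
  have "m u * step f u = (\<Sum>w\<in>nbr u. m u * p u w * f w)"
    by (simp add: step_def sum_distrib_left mult.assoc)
  also have "\<dots> = (\<Sum>w\<in>ch u. m u * p u w * f w) + (if u = base then 0 else m u * p u (par u) * f (par u))"
    using par_notin_ch by (simp add: nbr_eq)
  finally show ?thesis using a_ch(2)[of _ u] a_ch(1)[OF par_ch, of u] by simp
qed

lemma m_eq_sum: "m u = (\<Sum>w\<in>ch u. a w) + (if u = base then 0 else a u)"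
  using m_step[of u "\<lambda>_. 1"] by (simp add: step_const)

text \<open>The Laplacian in divergence form: the gradient flow towards the children minus the flow
  arriving from the parent.\<close>

lemma m_laplace:
  "m u * (f u - step f u) =
    (\<Sum>w\<in>ch u. a w * (f u - f w)) - (if u = base then 0 else a u * (f (par u) - f u))"
proof -
  have "m u * (f u - step f u) = m u * f u - m u * step f u" by (simp add: right_diff_distrib)
  also have "m u * f u = (\<Sum>w\<in>ch u. a w * f u) + (if u = base then 0 else a u * f u)"
    by (subst m_eq_sum) (simp add: distrib_right sum_distrib_right)
  finally show ?thesis unfolding m_step
    by (simp add: right_diff_distrib sum_subtractf)
qed

text \<open>Vanishing at infinity makes a positive maximum over the branch at \<open>w\<close>
  attained. Harmonicity carries it to all descendants, an infinite set on which \<open>f\<close>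
  would stay bounded below. The bound at \<open>par w\<close> covers the one neighbour outside the
  branch.\<close>

lemma max_principle:
  assumes fin: "\<And>\<epsilon>. 0 < \<epsilon> \<Longrightarrow> finite {v. \<epsilon> \<le> f v}"
    and harm: "\<And>v. w \<in> set (geo v) \<Longrightarrow> step f v = f v"
    and par: "w \<noteq> base \<Longrightarrow> f (par w) \<le> f u"
    and u: "w \<in> set (geo u)" "0 < f u"
  shows False
proof -
  define S where "S = {v. w \<in> set (geo v) \<and> f u \<le> f v}"
  have "finite S" unfolding S_def using fin[OF u(2)] by (rule rev_finite_subset) auto
  moreover have "u \<in> S" using u by (simp add: S_def)
  ultimately obtain v1 where v1: "v1 \<in> S" "\<And>v. v \<in> S \<Longrightarrow> f v \<le> f v1"
    using Max_in[of "f ` S"] Max_ge[of "f ` S"] by (metis (no_types, lifting) empty_iff finite_imageI image_iff image_is_empty)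
  have le: "f v \<le> f v1" if "w \<in> set (geo v)" for v
    using v1 that u \<open>u \<in> S\<close> by (cases "f u \<le> f v") (force simp: S_def)+
  have child: "f c = f v1" if "w \<in> set (geo v)" "f v = f v1" "c \<in> ch v" for v c
  proof -
    have nb: "f x \<le> f v1" if "x \<in> nbr v" for x
    proof (cases "x \<in> ch v")
      case True
      then have "w \<in> set (geo x)" using \<open>w \<in> set (geo v)\<close> anc_ch[OF True] by simp
      then show ?thesis by (rule le)
    next
      case False
      then have x: "x = par v" "v \<noteq> base" using that by (auto simp: nbr_eq split: if_splits)
      show ?thesis
      proof (cases "v = w")
        case True
        then show ?thesis using par x v1(1) by (auto simp: S_def)
      next
        case False
        then show ?thesis using par_anc[OF \<open>w \<in> set (geo v)\<close>] x le by auto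
      qed
    qed
    have "(\<Sum>x\<in>nbr v. p v x * (f v1 - f x)) = f v1 * (\<Sum>x\<in>nbr v. p v x) - step f v"
      by (simp add: step_def right_diff_distrib sum_subtractf sum_distrib_left mult.commute)
    also have "\<dots> = 0" using harm[OF that(1)] that(2) by (simp add: sum_p)
    finally have "\<forall>x\<in>nbr v. p v x * (f v1 - f x) = 0"
      using nb by (subst (asm) sum_nonneg_eq_0_iff) auto
    moreover have "c \<in> nbr v" using that(3) by (auto simp: nbr_eq)
    ultimately show ?thesis using p_ch_pos(1)[OF that(3)] by auto
  qed
  have w1: "w \<in> set (geo v1)" using v1 by (simp add: S_def)
  have "f v = f v1 \<and> w \<in> set (geo v)" if "v \<in> desc v1 k" for v k
    using that
  proof (induction k arbitrary: v)
    case (Suc k)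
    then obtain v' where v': "v' \<in> desc v1 k" "v \<in> ch v'" by (auto simp: desc_Suc)
    then show ?case using Suc.IH[OF v'(1)] child[of v' v] anc_ch[OF v'(2)] by auto
  qed (use w1 in simp)
  then have "{v. v1 \<in> set (geo v)} \<subseteq> {v. f v1 \<le> f v}" using descI by fastforce
  moreover have "0 < f v1" using u v1(1) by (auto simp: S_def)
  ultimately show False using fin[of "f v1"] infinite_below[of v1] finite_subset by blast
qed

lemma iter_add_time: "(step ^^ (n + k)) f = (step ^^ n) ((step ^^ k) f)"
  by (simp add: funpow_add)

lemma n_step_base_pos: "0 < n_step p (lev v) v base"
proof (induction v rule: tree_induct)
  case (child v w)
  have "0 < p w v * n_step p (lev v) v base" using child p_ch_pos by simp
  also have "\<dots> \<le> step (\<lambda>x. n_step p (lev v) x base) w"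
  proof -
    have "v \<in> nbr w" using child.hyps by (simp add: nbr_def E_iff)
    then show ?thesis unfolding step_def
      by (rule member_le_sum) (auto simp: n_step_eq intro!: mult_nonneg_nonneg iter_nonneg)
  qed
  also have "\<dots> = n_step p (lev w) w base"
    by (simp add: lev_ch[OF child.hyps] infsum_p step_def)
  finally show ?case .
qed simp

text \<open>Going from \<open>v\<close> to the root in \<open>k = lev v\<close> steps has positive
  probability \<open>c\<close>, so visits to \<open>v\<close> are dominated by visits to the root
  \<open>k\<close> steps later.\<close>

lemma transientI:
  assumes "\<And>u. summable (\<lambda>n. n_step p n u base)"
  shows "transient p"
  unfolding transient_def
proof (intro allI)
  fix u v
  define k where "k = lev v"
  define c where "c = n_step p k v base"
  have c: "0 < c" using n_step_base_pos by (simp add: c_def k_def)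
  have "c * n_step p n u v \<le> n_step p (n + k) u base" for n
  proof -
    have "c * n_step p n u v = (step ^^ n) (\<lambda>w. c * of_bool (w = v)) u"
      by (simp only: n_step_eq iter_cmult)
    also have "\<dots> \<le> (step ^^ n) (\<lambda>w. n_step p k w base) u"
      by (rule iter_mono) (auto simp: c_def n_step_eq intro: iter_nonneg)
    also have "\<dots> = n_step p (n + k) u base"
      by (simp add: n_step_eq[abs_def] iter_add_time)
    finally show ?thesis .
  qed
  note le = this
  have le: "n_step p n u v \<le> inverse c * n_step p (n + k) u base" for n
    using mult_left_mono[OF le[of n], of "inverse c"] c by (simp flip: mult.assoc)
  have "summable (\<lambda>n. inverse c * n_step p (n + k) u base)"
    by (intro summable_mult) (use assms[of u] in \<open>subst summable_iff_shift\<close>)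
  then show "summable (\<lambda>n. n_step p n u v)"
    by (rule summable_comparison_test'[where N = 0]) (use le in \<open>auto simp: n_step_eq iter_nonneg\<close>)
qed

end

text \<open>The function \<open>g\<close> plays the role of \<open>G(\<cdot>, o)\<close>; \<open>flow v\<close> is the net
  number of crossings of the edge from the parent of \<open>v\<close> to \<open>v\<close>.\<close>

locale green_potential = tree_walk E base p for E :: "'v \<Rightarrow> 'v \<Rightarrow> bool" and base p +
  fixes g :: "'v \<Rightarrow> real"
  assumes g_pos [simp]: "0 < g v"
    and g_dec: "w \<in> ch v \<Longrightarrow> g w < g v"
    and g_vanish: "0 < \<epsilon> \<Longrightarrow> finite {v. \<epsilon> \<le> g v}"
    and g_laplace: "g u - step g u = of_bool (u = base)"
begin

definition flow :: "'v \<Rightarrow> real" where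
  "flow v = (if v = base then 1 else a v * (g (par v) - g v))"

definition kap :: "'v \<Rightarrow> real" where
  "kap v = (if v = base then 1 / g v else 1 / g v - 1 / g (par v))"

text \<open>The weights \<open>g v * kap u\<close> on the geodesic sum to \<open>1\<close>
  (\<open>ext_const\<close>). Probabilistically such a weight is the chance that \<open>u\<close> is
  the vertex nearest to the root that the walk from \<open>v\<close> reaches; \<open>A u\<close> is
  the mean of the boundary values given this.\<close>

definition ext :: "('v \<Rightarrow> real) \<Rightarrow> 'v \<Rightarrow> real" where
  "ext A v = g v * (\<Sum>u\<in>set (geo v). kap u * A u)"

text \<open>The martingale condition: \<open>A\<close> behaves like the averages of a boundary
  function over the branches, whose masses are \<open>flow\<close>.\<close>

definition additive :: "('v \<Rightarrow> real) \<Rightarrow> bool" where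
  "additive A \<longleftrightarrow> (\<forall>v. flow v * A v = (\<Sum>w\<in>ch v. flow w * A w))"

lemma g_ne [simp]: "g v \<noteq> 0"
  by (metis g_pos less_irrefl)

lemma ch_ne_base: "w \<in> ch v \<Longrightarrow> w \<noteq> base"
  by (simp add: ch_iff)

lemma flow_base [simp]: "flow base = 1"
  by (simp add: flow_def)

lemma flow_ch: "w \<in> ch v \<Longrightarrow> flow w = a w * (g v - g w)"
  using par_of_ch ch_ne_base by (simp add: flow_def)

lemma kap_ch: "w \<in> ch v \<Longrightarrow> kap w = 1 / g w - 1 / g v"
  using par_of_ch ch_ne_base by (simp add: kap_def)

lemma flow_pos [simp]: "0 < flow v"
proof (cases "v = base")
  case False
  then show ?thesis using flow_ch[OF par_ch] a_pos[OF par_ch] g_dec[OF par_ch] by simp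
qed simp

lemma flow_ne [simp]: "flow v \<noteq> 0"
  by (metis flow_pos less_irrefl)

lemma kap_pos: "0 < kap v"
proof (cases "v = base")
  case False
  then show ?thesis using kap_ch[OF par_ch] g_dec[OF par_ch] by (simp add: frac_less2)
qed (simp add: kap_def)

text \<open>Kirchhoff's node law: \<open>g_laplace\<close> times \<open>m v\<close>, with a source
  of strength \<open>m base = 1\<close> at the root.\<close>

lemma flow_sum: "(\<Sum>w\<in>ch v. flow w) = flow v"
proof -
  have "m v * (g v - step g v) = of_bool (v = base)" using g_laplace[of v] by auto
  moreover have "(\<Sum>w\<in>ch v. flow w) = (\<Sum>w\<in>ch v. a w * (g v - g w))"
    by (rule sum.cong) (auto simp: flow_ch)
  ultimately show ?thesis unfolding m_laplace by (auto simp: flow_def split: if_splits)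
qed

lemma flow_anc_mono: "u \<in> set (geo v) \<Longrightarrow> flow v \<le> flow u"
proof (induction v rule: tree_induct)
  case (child w v)
  have "flow v \<le> (\<Sum>x\<in>ch w. flow x)"
    by (rule member_le_sum) (use child.hyps in \<open>auto intro: less_imp_le\<close>)
  then show ?case using child anc_ch[OF child.hyps] flow_sum[of w] by auto
qed simp

lemma sum_geo_ch: "w \<in> ch v \<Longrightarrow> (\<Sum>u\<in>set (geo w). f u) = f w + (\<Sum>u\<in>set (geo v). f u)"
  by (simp add: anc_ch ch_notin_geo)

lemma ext_base: "ext A base = A base"
  by (simp add: ext_def kap_def)

lemma ext_ch:
  assumes "w \<in> ch v"
  shows "ext A w = g w / g v * ext A v + (1 - g w / g v) * A w"
proof -
  have "g w * kap w = 1 - g w / g v"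
    by (simp add: kap_ch[OF assms] field_simps)
  then have "(1 - g w / g v) * A w = g w * kap w * A w" by simp
  then show ?thesis
    by (simp add: ext_def sum_geo_ch[OF assms] algebra_simps)
qed

lemma ext_diff:
  assumes "w \<in> ch v"
  shows "A w - ext A w = g w / g v * (A w - ext A v)"
    and "ext A w - ext A v = (1 - g w / g v) * (A w - ext A v)"
  by (simp_all add: ext_ch[OF assms] algebra_simps)

text \<open>The increment of \<open>ext A\<close> carries the factor \<open>1 - g w / g v\<close>,
  and \<open>a w\<close> times this is \<open>flow w / g v\<close>.\<close>

lemma conductance_ext_diff:
  assumes "w \<in> ch v"
  shows "a w * (ext A w - ext A v) = flow w / g v * (A w - ext A v)"
proof -
  have "a w * (1 - g w / g v) = flow w / g v" by (simp add: flow_ch[OF assms] field_simps)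
  then show ?thesis unfolding ext_diff(2)[OF assms] by (simp flip: mult.assoc)
qed

lemma sum_conductance_ext_diff:
  assumes "additive A"
  shows "(\<Sum>w\<in>ch v. a w * (ext A w - ext A v)) = flow v / g v * (A v - ext A v)"
proof -
  have "(\<Sum>w\<in>ch v. a w * (ext A w - ext A v)) = (\<Sum>w\<in>ch v. (flow w * A w - flow w * ext A v) / g v)"
  proof (rule sum.cong)
    fix w assume "w \<in> ch v"
    show "a w * (ext A w - ext A v) = (flow w * A w - flow w * ext A v) / g v"
      unfolding conductance_ext_diff[OF \<open>w \<in> ch v\<close>] by (simp add: right_diff_distrib diff_divide_distrib)
  qed simp
  also have "\<dots> = ((\<Sum>w\<in>ch v. flow w * A w) - (\<Sum>w\<in>ch v. flow w) * ext A v) / g v"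
    by (simp only: sum_distrib_right sum_subtractf[symmetric] sum_divide_distrib)
  also have "(\<Sum>w\<in>ch v. flow w * A w) = flow v * A v"
    using assms unfolding additive_def by metis
  finally show ?thesis by (simp add: flow_sum right_diff_distrib diff_divide_distrib)
qed

lemma ext_const: "ext (\<lambda>_. 1) v = 1"
proof (induction v rule: tree_induct)
  case (child u v)
  then show ?case by (simp add: ext_ch[OF child.hyps])
qed (simp add: ext_base)

text \<open>The node law for the current: \<open>flow u / g u * (A u - ext A u)\<close> leaves
  towards the children by additivity, and the same amount arrives from the parent by
  \<open>ext_diff\<close>. At the root it is \<open>0\<close>.\<close>

lemma ext_harmonic:
  assumes "additive A"
  shows "step (ext A) u = ext A u"
proof -
  have s: "(\<Sum>w\<in>ch u. a w * (ext A u - ext A w)) = - (flow u / g u * (A u - ext A u))"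
    unfolding sum_conductance_ext_diff[OF assms, symmetric]
    by (simp add: sum_negf[symmetric] algebra_simps)
  have "m u * (ext A u - step (ext A) u) = 0"
  proof (cases "u = base")
    case True
    then show ?thesis unfolding m_laplace s by (simp add: ext_base)
  next
    case False
    then have u: "u \<in> ch (par u)" by (rule par_ch)
    have "a u * (ext A (par u) - ext A u) = - (flow u / g (par u) * (A u - ext A (par u)))"
      using conductance_ext_diff[OF u, of A] by (simp add: algebra_simps)
    also have "\<dots> = - (flow u / g u * (A u - ext A u))"
      unfolding ext_diff(1)[OF u] by simp
    finally show ?thesis unfolding m_laplace s using False by simp
  qed
  then show ?thesis using m_pos[of u] by (auto simp: less_le)
qed

lemma n_step_base_partial: "(\<Sum>k<n. n_step p k u base) = g u - (step ^^ n) g u"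
proof (induction n)
  case (Suc n)
  have "(step ^^ n) g u - (step ^^ Suc n) g u = (step ^^ n) (\<lambda>w. g w - step g w) u"
    by (simp add: iter_diff funpow_swap1)
  also have "\<dots> = n_step p n u base" unfolding g_laplace n_step_eq ..
  finally show ?case using Suc by simp
qed simp

lemma summable_n_step_base: "summable (\<lambda>n. n_step p n u base)"
proof (rule summableI_nonneg_bounded)
  show "0 \<le> n_step p n u base" for n by (simp add: n_step_eq iter_nonneg)
  show "(\<Sum>k<n. n_step p k u base) \<le> g u" for n
    unfolding n_step_base_partial using iter_nonneg[of g n u] g_pos by (simp add: less_imp_le)
qed

lemma transient: "transient p"
  by (rule transientI) (rule summable_n_step_base)

text \<open>Riesz decomposition: \<open>g - Green\<close> is the limit of the iterates of
  \<open>g\<close>, hence harmonic and between \<open>0\<close> and \<open>g\<close>. As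
  \<open>g\<close> vanishes at infinity, the maximum principle removes it.\<close>

lemma Green_base: "Green p u base = g u"
proof -
  define r where "r u = g u - Green p u base" for u
  have lim: "(\<lambda>n. (step ^^ n) g u) \<longlonglongrightarrow> r u" for u
  proof -
    have "(\<lambda>n. \<Sum>k<n. n_step p k u base) \<longlonglongrightarrow> Green p u base"
      unfolding Green_def using summable_n_step_base by (rule summable_LIMSEQ)
    then have "(\<lambda>n. g u - (\<Sum>k<n. n_step p k u base)) \<longlonglongrightarrow> r u"
      unfolding r_def by (intro tendsto_intros)
    then show ?thesis by (simp add: n_step_base_partial)
  qed
  have r0: "0 \<le> r u" for u
    by (rule LIMSEQ_le_const[OF lim]) (intro exI[of _ 0] allI impI iter_nonneg less_imp_le g_pos)
  have "(\<lambda>n. step ((step ^^ n) g) u) \<longlonglongrightarrow> step r u" for u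
    by (simp only: step_def[of "(step ^^ _) g"] step_def[of r]) (intro tendsto_intros lim)
  moreover have "(\<lambda>n. (step ^^ Suc n) g u) \<longlonglongrightarrow> r u" for u
    using LIMSEQ_Suc[OF lim[of u]] .
  ultimately have rh: "step r u = r u" for u by (auto intro: LIMSEQ_unique)
  have rg: "r u \<le> g u" for u
    unfolding r_def Green_def
    using suminf_nonneg[OF summable_n_step_base[of u]] by (simp add: n_step_eq iter_nonneg)
  have "finite {v. \<epsilon> \<le> r v}" if "0 < \<epsilon>" for \<epsilon>
    using g_vanish[OF that] by (rule rev_finite_subset) (use rg order_trans in blast)
  then have "\<not> 0 < r u" using max_principle[of r base u] rh by auto
  then show ?thesis using r0[of u] by (simp add: r_def)
qed

section \<open>Harmonic measure of the branches\<close>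

lemma iter_g_tendsto_0: "(\<lambda>n. (step ^^ n) g u) \<longlonglongrightarrow> 0"
proof -
  have "(\<lambda>n. \<Sum>k<n. n_step p k u base) \<longlonglongrightarrow> g u"
    unfolding Green_base[symmetric] Green_def using summable_n_step_base by (rule summable_LIMSEQ)
  then have "(\<lambda>n. g u - (\<Sum>k<n. n_step p k u base)) \<longlonglongrightarrow> g u - g u"
    by (intro tendsto_intros)
  then show ?thesis by (simp add: n_step_base_partial)
qed

text \<open>The conditional probability of the branch at \<open>w\<close> given the branch at
  \<open>v\<close>, for branch masses \<open>flow\<close>: the average of an indicator, available
  before any measure on the ends with these masses.\<close>

definition cell :: "'v \<Rightarrow> 'v \<Rightarrow> real" where
  "cell w v = (if w \<in> set (geo v) then 1 else if v \<in> set (geo w) then flow w / flow v else 0)"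

lemma cell_bounds: "0 \<le> cell w v" "cell w v \<le> 1"
  using flow_anc_mono[of v w] flow_pos[of w] flow_pos[of v] by (auto simp: cell_def less_imp_le)

lemma additive_cell: "additive (cell w)"
  unfolding additive_def
proof
  fix v
  show "flow v * cell w v = (\<Sum>c\<in>ch v. flow c * cell w c)"
  proof (cases "w \<in> set (geo v)")
    case True
    then have "cell w c = 1" if "c \<in> ch v" for c using anc_ch[OF that] by (simp add: cell_def)
    then show ?thesis using True flow_sum[of v] by (simp add: cell_def)
  next
    case nw: False
    show ?thesis
    proof (cases "v \<in> set (geo w)")
      case False
      have "cell w c = 0" if c: "c \<in> ch v" for c
      proof -
        have "v \<in> set (geo c)" using c by (rule anc_in_ch)
        then have "c \<notin> set (geo w)" using False anc_trans by blast
        moreover from this have "w \<notin> set (geo c)" using anc_ch[OF c] nw by auto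
        ultimately show ?thesis by (simp add: cell_def)
      qed
      then show ?thesis using False nw by (simp add: cell_def)
    next
      case True
      have "v \<noteq> w" using nw by auto
      then have "w \<in> desc v (Suc (lev w - lev v - 1))"
        using descI[OF True] anc_lev[OF True] anc_unique[OF True self_in_geo] by (cases "lev w - lev v") auto
      moreover have "desc v (Suc (lev w - lev v - 1)) = (\<Union>c\<in>ch v. desc c (lev w - lev v - 1))"
        using desc_add[of v 1 "lev w - lev v - 1"] desc_1[of v] by simp
      \<comment> \<open>\<open>c0\<close> is the child of \<open>v\<close> on the way to
        \<open>w\<close>; all mass of the branch at \<open>w\<close> passes through it.\<close>
      ultimately obtain c0 where c0: "c0 \<in> ch v" "c0 \<in> set (geo w)" by (auto simp: desc_def)
      have other: "cell w c = 0" if c: "c \<in> ch v" "c \<noteq> c0" for c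
      proof -
        have "c \<notin> set (geo w)" using anc_unique[OF _ c0(2)] c lev_ch[OF c(1)] lev_ch[OF c0(1)] by auto
        moreover from this have "w \<notin> set (geo c)" using anc_ch[OF c(1)] nw by auto
        ultimately show ?thesis by (simp add: cell_def)
      qed
      have "cell w c0 = flow w / flow c0"
        using c0 anc_antisym[of c0 w] by (auto simp: cell_def)
      then have c0c: "flow c0 * cell w c0 = flow w" using flow_pos[of c0] by simp
      have "(\<Sum>c\<in>ch v. flow c * cell w c) = flow c0 * cell w c0 + (\<Sum>c\<in>ch v - {c0}. flow c * cell w c)"
        using c0(1) by (simp add: sum.remove)
      also have "\<dots> = flow w" using other c0c by simp
      also have "\<dots> = flow v * cell w v" using True nw flow_pos[of v] by (simp add: cell_def)
      finally show ?thesis by simp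
    qed
  qed
qed

text \<open>Both terms are means over the geodesic of \<open>v\<close> with weights
  \<open>g v * kap u\<close>, and \<open>cell w\<close> deviates from the value of the indicator
  only at common ancestors of \<open>v\<close> and \<open>w\<close>. Their weights add up to at most
  \<open>g v\<close> times a constant that depends on \<open>w\<close>.\<close>

lemma ext_cell_approx:
  "\<bar>ext (cell w) v - indicator {v. w \<in> set (geo v)} v\<bar> \<le> (\<Sum>u\<in>set (geo w). kap u) * g v"
proof -
  define b :: real where "b = indicator {v. w \<in> set (geo v)} v"
  have pt: "\<bar>cell w u - b\<bar> \<le> of_bool (u \<in> set (geo w))" if u: "u \<in> set (geo v)" for u
  proof (cases "u \<in> set (geo w)")
    case True
    then show ?thesis using cell_bounds[of w u] by (auto simp: b_def split: split_indicator)
  next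
    case False
    then show ?thesis using anc_total[OF u, of w] anc_trans[of w u v] u
      by (auto simp: b_def cell_def split: split_indicator)
  qed
  have "ext (cell w) v - b = ext (cell w) v - b * ext (\<lambda>_. 1) v" by (simp add: ext_const)
  also have "\<dots> = g v * (\<Sum>u\<in>set (geo v). kap u * (cell w u - b))"
    by (simp add: ext_def right_diff_distrib sum_subtractf sum_distrib_left mult.left_commute mult.commute)
  finally have "\<bar>ext (cell w) v - b\<bar> \<le> g v * (\<Sum>u\<in>set (geo v). \<bar>kap u * (cell w u - b)\<bar>)"
    using sum_abs[of "\<lambda>u. kap u * (cell w u - b)" "set (geo v)"] by (simp add: abs_mult less_imp_le)
  also have "(\<Sum>u\<in>set (geo v). \<bar>kap u * (cell w u - b)\<bar>) \<le> (\<Sum>u\<in>set (geo v). kap u * of_bool (u \<in> set (geo w)))"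
    using pt kap_pos by (intro sum_mono) (auto simp: abs_mult less_imp_le intro!: mult_left_mono)
  also have "\<dots> = (\<Sum>u\<in>set (geo v) \<inter> set (geo w). kap u)"
    by (simp add: sum.inter_restrict of_bool_def if_distrib cong: if_cong)
  also have "\<dots> \<le> (\<Sum>u\<in>set (geo w). kap u)"
    using kap_pos by (intro sum_mono2) (auto simp: less_imp_le)
  finally show ?thesis by (simp add: b_def mult.commute less_imp_le)
qed

text \<open>The iterates of \<open>step\<close> fix the harmonic function
  \<open>ext (cell w)\<close> and send the error bound, a multiple of \<open>g\<close>, to
  \<open>0\<close>; on the indicator they tend to harmonic measure.\<close>

lemma limit_law_bd: "measure (limit_law E base p u) (bd w) = ext (cell w) u"
proof (rule LIMSEQ_unique[OF limit_law_bd_tendsto[OF transient]])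
  define c where "c = (\<Sum>u\<in>set (geo w). kap u)"
  let ?f = "indicator {v. w \<in> set (geo v)} :: 'v \<Rightarrow> real"
  have "\<bar>(step ^^ n) ?f u - ext (cell w) u\<bar> \<le> c * (step ^^ n) g u" for n
  proof -
    have h: "(step ^^ n) (ext (cell w)) u = ext (cell w) u"
      by (rule iter_harmonic) (rule ext_harmonic[OF additive_cell])
    have "ext (cell w) v - ?f v \<le> c * g v" "?f v - ext (cell w) v \<le> c * g v" for v
      using ext_cell_approx[of w v] unfolding c_def by linarith+
    then have "(step ^^ n) (\<lambda>v. ext (cell w) v - ?f v) u \<le> (step ^^ n) (\<lambda>v. c * g v) u"
      "(step ^^ n) (\<lambda>v. ?f v - ext (cell w) v) u \<le> (step ^^ n) (\<lambda>v. c * g v) u"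
      by (auto intro!: iter_mono)
    then show ?thesis unfolding iter_diff iter_cmult h by linarith
  qed
  moreover have "(\<lambda>n. c * (step ^^ n) g u) \<longlonglongrightarrow> 0"
    using tendsto_mult_right_zero[OF iter_g_tendsto_0[of u]] by simp
  ultimately have "(\<lambda>n. (step ^^ n) ?f u - ext (cell w) u) \<longlonglongrightarrow> 0"
    by (intro Lim_null_comparison[where f = "\<lambda>n. (step ^^ n) ?f u - ext (cell w) u"]) auto
  then show "(\<lambda>n. (step ^^ n) ?f u) \<longlonglongrightarrow> ext (cell w) u"
    by (simp add: LIM_zero_iff)
qed

lemma limit_law_base_bd: "measure (limit_law E base p base) (bd w) = flow w"
  unfolding limit_law_bd ext_base using anc_antisym[of w base] by (auto simp: cell_def)

text \<open>Since \<open>g\<close> is superharmonic, optional stopping bounds the probability by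
  \<open>g w / g v\<close>.\<close>

lemma hit_prob_par:
  assumes "w \<in> ch v"
  shows "hit_prob p w v < 1"
proof -
  have "hit_prob p w v * g v \<le> g w"
  proof (rule hit_prob_superharmonic)
    show "step g u \<le> g u" for u using g_laplace[of u] by (cases "u = base") auto
  qed (simp add: less_imp_le)
  also have "\<dots> < 1 * g v" using g_dec[OF assms] by simp
  finally show ?thesis using g_pos[of v] mult_less_cancel_right_pos by blast
qed

end

section \<open>The energy of a harmonic extension\<close>

context rooted_tree
begin

lemma levels_sum:
  "(\<Sum>v\<in>(\<Union>n<N. desc base (Suc n)). f v) = (\<Sum>n<N. \<Sum>v\<in>desc base (Suc n). f v)"
  by (rule sum.UNION_disjoint) (auto simp: desc_base)

text \<open>Any finite set of vertices lies in finitely many levels, so for nonnegative terms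
  unordered sums and sums by levels have the same supremum.\<close>

lemma nonneg_levels:
  fixes f :: "'v \<Rightarrow> real"
  assumes nonneg: "\<And>v. v \<noteq> base \<Longrightarrow> 0 \<le> f v"
  defines "F \<equiv> \<lambda>n. \<Sum>v\<in>desc base (Suc n). f v"
  shows "f summable_on (- {base}) \<longleftrightarrow> summable F"
    and "summable F \<Longrightarrow> infsum f (- {base}) = suminf F"
proof -
  have ne: "v \<noteq> base" if "v \<in> desc base (Suc n)" for v n
    using that by (auto simp: desc_base)
  have F0: "0 \<le> F n" for n
    unfolding F_def using ne by (intro sum_nonneg nonneg) auto
  have fin: "sum f X \<le> suminf F" if X: "finite X" "X \<subseteq> - {base}" and "summable F" for X
  proof -
    obtain N where N: "\<forall>v\<in>X. lev v < N" using finite_set_levels X by blast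
    have "X \<subseteq> (\<Union>n<N. desc base (Suc n))"
    proof
      fix v assume v: "v \<in> X"
      then have "lev v \<noteq> 0" using X lev_0_iff by auto
      then obtain n where "lev v = Suc n" by (metis not0_implies_Suc)
      then show "v \<in> (\<Union>n<N. desc base (Suc n))" using N v by (auto simp: desc_base intro!: bexI[of _ n])
    qed
    then have "sum f X \<le> (\<Sum>v\<in>(\<Union>n<N. desc base (Suc n)). f v)"
      by (intro sum_mono2) (auto intro!: nonneg dest: ne)
    also have "\<dots> = (\<Sum>n<N. F n)" by (simp add: levels_sum F_def)
    also have "\<dots> \<le> suminf F" using \<open>summable F\<close> by (intro sum_le_suminf) (auto intro: F0)
    finally show ?thesis .
  qed
  have "f summable_on (- {base})" if "summable F"
  proof (rule nonneg_bounded_partial_sums_imp_summable_on[where C = "suminf F"])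
    show "0 \<le> f v" if "v \<in> - {base}" for v using nonneg that by simp
    show "\<forall>\<^sub>F X in finite_subsets_at_top (- {base}). sum f X \<le> suminf F"
      by (rule eventually_finite_subsets_at_top_weakI) (rule fin[OF _ _ that])
  qed
  note sumI = this
  have part: "(\<Sum>n<N. F n) \<le> infsum f (- {base})" if "f summable_on (- {base})" for N
  proof -
    have "sum f (\<Union>n<N. desc base (Suc n)) \<le> infsum f (- {base})"
    proof (rule finite_sum_le_infsum[OF that])
      show "(\<Union>n<N. desc base (Suc n)) \<subseteq> - {base}" using ne by blast
      show "0 \<le> f v" if "v \<in> - {base} - (\<Union>n<N. desc base (Suc n))" for v using nonneg that by blast
    qed simp
    then show ?thesis by (simp only: levels_sum F_def)
  qed
  show iff: "f summable_on (- {base}) \<longleftrightarrow> summable F"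
  proof
    assume s: "f summable_on (- {base})"
    show "summable F" by (rule summableI_nonneg_bounded[OF F0 part[OF s]])
  qed (rule sumI)
  show "infsum f (- {base}) = suminf F" if s: "summable F"
  proof (rule antisym)
    show "infsum f (- {base}) \<le> suminf F"
      by (rule infsum_le_finite_sums[OF sumI[OF s]]) (rule fin[OF _ _ s])
    show "suminf F \<le> infsum f (- {base})"
      by (rule suminf_le_const[OF s]) (rule part[OF sumI[OF s]])
  qed
qed

end

context green_potential
begin

definition spread :: "('v \<Rightarrow> real) \<Rightarrow> 'v \<Rightarrow> real" where
  "spread A v = (\<Sum>w\<in>ch v. flow w * (A w - A v)\<^sup>2)"

definition spectral_level :: "('v \<Rightarrow> real) \<Rightarrow> nat \<Rightarrow> real" where
  "spectral_level A n = (\<Sum>v\<in>desc base n. spread A v / g v)"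

definition energy_below :: "('v \<Rightarrow> real) \<Rightarrow> 'v \<Rightarrow> nat \<Rightarrow> real" where
  "energy_below A v n = (\<Sum>w\<in>desc v (Suc n). a w * (ext A w - ext A (par w))\<^sup>2)"

text \<open>With \<open>g v / flow v\<close> as the resistance of the branch below \<open>v\<close>,
  this is the least energy of a flow of strength \<open>current A v\<close>; it is the remainder
  when the energy is cut off at \<open>v\<close>.\<close>

definition defect :: "('v \<Rightarrow> real) \<Rightarrow> 'v \<Rightarrow> real" where
  "defect A v = flow v / g v * (A v - ext A v)\<^sup>2"

definition current :: "('v \<Rightarrow> real) \<Rightarrow> 'v \<Rightarrow> real" where
  "current A v = flow v / g v * (A v - ext A v)"

lemma flow_nonneg [simp]: "0 \<le> flow v" and g_nonneg [simp]: "0 \<le> g v"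
  by (simp_all add: less_imp_le)

lemma spread_nonneg: "0 \<le> spread A v"
  by (auto simp: spread_def intro!: sum_nonneg)

lemma spectral_level_nonneg: "0 \<le> spectral_level A n"
  unfolding spectral_level_def by (intro sum_nonneg divide_nonneg_nonneg spread_nonneg g_nonneg)

lemma desc_Suc_child: "w \<in> desc v (Suc n) \<Longrightarrow> w \<in> ch (par w)"
  unfolding desc_Suc using par_of_ch by fastforce

lemma energy_below_nonneg: "0 \<le> energy_below A v n"
  unfolding energy_below_def
  by (intro sum_nonneg mult_nonneg_nonneg less_imp_le[OF a_pos] zero_le_power2) (rule desc_Suc_child)

lemma defect_nonneg: "0 \<le> defect A v"
  by (simp add: defect_def)

lemma current_ch: "w \<in> ch v \<Longrightarrow> a w * (ext A w - ext A v) = current A w"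
  unfolding current_def conductance_ext_diff ext_diff(1) by simp

lemma sum_current: "additive A \<Longrightarrow> (\<Sum>w\<in>ch v. current A w) = current A v"
  using sum_conductance_ext_diff[of A v] by (simp add: current_ch current_def)

text \<open>By additivity the mean of \<open>A w - ext A v\<close> over the children is
  \<open>A v - ext A v\<close>, so \<open>spread\<close> plus the squared bias is the second moment
  about \<open>ext A v\<close>. Each of its terms is divided in the ratio
  \<open>1 - g w / g v\<close> to \<open>g w / g v\<close> into the energy of the edge and the
  defect of the child.\<close>

lemma spread_split:
  assumes "additive A"
  shows "spread A v / g v + defect A v = (\<Sum>w\<in>ch v. a w * (ext A w - ext A v)\<^sup>2 + defect A w)"
proof -
  let ?e = "A v - ext A v" and ?x = "\<lambda>w. A w - ext A v"
  have "(\<Sum>w\<in>ch v. flow w * ?x w) = (\<Sum>w\<in>ch v. flow w * A w) - (\<Sum>w\<in>ch v. flow w) * ext A v"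
    by (simp add: right_diff_distrib sum_subtractf sum_distrib_right)
  also have "(\<Sum>w\<in>ch v. flow w * A w) = flow v * A v"
    using assms unfolding additive_def by metis
  also have "flow v * A v - (\<Sum>w\<in>ch v. flow w) * ext A v = flow v * ?e"
    by (simp add: flow_sum right_diff_distrib)
  finally have x: "(\<Sum>w\<in>ch v. flow w * ?x w) = flow v * ?e" .
  have "spread A v = (\<Sum>w\<in>ch v. flow w * (?x w)\<^sup>2 - 2 * ?e * (flow w * ?x w) + flow w * ?e\<^sup>2)"
    unfolding spread_def by (rule sum.cong) (auto simp: power2_eq_square algebra_simps)
  also have "\<dots> = (\<Sum>w\<in>ch v. flow w * (?x w)\<^sup>2) - 2 * ?e * (flow v * ?e) + flow v * ?e\<^sup>2"
    unfolding x[symmetric]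
    by (simp add: sum.distrib sum_subtractf flow_sum flip: sum_distrib_left sum_distrib_right)
  also have "\<dots> = (\<Sum>w\<in>ch v. flow w * (?x w)\<^sup>2) - flow v * ?e\<^sup>2"
    by (simp add: power2_eq_square)
  finally have "spread A v / g v + defect A v = (\<Sum>w\<in>ch v. flow w * (?x w)\<^sup>2 / g v)"
    by (simp add: defect_def diff_divide_distrib flip: sum_divide_distrib)
  also have "\<dots> = (\<Sum>w\<in>ch v. a w * (ext A w - ext A v)\<^sup>2 + defect A w)"
  proof (rule sum.cong)
    fix w assume w: "w \<in> ch v"
    have "a w * (ext A w - ext A v)\<^sup>2 = (a w * (ext A w - ext A v)) * (ext A w - ext A v)"
      by (simp add: power2_eq_square)
    also have "\<dots> = flow w / g v * ?x w * ((1 - g w / g v) * ?x w)"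
      by (subst conductance_ext_diff[OF w], subst ext_diff(2)[OF w]) (rule refl)
    finally have 1: "a w * (ext A w - ext A v)\<^sup>2 = flow w / g v * (1 - g w / g v) * (?x w)\<^sup>2"
      by (simp add: power2_eq_square)
    have 2: "defect A w = flow w / g v * (g w / g v) * (?x w)\<^sup>2"
      unfolding defect_def ext_diff(1)[OF w] by (simp add: power2_eq_square)
    show "flow w * (?x w)\<^sup>2 / g v = a w * (ext A w - ext A v)\<^sup>2 + defect A w"
    proof -
      have id: "q * (1 - r) * X + q * r * X = q * X" for q r X :: real by (simp add: algebra_simps)
      show ?thesis unfolding 1 2 id by simp
    qed
  qed simp
  finally show ?thesis .
qed

lemma sum_desc_Suc_par: "(\<Sum>w\<in>desc u (Suc k). f w (par w)) = (\<Sum>v\<in>desc u k. \<Sum>w\<in>ch v. f w v)"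
  unfolding sum_desc_Suc by (intro sum.cong refl) (auto simp: par_of_ch)

text \<open>\<open>spread_split\<close> telescopes over the levels; the initial defect is
  \<open>0\<close> because \<open>ext A\<close> and \<open>A\<close> agree at the root.\<close>

lemma spectral_partial_sums:
  assumes "additive A"
  shows "(\<Sum>n<N. spectral_level A n) = (\<Sum>n<N. energy_below A base n) + (\<Sum>v\<in>desc base N. defect A v)"
proof (induction N)
  case 0
  then show ?case by (simp add: defect_def ext_base)
next
  case (Suc N)
  have "spectral_level A N + (\<Sum>v\<in>desc base N. defect A v)
      = (\<Sum>v\<in>desc base N. \<Sum>w\<in>ch v. a w * (ext A w - ext A v)\<^sup>2 + defect A w)"
    unfolding spectral_level_def by (simp add: spread_split[OF assms] flip: sum.distrib)
  also have "\<dots> = energy_below A base N + (\<Sum>v\<in>desc base (Suc N). defect A v)"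
    unfolding energy_below_def sum_desc_Suc_par[where f = "\<lambda>w v. a w * (ext A w - ext A v)\<^sup>2"]
    by (simp add: sum.distrib sum_desc_Suc)
  finally show ?case using Suc by simp
qed

text \<open>Thomson's principle: among all flows of the given strength through the branch at \<open>v\<close>, the
  gradient of \<open>g\<close> has the least energy. Since the branch is infinite, \<open>g\<close> is first replaced by the
  finitely supported function \<open>max 0 (g - \<epsilon>)\<close>.\<close>

lemma defect_le_energy:
  assumes A: "additive A" and sum: "summable (energy_below A v)"
  shows "defect A v \<le> suminf (energy_below A v)"
proof -
  let ?T = "suminf (energy_below A v)"
  \<comment> \<open>The multiple of the gradient of \<open>g\<close> that carries the same strength:
    \<open>c * flow v = current A v\<close>.\<close>
  define c where "c = current A v / flow v"
  have main: "c\<^sup>2 * flow v * (g v - \<epsilon>) \<le> ?T" if \<epsilon>: "0 < \<epsilon>" "\<epsilon> < g v" for \<epsilon>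
  proof -
    define \<psi> where "\<psi> u = max 0 (g u - \<epsilon>)" for u
    obtain N where N: "\<forall>u\<in>{u. \<epsilon> \<le> g u}. lev u < N" using finite_set_levels g_vanish[OF \<epsilon>(1)] by blast
    have \<psi>0: "\<psi> u = 0" if "u \<in> desc v N" for u
      using that N by (force simp: desc_def \<psi>_def max_def)
    \<comment> \<open>Summation by parts, valid for every \<open>f\<close> obeying the node law; it
      is applied to \<open>current A\<close> and to \<open>flow\<close>.\<close>
    have parts: "(\<Sum>k<n. \<Sum>w\<in>desc v (Suc k). f w * (\<psi> (par w) - \<psi> w)) =
        f v * \<psi> v - (\<Sum>w\<in>desc v n. f w * \<psi> w)" if f: "\<And>u. (\<Sum>w\<in>ch u. f w) = f u" for f n
    proof (induction n)
      case (Suc n)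
      have "(\<Sum>w\<in>desc v (Suc n). f w * (\<psi> (par w) - \<psi> w))
         = (\<Sum>u\<in>desc v n. \<Sum>w\<in>ch u. f w * (\<psi> u - \<psi> w))"
        by (rule sum_desc_Suc_par[where f = "\<lambda>w u. f w * (\<psi> u - \<psi> w)"])
      also have "\<dots> = (\<Sum>u\<in>desc v n. f u * \<psi> u) - (\<Sum>w\<in>desc v (Suc n). f w * \<psi> w)"
        by (simp add: right_diff_distrib sum_subtractf sum_desc_Suc f flip: sum_distrib_right)
      finally show ?case using Suc by simp
    qed simp
    have vanish: "(\<Sum>w\<in>desc v N. f w * \<psi> w) = 0" for f :: "'v \<Rightarrow> real"
      using \<psi>0 by simp
    \<comment> \<open>Truncation shortens increments, so \<open>a w * d\<^sup>2\<close> is at most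
      \<open>flow w * d\<close>; the rest is the expansion of
      \<open>a w * (y - c * d)\<^sup>2\<close>.\<close>
    have point: "2 * c * (current A w * (\<psi> (par w) - \<psi> w)) - c\<^sup>2 * (flow w * (\<psi> (par w) - \<psi> w))
        \<le> a w * (ext A w - ext A (par w))\<^sup>2" if "w \<in> desc v (Suc k)" for w k
    proof -
      define d where "d = \<psi> (par w) - \<psi> w"
      define y where "y = ext A w - ext A (par w)"
      have w: "w \<in> ch (par w)" using that by (rule desc_Suc_child)
      have d: "0 \<le> d" "d \<le> g (par w) - g w"
        using g_dec[OF w] by (auto simp: d_def \<psi>_def)
      have "a w * d\<^sup>2 \<le> a w * (g (par w) - g w) * d"
        using d a_pos[OF w] by (simp add: power2_eq_square mult_right_mono)
      also have "\<dots> = flow w * d" by (simp add: flow_ch[OF w])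
      finally have "c\<^sup>2 * (a w * d\<^sup>2) \<le> c\<^sup>2 * (flow w * d)" by (rule mult_left_mono) simp
      moreover have "0 \<le> a w * (y - c * d)\<^sup>2" using a_pos[OF w] by simp
      moreover have "a w * (y - c * d)\<^sup>2 = a w * y\<^sup>2 - 2 * c * (a w * y * d) + c\<^sup>2 * (a w * d\<^sup>2)"
        by (simp add: power2_eq_square algebra_simps)
      moreover have "a w * y = current A w" unfolding y_def by (rule current_ch[OF w])
      ultimately show ?thesis unfolding d_def[symmetric] y_def[symmetric] by simp
    qed
    have "c\<^sup>2 * flow v * (g v - \<epsilon>) = 2 * c * (current A v * \<psi> v) - c\<^sup>2 * (flow v * \<psi> v)"
      using \<epsilon> by (simp add: \<psi>_def c_def power2_eq_square)
    also have "\<dots> = (\<Sum>k<N. \<Sum>w\<in>desc v (Suc k). 2 * c * (current A w * (\<psi> (par w) - \<psi> w))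
        - c\<^sup>2 * (flow w * (\<psi> (par w) - \<psi> w)))"
    proof -
      have "current A v * \<psi> v = (\<Sum>k<N. \<Sum>w\<in>desc v (Suc k). current A w * (\<psi> (par w) - \<psi> w))"
        "flow v * \<psi> v = (\<Sum>k<N. \<Sum>w\<in>desc v (Suc k). flow w * (\<psi> (par w) - \<psi> w))"
        using parts[of "current A" N] parts[of flow N] sum_current[OF A] flow_sum vanish by simp_all
      then show ?thesis by (simp only: sum_subtractf sum_distrib_left)
    qed
    also have "\<dots> \<le> (\<Sum>k<N. energy_below A v k)"
      unfolding energy_below_def by (intro sum_mono point)
    also have "\<dots> \<le> ?T" using sum by (intro sum_le_suminf) (auto intro: energy_below_nonneg)
    finally show ?thesis .
  qed
  have "((\<lambda>\<epsilon>. c\<^sup>2 * flow v * (g v - \<epsilon>)) \<longlongrightarrow> c\<^sup>2 * flow v * (g v - 0)) (at_right 0)"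
    by (intro tendsto_intros)
  moreover have "\<forall>\<^sub>F \<epsilon> in at_right 0. c\<^sup>2 * flow v * (g v - \<epsilon>) \<le> ?T"
    unfolding eventually_at_right_field using main g_pos by blast
  ultimately have "c\<^sup>2 * flow v * (g v - 0) \<le> ?T"
    by (rule tendsto_upperbound) simp
  moreover have "c\<^sup>2 * flow v * (g v - 0) = defect A v"
    by (simp add: c_def current_def defect_def power2_eq_square)
  ultimately show ?thesis by simp
qed

lemma energy_below_add:
  "(\<Sum>v\<in>desc base N. energy_below A v k) = energy_below A base (N + k)"
  unfolding energy_below_def add_Suc_right[symmetric] by (rule sum_desc_add[symmetric])

text \<open>Thomson's bound in each of the disjoint branches at level \<open>N\<close>; together
  their energies make up the tail of the total energy.\<close>

lemma sum_defect_le: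
  assumes A: "additive A" and sum: "summable (energy_below A base)"
  shows "(\<Sum>v\<in>desc base N. defect A v) \<le> (\<Sum>k. energy_below A base (N + k))"
proof -
  have sh: "summable (\<lambda>k. energy_below A base (N + k))"
    using summable_iff_shift[of "energy_below A base" N] sum by (simp add: add.commute)
  have sv: "summable (energy_below A v)" if "v \<in> desc base N" for v
  proof (rule summable_comparison_test'[OF sh, where N = 0])
    fix k
    have "energy_below A v k \<le> (\<Sum>v\<in>desc base N. energy_below A v k)"
      using that by (intro member_le_sum) (auto intro: energy_below_nonneg)
    then show "norm (energy_below A v k) \<le> energy_below A base (N + k)"
      by (simp add: energy_below_add energy_below_nonneg)
  qed
  have "(\<Sum>v\<in>desc base N. defect A v) \<le> (\<Sum>v\<in>desc base N. suminf (energy_below A v))"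
    by (intro sum_mono defect_le_energy[OF A] sv)
  also have "\<dots> = (\<Sum>k. \<Sum>v\<in>desc base N. energy_below A v k)"
    by (rule suminf_sum[symmetric]) (rule sv)
  finally show ?thesis by (simp add: energy_below_add)
qed

text \<open>Partial sums of the energy and of the spectral series differ by the defects, which are
  nonnegative and bounded by the tail of the energy; hence each series bounds the other.\<close>

lemma energy_spectral:
  assumes A: "additive A"
  shows "summable (energy_below A base) \<longleftrightarrow> summable (spectral_level A)"
    and "summable (energy_below A base) \<Longrightarrow> suminf (energy_below A base) = suminf (spectral_level A)"
proof -
  let ?e = "energy_below A base" and ?s = "spectral_level A"
  note ps = spectral_partial_sums[OF A]
  have up: "(\<Sum>n<N. ?s n) \<le> suminf ?e" if "summable ?e" for N
    using sum_defect_le[OF A that, of N] suminf_split_initial_segment[OF that, of N]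
    unfolding ps by (simp add: add.commute)
  have lo: "(\<Sum>n<N. ?e n) \<le> (\<Sum>n<N. ?s n)" for N
    unfolding ps by (simp add: sum_nonneg defect_nonneg)
  have se: "summable ?s" if "summable ?e"
    using up[OF that] by (intro summableI_nonneg_bounded) (auto intro: spectral_level_nonneg)
  have lo': "(\<Sum>n<N. ?e n) \<le> suminf ?s" if "summable ?s" for N
    by (rule order_trans[OF lo]) (use that in \<open>auto intro!: sum_le_suminf spectral_level_nonneg\<close>)
  have es: "summable ?e" if "summable ?s"
    using lo'[OF that] by (intro summableI_nonneg_bounded) (auto intro: energy_below_nonneg)
  show "summable ?e \<longleftrightarrow> summable ?s" using es se by blast
  show "suminf ?e = suminf ?s" if "summable ?e"
    using suminf_le_const[OF that lo'[OF se[OF that]]] suminf_le_const[OF se[OF that] up[OF that]] by simp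
qed

lemma tree_form_ext:
  assumes A: "additive A"
  shows "tree_form_term E base p (ext A) (ext A) summable_on (- {base}) \<longleftrightarrow> summable (spectral_level A)"
    and "summable (spectral_level A) \<Longrightarrow> tree_form E base p (ext A) (ext A) = suminf (spectral_level A)"
proof -
  let ?f = "tree_form_term E base p (ext A) (ext A)"
  have f: "?f v = a v * (ext A v - ext A (par v))\<^sup>2" for v
    by (simp add: tree_form_term_def power2_eq_square)
  have nn: "0 \<le> ?f v" if "v \<noteq> base" for v
    unfolding f using a_pos[OF par_ch[OF that]] by simp
  have F: "(\<lambda>n. \<Sum>v\<in>desc base (Suc n). ?f v) = energy_below A base"
    by (simp add: energy_below_def[abs_def] f)
  show "?f summable_on (- {base}) \<longleftrightarrow> summable (spectral_level A)"
    using nonneg_levels(1)[of ?f] nn energy_spectral(1)[OF A] unfolding F by blast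
  show "tree_form E base p (ext A) (ext A) = suminf (spectral_level A)" if "summable (spectral_level A)"
    unfolding tree_form_def using nonneg_levels(2)[of ?f] nn energy_spectral[OF A] that unfolding F by simp
qed

end

section \<open>Averages over the branches\<close>

locale end_measure = rooted_tree E base for E :: "'v \<Rightarrow> 'v \<Rightarrow> bool" and base :: 'v +
  fixes \<mu> :: "'v tree_end measure"
  assumes prob_mu: "prob_space \<mu>" and sets_mu: "sets \<mu> = sets (end_borel E base)"
    and bd_positive: "0 < measure \<mu> (bd v)"
begin

sublocale prob_space \<mu> by (rule prob_mu)

definition mu :: "'v \<Rightarrow> real" where "mu v = measure \<mu> (bd v)"

definition part_int :: "('v tree_end \<Rightarrow> real) \<Rightarrow> 'v \<Rightarrow> real" where
  "part_int f v = (\<integral>x. indicator (bd v) x * f x \<partial>\<mu>)"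

definition avg :: "('v tree_end \<Rightarrow> real) \<Rightarrow> 'v \<Rightarrow> real" where
  "avg f v = part_int f v / mu v"

text \<open>The conditional expectation given the branches of level \<open>n\<close>, written as a
  finite sum so that linearity and integrability are immediate.\<close>

definition level_avg :: "('v tree_end \<Rightarrow> real) \<Rightarrow> nat \<Rightarrow> 'v tree_end \<Rightarrow> real" where
  "level_avg f n x = (\<Sum>v\<in>desc base n. avg f v * indicator (bd v) x)"

lemma space_mu: "space \<mu> = ends E"
  using sets_eq_imp_space_eq[OF sets_mu] space_end_borel by simp

lemma bd_sets [measurable, simp]: "bd v \<in> sets \<mu>"
  by (simp add: sets_mu bd_meas)

lemma mu_pos [simp]: "0 < mu v"
  by (simp add: mu_def bd_positive)

lemma mu_ne [simp]: "mu v \<noteq> 0"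
  by (metis mu_pos less_irrefl)

lemma mu_nonneg [simp]: "0 \<le> mu v"
  by (simp add: mu_def)

lemma mu_base: "mu base = 1"
  using prob_space by (simp add: mu_def bd_base space_mu)

lemma indicator_children: "(indicator (bd v) x :: real) = (\<Sum>w\<in>ch v. indicator (bd w) x)"
proof -
  have "disjoint_family_on bd (ch v)"
    unfolding disjoint_family_on_def using bd_disjoint_level lev_ch by metis
  then show ?thesis
    unfolding bd_children[of v] by (intro indicator_UN_disjoint) auto
qed

lemma indicator_desc: "(indicator (bd v) x :: real) = (\<Sum>w\<in>desc v k. indicator (bd w) x)"
proof (induction k)
  case (Suc k)
  then show ?case by (simp add: sum_desc_Suc flip: indicator_children)
qed simp

lemma part_int_integrable [simp]:
  fixes f :: "'v tree_end \<Rightarrow> real"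
  shows "integrable \<mu> f \<Longrightarrow> integrable \<mu> (\<lambda>x. indicator (bd v) x * f x)"
  using integrable_mult_indicator[of "bd v" \<mu> f] by simp

lemma part_int_desc:
  assumes "integrable \<mu> f"
  shows "part_int f v = (\<Sum>w\<in>desc v k. part_int f w)"
proof -
  have "part_int f v = (\<integral>x. (\<Sum>w\<in>desc v k. indicator (bd w) x * f x) \<partial>\<mu>)"
    unfolding part_int_def by (subst indicator_desc[where k = k]) (simp add: sum_distrib_right)
  also have "\<dots> = (\<Sum>w\<in>desc v k. part_int f w)"
    unfolding part_int_def using assms by (intro Bochner_Integration.integral_sum) simp
  finally show ?thesis .
qed

lemma part_int_const: "part_int (\<lambda>_. 1) v = mu v"
  by (simp add: part_int_def mu_def)

lemma mu_desc: "mu v = (\<Sum>w\<in>desc v k. mu w)"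
  using part_int_desc[of "\<lambda>_. 1"] by (simp add: part_int_const)

lemma mu_avg: "mu v * avg f v = part_int f v"
  by (simp add: avg_def)

lemma part_int_base: "part_int f base = (\<integral>x. f x \<partial>\<mu>)"
  unfolding part_int_def by (rule Bochner_Integration.integral_cong) (auto simp: bd_base space_mu)

lemma part_int_add: "integrable \<mu> f \<Longrightarrow> integrable \<mu> g \<Longrightarrow>
    part_int (\<lambda>x. f x + g x) v = part_int f v + part_int g v"
  by (simp add: part_int_def distrib_left)

lemma part_int_diff: "integrable \<mu> f \<Longrightarrow> integrable \<mu> g \<Longrightarrow>
    part_int (\<lambda>x. f x - g x) v = part_int f v - part_int g v"
  by (simp add: part_int_def right_diff_distrib)

lemma part_int_cmult: "part_int (\<lambda>x. c * f x) v = c * part_int f v"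
  by (simp add: part_int_def mult.left_commute)

lemma avg_add: "integrable \<mu> f \<Longrightarrow> integrable \<mu> g \<Longrightarrow> avg (\<lambda>x. f x + g x) v = avg f v + avg g v"
  by (simp add: avg_def part_int_add add_divide_distrib)

lemma level_avg_integrable [simp]: "integrable \<mu> (level_avg f n)"
  unfolding level_avg_def by (intro Bochner_Integration.integrable_sum integrable_mult_right integrable_real_indicator)
    (auto simp: emeasure_eq_measure)

lemma level_avg_diff: "integrable \<mu> f \<Longrightarrow> integrable \<mu> g \<Longrightarrow>
    level_avg (\<lambda>x. f x - g x) n x = level_avg f n x - level_avg g n x"
  by (simp add: level_avg_def avg_def part_int_diff diff_divide_distrib left_diff_distrib sum_subtractf)

lemma level_avg_cmult: "level_avg (\<lambda>x. c * f x) n x = c * level_avg f n x"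
  by (simp add: level_avg_def avg_def part_int_cmult sum_distrib_left mult.assoc)

lemma level_avg_add: "integrable \<mu> f \<Longrightarrow> integrable \<mu> g \<Longrightarrow>
    level_avg (\<lambda>x. f x + g x) n x = level_avg f n x + level_avg g n x"
  by (simp add: level_avg_def avg_add distrib_right sum.distrib)

lemma level_avg_eq: "x \<in> ends E \<Longrightarrow> level_avg f n x = avg f (ray x n)"
proof -
  assume x: "x \<in> ends E"
  have "level_avg f n x = (\<Sum>v\<in>desc base n. if v = ray x n then avg f v else 0)"
    unfolding level_avg_def
    by (rule sum.cong) (use x in \<open>auto simp: desc_base bd_iff split: split_indicator\<close>)
  then show ?thesis using x by (simp add: desc_base)
qed

section \<open>Convergence of branch averages in the mean\<close>

lemma level_avg_contraction:
  assumes "integrable \<mu> f"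
  shows "(\<integral>x. \<bar>level_avg f n x\<bar> \<partial>\<mu>) \<le> (\<integral>x. \<bar>f x\<bar> \<partial>\<mu>)"
proof -
  have "(\<integral>x. \<bar>level_avg f n x\<bar> \<partial>\<mu>) \<le> (\<integral>x. (\<Sum>v\<in>desc base n. \<bar>avg f v\<bar> * indicator (bd v) x) \<partial>\<mu>)"
  proof (rule integral_mono)
    show "integrable \<mu> (\<lambda>x. \<Sum>v\<in>desc base n. \<bar>avg f v\<bar> * indicator (bd v) x)"
      by (intro Bochner_Integration.integrable_sum integrable_mult_right integrable_real_indicator)
        (auto simp: emeasure_eq_measure)
    show "\<bar>level_avg f n x\<bar> \<le> (\<Sum>v\<in>desc base n. \<bar>avg f v\<bar> * indicator (bd v) x)" for x
      unfolding level_avg_def by (rule order_trans[OF sum_abs]) (simp add: abs_mult)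
  qed simp
  also have "\<dots> = (\<Sum>v\<in>desc base n. \<bar>avg f v\<bar> * mu v)"
    by (subst Bochner_Integration.integral_sum) (auto simp: mu_def emeasure_eq_measure)
  also have "\<dots> \<le> (\<Sum>v\<in>desc base n. part_int (\<lambda>x. \<bar>f x\<bar>) v)"
  proof (rule sum_mono)
    fix v
    have "\<bar>avg f v\<bar> * mu v = \<bar>part_int f v\<bar>" by (simp add: avg_def abs_mult)
    also have "\<dots> \<le> (\<integral>x. \<bar>indicator (bd v) x * f x\<bar> \<partial>\<mu>)"
      unfolding part_int_def by (rule integral_abs_bound)
    finally show "\<bar>avg f v\<bar> * mu v \<le> part_int (\<lambda>x. \<bar>f x\<bar>) v"
      by (simp add: part_int_def abs_mult)
  qed
  also have "\<dots> = (\<integral>x. \<bar>f x\<bar> \<partial>\<mu>)"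
    using part_int_desc[of "\<lambda>x. \<bar>f x\<bar>" base n] assms by (simp add: part_int_base)
  finally show ?thesis .
qed

text \<open>Levy's convergence theorem as a property of \<open>f\<close>. The class of such
  functions is linear and closed in the mean, and it contains the indicators of branches, which
  generate the Borel sets.\<close>

definition L1_approx :: "('v tree_end \<Rightarrow> real) \<Rightarrow> bool" where
  "L1_approx f \<longleftrightarrow> integrable \<mu> f \<and> (\<lambda>n. \<integral>x. \<bar>level_avg f n x - f x\<bar> \<partial>\<mu>) \<longlonglongrightarrow> 0"

text \<open>Contraction makes the average of \<open>f - g\<close> small uniformly in
  \<open>n\<close>, so the error splits into three small terms.\<close>

lemma L1_approx_close:
  assumes f: "integrable \<mu> f"
    and ex: "\<And>\<epsilon>. 0 < \<epsilon> \<Longrightarrow> \<exists>g. L1_approx g \<and> (\<integral>x. \<bar>f x - g x\<bar> \<partial>\<mu>) < \<epsilon>"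
  shows "L1_approx f"
  unfolding L1_approx_def
proof (intro conjI f LIMSEQ_I)
  fix e :: real assume e: "0 < e"
  obtain g where g: "L1_approx g" "(\<integral>x. \<bar>f x - g x\<bar> \<partial>\<mu>) < e / 3" using ex[of "e / 3"] e by auto
  then have gi [simp]: "integrable \<mu> g" by (simp add: L1_approx_def)
  note f [simp]
  obtain N where N: "\<And>n. n \<ge> N \<Longrightarrow> \<bar>\<integral>x. \<bar>level_avg g n x - g x\<bar> \<partial>\<mu>\<bar> < e / 3"
    using g(1) e unfolding L1_approx_def LIMSEQ_iff by (metis diff_zero divide_pos_pos real_norm_def zero_less_numeral)
  have "(\<integral>x. \<bar>level_avg f n x - f x\<bar> \<partial>\<mu>) < e" if "n \<ge> N" for n
  proof -
    have "(\<integral>x. \<bar>level_avg f n x - f x\<bar> \<partial>\<mu>) \<le>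
      (\<integral>x. \<bar>level_avg (\<lambda>x. f x - g x) n x\<bar> + \<bar>level_avg g n x - g x\<bar> + \<bar>f x - g x\<bar> \<partial>\<mu>)"
      by (rule integral_mono) (auto simp: level_avg_diff)
    also have "\<dots> = (\<integral>x. \<bar>level_avg (\<lambda>x. f x - g x) n x\<bar> \<partial>\<mu>) +
        (\<integral>x. \<bar>level_avg g n x - g x\<bar> \<partial>\<mu>) + (\<integral>x. \<bar>f x - g x\<bar> \<partial>\<mu>)"
      by simp
    also have "(\<integral>x. \<bar>level_avg (\<lambda>x. f x - g x) n x\<bar> \<partial>\<mu>) \<le> (\<integral>x. \<bar>f x - g x\<bar> \<partial>\<mu>)"
      by (rule level_avg_contraction) simp
    finally show ?thesis using N[OF that] g(2) by simp
  qed
  then show "\<exists>N. \<forall>n\<ge>N. norm ((\<integral>x. \<bar>level_avg f n x - f x\<bar> \<partial>\<mu>) - 0) < e"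
    by (intro exI[of _ N]) simp
qed

lemma L1_approx_add:
  assumes "L1_approx f" "L1_approx g"
  shows "L1_approx (\<lambda>x. f x + g x)"
proof -
  have i [simp]: "integrable \<mu> f" "integrable \<mu> g" using assms by (auto simp: L1_approx_def)
  have lim: "(\<lambda>n. (\<integral>x. \<bar>level_avg f n x - f x\<bar> \<partial>\<mu>) + (\<integral>x. \<bar>level_avg g n x - g x\<bar> \<partial>\<mu>)) \<longlonglongrightarrow> 0"
    by (rule tendsto_add_zero) (use assms in \<open>simp_all add: L1_approx_def\<close>)
  have le: "(\<integral>x. \<bar>level_avg (\<lambda>x. f x + g x) n x - (f x + g x)\<bar> \<partial>\<mu>) \<le>
     (\<integral>x. \<bar>level_avg f n x - f x\<bar> \<partial>\<mu>) + (\<integral>x. \<bar>level_avg g n x - g x\<bar> \<partial>\<mu>)" for n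
  proof -
    have "(\<integral>x. \<bar>level_avg (\<lambda>x. f x + g x) n x - (f x + g x)\<bar> \<partial>\<mu>) \<le>
      (\<integral>x. \<bar>level_avg f n x - f x\<bar> + \<bar>level_avg g n x - g x\<bar> \<partial>\<mu>)"
      by (rule integral_mono) (auto simp: level_avg_add)
    then show ?thesis by simp
  qed
  have "(\<lambda>n. \<integral>x. \<bar>level_avg (\<lambda>x. f x + g x) n x - (f x + g x)\<bar> \<partial>\<mu>) \<longlonglongrightarrow> 0"
    by (rule Lim_null_comparison[OF _ lim]) (simp add: le)
  then show ?thesis by (simp add: L1_approx_def)
qed

lemma L1_approx_cmult:
  assumes "L1_approx f"
  shows "L1_approx (\<lambda>x. c * f x)"
proof -
  have "(\<integral>x. \<bar>level_avg (\<lambda>x. c * f x) n x - c * f x\<bar> \<partial>\<mu>) = \<bar>c\<bar> * (\<integral>x. \<bar>level_avg f n x - f x\<bar> \<partial>\<mu>)" for n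
    unfolding level_avg_cmult right_diff_distrib[symmetric] abs_mult by simp
  then show ?thesis
    using assms tendsto_mult_right_zero[of "\<lambda>n. \<integral>x. \<bar>level_avg f n x - f x\<bar> \<partial>\<mu>" sequentially "\<bar>c\<bar>"]
    by (simp add: L1_approx_def)
qed

lemma L1_approx_cong:
  assumes "L1_approx f" "\<And>x. x \<in> space \<mu> \<Longrightarrow> f x = g x"
  shows "L1_approx g"
proof -
  have "integrable \<mu> f \<longleftrightarrow> integrable \<mu> g"
    by (rule Bochner_Integration.integrable_cong) (auto simp: assms)
  moreover have "avg f v = avg g v" for v
    unfolding avg_def part_int_def
    by (intro arg_cong2[where f = "(/)"] Bochner_Integration.integral_cong refl) (simp add: assms)
  then have "level_avg f n x = level_avg g n x" for n x by (simp add: level_avg_def)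
  then have "(\<integral>x. \<bar>level_avg f n x - f x\<bar> \<partial>\<mu>) = (\<integral>x. \<bar>level_avg g n x - g x\<bar> \<partial>\<mu>)" for n
    by (intro Bochner_Integration.integral_cong) (auto simp: assms(2))
  ultimately show ?thesis using assms(1) by (simp add: L1_approx_def)
qed

text \<open>From level \<open>lev u\<close> on, the branch is a union of branches of level
  \<open>n\<close>, and averaging reproduces its indicator exactly.\<close>

lemma L1_approx_bd: "L1_approx (indicator (bd u))"
proof -
  have i: "integrable \<mu> (indicator (bd u) :: _ \<Rightarrow> real)" by (simp add: emeasure_eq_measure)
  have "(\<integral>x. \<bar>level_avg (indicator (bd u)) n x - indicator (bd u) x\<bar> \<partial>\<mu>) = 0" if n: "lev u \<le> n" for n
  proof -
    have "level_avg (indicator (bd u)) n x = indicator (bd u) x" if x: "x \<in> ends E" for x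
    proof -
      let ?v = "ray x n"
      have eq: "indicator (bd ?v) y * indicator (bd u) y = (indicator (bd ?v) y * indicator (bd u) x :: real)" for y
        using bd_inter_cases[of u ?v] ray_anc[OF x, of u n] n bd_common[of y u ?v] bd_anc_mono[of u ?v] x
        by (auto split: split_indicator)
      have "part_int (indicator (bd u)) ?v = mu ?v * indicator (bd u) x"
        unfolding part_int_def eq by (simp add: mu_def)
      then show ?thesis using x by (simp add: level_avg_eq avg_def)
    qed
    then have "(\<integral>x. \<bar>level_avg (indicator (bd u)) n x - indicator (bd u) x\<bar> \<partial>\<mu>) = (\<integral>x. 0 \<partial>\<mu>)"
      by (intro Bochner_Integration.integral_cong) (auto simp: space_mu)
    then show ?thesis by simp
  qed
  then have "\<forall>\<^sub>F n in sequentially. (\<integral>x. \<bar>level_avg (indicator (bd u)) n x - indicator (bd u) x\<bar> \<partial>\<mu>) = 0"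
    unfolding eventually_sequentially by blast
  then show ?thesis using i by (simp add: L1_approx_def tendsto_eventually)
qed

lemma L1_approx_zero: "L1_approx (\<lambda>x. 0)"
  using L1_approx_cmult[OF L1_approx_bd[of base], of 0] by simp

lemma L1_approx_sum: "(\<And>i. i < n \<Longrightarrow> L1_approx (f i)) \<Longrightarrow> L1_approx (\<lambda>x. \<Sum>i<(n::nat). f i x)"
proof (induction n)
  case 0
  show ?case using L1_approx_zero by simp
next
  case (Suc n)
  then show ?case using L1_approx_add[of "\<lambda>x. \<Sum>i<n. f i x" "f n"] by simp
qed

text \<open>Dynkin induction. A complement is handled by subtraction from the indicator of
  \<open>bd base\<close>; a countable disjoint union is approximated in the mean by finite
  ones.\<close>

lemma L1_approx_indicator:
  assumes "A \<in> sets \<mu>"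
  shows "L1_approx (indicator A)"
proof -
  have A: "A \<in> sigma_sets (ends E) (insert {} (range bd))"
    using assms by (simp add: sets_mu sets_end_borel sigma_sets_insert_bd)
  have "insert {} (range bd) \<subseteq> Pow (ends E)" using bd_subset_ends by auto
  note ind = sigma_sets_induct_disjoint[OF bd_Int_stable this, consumes 1, case_names basic empty compl union]
  show ?thesis using A
  proof (induct rule: ind)
    case (basic A)
    have "L1_approx (indicator {})" by (rule L1_approx_cong[OF L1_approx_zero]) simp
    with basic L1_approx_bd show ?case by blast
  next
    case empty
    show ?case by (rule L1_approx_cong[OF L1_approx_zero]) simp
  next
    case (compl A)
    have "L1_approx (\<lambda>x. indicator (bd base) x + (- 1) * indicator A x)"
      by (rule L1_approx_add[OF L1_approx_bd L1_approx_cmult]) (rule compl(2))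
    then show ?case by (rule L1_approx_cong) (auto simp: bd_base space_mu split: split_indicator)
  next
    case (union A)
    have sA: "A i \<in> sets \<mu>" for i
      using union(2) by (auto simp: sets_mu sets_end_borel sigma_sets_insert_bd)
    then have sU: "(\<Union>i. A i) \<in> sets \<mu>" by blast
    show ?case
    proof (rule L1_approx_close)
      show "integrable \<mu> (indicator (\<Union>i. A i) :: _ \<Rightarrow> real)" using sU by (simp add: emeasure_eq_measure)
      fix \<epsilon> :: real assume \<epsilon>: "0 < \<epsilon>"
      have "(\<lambda>i. measure \<mu> (A i)) sums measure \<mu> (\<Union>i. A i)"
        using sA union(1) by (intro finite_measure_UNION) blast+
      then have "(\<lambda>n. \<Sum>i<n. measure \<mu> (A i)) \<longlonglongrightarrow> measure \<mu> (\<Union>i. A i)" by (simp add: sums_def)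
      then obtain n where n: "\<bar>(\<Sum>i<n. measure \<mu> (A i)) - measure \<mu> (\<Union>i. A i)\<bar> < \<epsilon>"
        using \<epsilon> unfolding LIMSEQ_iff by (metis order_refl real_norm_def)
      let ?g = "\<lambda>x. \<Sum>i<n. indicator (A i) x :: real"
      have "?g x = indicator (\<Union>i<n. A i) x" for x
        using union(1) by (intro indicator_UN_disjoint[symmetric]) (simp_all add: disjoint_family_on_def)
      then have "\<bar>indicator (\<Union>i. A i) x - ?g x\<bar> = indicator (\<Union>i. A i) x - ?g x" for x
        by (auto split: split_indicator)
      then have "(\<integral>x. \<bar>indicator (\<Union>i. A i) x - ?g x\<bar> \<partial>\<mu>) = (\<integral>x. indicator (\<Union>i. A i) x - ?g x \<partial>\<mu>)"
        by simp
      also have "\<dots> = measure \<mu> (\<Union>i. A i) - (\<Sum>i<n. measure \<mu> (A i))"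
        using sA sU by (subst Bochner_Integration.integral_diff) (auto simp: emeasure_eq_measure)
      finally have "(\<integral>x. \<bar>indicator (\<Union>i. A i) x - ?g x\<bar> \<partial>\<mu>) < \<epsilon>" using n by linarith
      moreover have "L1_approx ?g" by (rule L1_approx_sum) (rule union(3))
      ultimately show "\<exists>g. L1_approx g \<and> (\<integral>x. \<bar>indicator (\<Union>i. A i) x - g x\<bar> \<partial>\<mu>) < \<epsilon>"
        by blast
    qed
  qed
qed

lemma L1_approx:
  assumes "integrable \<mu> f"
  shows "L1_approx f"
  using assms
proof (induct rule: integrable_induct)
  case (base A c)
  have "L1_approx (\<lambda>x. c * indicator A x)"
    by (rule L1_approx_cmult[OF L1_approx_indicator[OF base(1)]])
  then show ?case by (simp add: mult.commute)
next
  case (add f g)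
  then show ?case by (intro L1_approx_add)
next
  case (lim f s)
  show ?case
  proof (rule L1_approx_close[OF lim(5)])
    fix \<epsilon> :: real assume "0 < \<epsilon>"
    have "(\<lambda>i. \<integral>x. \<bar>f x - s i x\<bar> \<partial>\<mu>) \<longlonglongrightarrow> (\<integral>x. 0 \<partial>\<mu>)"
    proof (rule integral_dominated_convergence[where w = "\<lambda>x. 3 * \<bar>f x\<bar>"])
      show "AE x in \<mu>. (\<lambda>i. \<bar>f x - s i x\<bar>) \<longlonglongrightarrow> 0"
      proof (rule AE_I2)
        fix x assume "x \<in> space \<mu>"
        then have "(\<lambda>i. \<bar>f x - s i x\<bar>) \<longlonglongrightarrow> \<bar>f x - f x\<bar>" by (intro tendsto_intros lim(3))
        then show "(\<lambda>i. \<bar>f x - s i x\<bar>) \<longlonglongrightarrow> 0" by simp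
      qed
      \<comment> \<open>The approximating functions satisfy the bound
        \<open>2 * \<bar>f x\<bar>\<close>, hence the differences
        \<open>3 * \<bar>f x\<bar>\<close>.\<close>
      show "AE x in \<mu>. norm \<bar>f x - s i x\<bar> \<le> 3 * \<bar>f x\<bar>" for i
      proof (rule AE_I2)
        fix x assume "x \<in> space \<mu>"
        then have "\<bar>s i x\<bar> \<le> 2 * \<bar>f x\<bar>" using lim(4)[of x i] by simp
        then show "norm \<bar>f x - s i x\<bar> \<le> 3 * \<bar>f x\<bar>"
          using abs_triangle_ineq4[of "f x" "s i x"] by simp
      qed
    qed (use lim in auto)
    then have "(\<lambda>i. \<integral>x. \<bar>f x - s i x\<bar> \<partial>\<mu>) \<longlonglongrightarrow> 0" by simp
    then obtain i where "\<bar>\<integral>x. \<bar>f x - s i x\<bar> \<partial>\<mu>\<bar> < \<epsilon>"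
      using \<open>0 < \<epsilon>\<close> unfolding LIMSEQ_iff by (metis diff_zero order_refl real_norm_def)
    then show "\<exists>g. L1_approx g \<and> (\<integral>x. \<bar>f x - g x\<bar> \<partial>\<mu>) < \<epsilon>" using lim(2) by fastforce
  qed
qed

text \<open>Pointwise convergence along a subsequence is what Fatou's lemma requires in
  \<open>square_bound\<close>.\<close>

lemma AE_subseq:
  assumes "integrable \<mu> f"
  shows "\<exists>r. strict_mono r \<and> (AE x in \<mu>. (\<lambda>n. level_avg f (r n) x) \<longlonglongrightarrow> f x)"
proof -
  have "\<exists>r. strict_mono r \<and> (AE x in \<mu>. (\<lambda>n. level_avg f (r n) x - f x) \<longlonglongrightarrow> 0)"
    using L1_approx[OF assms] assms
    by (intro tendsto_L1_AE_subseq) (auto simp: L1_approx_def)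
  then show ?thesis by (simp add: LIM_zero_iff)
qed

section \<open>Variance within a branch\<close>

definition square_integrable :: "('v tree_end \<Rightarrow> real) \<Rightarrow> bool" where
  "square_integrable f \<longleftrightarrow> f \<in> borel_measurable \<mu> \<and> integrable \<mu> (\<lambda>x. (f x)\<^sup>2)"

definition variation :: "('v tree_end \<Rightarrow> real) \<Rightarrow> 'v \<Rightarrow> real" where
  "variation f v = (\<Sum>w\<in>ch v. mu w * (avg f w - avg f v)\<^sup>2)"

text \<open>The variance within the branch, not normalised by \<open>mu v\<close>;
  \<open>variation f v\<close> is its part between the children of \<open>v\<close>.\<close>

definition var :: "('v tree_end \<Rightarrow> real) \<Rightarrow> 'v \<Rightarrow> real" where
  "var f v = part_int (\<lambda>x. (f x)\<^sup>2) v - mu v * (avg f v)\<^sup>2"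

lemma variation_nonneg: "0 \<le> variation f v"
  by (auto simp: variation_def intro!: sum_nonneg)

lemma square_integrable_integrable:
  assumes "square_integrable f"
  shows "integrable \<mu> f"
proof (rule Bochner_Integration.integrable_bound[where f = "\<lambda>x. 1 + (f x)\<^sup>2"])
  show "AE x in \<mu>. norm (f x) \<le> norm (1 + (f x)\<^sup>2)"
  proof (rule AE_I2)
    fix x
    have "0 \<le> (\<bar>f x\<bar> - 1)\<^sup>2" by simp
    then have "2 * \<bar>f x\<bar> \<le> 1 + (f x)\<^sup>2" by (simp add: power2_eq_square algebra_simps)
    then show "norm (f x) \<le> norm (1 + (f x)\<^sup>2)" by simp
  qed
qed (use assms in \<open>auto simp: square_integrable_def\<close>)

lemma sum_mu_avg:
  assumes "integrable \<mu> f"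
  shows "(\<Sum>w\<in>ch v. mu w * avg f w) = mu v * avg f v"
  using part_int_desc[OF assms, of v 1] by (simp add: mu_avg desc_1)

lemma mu_children: "(\<Sum>w\<in>ch v. mu w) = mu v"
  using mu_desc[of v 1] by (simp add: desc_1)

lemma variation_eq:
  assumes "integrable \<mu> f"
  shows "variation f v = (\<Sum>w\<in>ch v. mu w * (avg f w)\<^sup>2) - mu v * (avg f v)\<^sup>2"
proof -
  let ?a = "avg f v"
  have "variation f v = (\<Sum>w\<in>ch v. mu w * (avg f w)\<^sup>2 - 2 * ?a * (mu w * avg f w) + mu w * ?a\<^sup>2)"
    unfolding variation_def by (rule sum.cong) (auto simp: power2_eq_square algebra_simps)
  also have "\<dots> = (\<Sum>w\<in>ch v. mu w * (avg f w)\<^sup>2) - 2 * ?a * (\<Sum>w\<in>ch v. mu w * avg f w) + (\<Sum>w\<in>ch v. mu w) * ?a\<^sup>2"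
    by (simp only: sum.distrib sum_subtractf sum_distrib_left sum_distrib_right)
  also have "\<dots> = (\<Sum>w\<in>ch v. mu w * (avg f w)\<^sup>2) - mu v * ?a\<^sup>2"
    unfolding sum_mu_avg[OF assms] mu_children by (simp add: power2_eq_square)
  finally show ?thesis .
qed

lemma variation_partial_sums:
  assumes "integrable \<mu> f"
  shows "(\<Sum>j<k. \<Sum>u\<in>desc v j. variation f u) = (\<Sum>w\<in>desc v k. mu w * (avg f w)\<^sup>2) - mu v * (avg f v)\<^sup>2"
proof (induction k)
  case (Suc k)
  have "(\<Sum>u\<in>desc v k. variation f u) = (\<Sum>w\<in>desc v (Suc k). mu w * (avg f w)\<^sup>2) - (\<Sum>w\<in>desc v k. mu w * (avg f w)\<^sup>2)"
    by (simp add: variation_eq[OF assms] sum_subtractf sum_desc_Suc)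
  then show ?case using Suc by simp
qed simp

text \<open>The integral of \<open>(f x - avg f w)\<^sup>2\<close> over the branch is
  nonnegative.\<close>

lemma jensen:
  assumes "square_integrable f"
  shows "mu w * (avg f w)\<^sup>2 \<le> part_int (\<lambda>x. (f x)\<^sup>2) w"
proof -
  let ?a = "avg f w"
  have i [simp]: "integrable \<mu> f" "integrable \<mu> (\<lambda>x. (f x)\<^sup>2)"
    using assms square_integrable_integrable[OF assms] by (simp_all add: square_integrable_def)
  have "0 \<le> part_int (\<lambda>x. (f x - ?a)\<^sup>2) w"
    unfolding part_int_def by (intro integral_nonneg_AE AE_I2) simp
  also have "(\<lambda>x. (f x - ?a)\<^sup>2) = (\<lambda>x. (f x)\<^sup>2 + ((- 2 * ?a) * f x + ?a\<^sup>2 * 1))"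
  proof
    fix x
    have "(y - c)\<^sup>2 = y\<^sup>2 + ((- 2 * c) * y + c\<^sup>2 * 1)" for y c :: real by algebra
    then show "(f x - ?a)\<^sup>2 = (f x)\<^sup>2 + ((- 2 * ?a) * f x + ?a\<^sup>2 * 1)" .
  qed
  also have "part_int \<dots> w = part_int (\<lambda>x. (f x)\<^sup>2) w + part_int (\<lambda>x. (- 2 * ?a) * f x + ?a\<^sup>2 * 1) w"
    by (rule part_int_add) simp_all
  also have "part_int (\<lambda>x. (- 2 * ?a) * f x + ?a\<^sup>2 * 1) w = part_int (\<lambda>x. (- 2 * ?a) * f x) w + part_int (\<lambda>x. ?a\<^sup>2 * 1) w"
    by (rule part_int_add) simp_all
  also have "\<dots> = (- 2 * ?a) * part_int f w + ?a\<^sup>2 * mu w"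
    unfolding part_int_cmult part_int_const ..
  also have "part_int (\<lambda>x. (f x)\<^sup>2) w + \<dots> = part_int (\<lambda>x. (f x)\<^sup>2) w - mu w * ?a\<^sup>2"
    unfolding mu_avg[symmetric] by (simp add: power2_eq_square)
  finally show ?thesis by simp
qed

lemma indicator_level_avg_sq:
  assumes x: "x \<in> ends E"
  shows "indicator (bd v) x * (level_avg f (lev v + k) x)\<^sup>2 = (\<Sum>w\<in>desc v k. (avg f w)\<^sup>2 * indicator (bd w) x)"
proof -
  have "(avg f w)\<^sup>2 * indicator (bd w) x = (level_avg f (lev v + k) x)\<^sup>2 * indicator (bd w) x"
    if "w \<in> desc v k" for w
  proof (cases "x \<in> bd w")
    case True
    then have "w = ray x (lev v + k)" using that by (auto simp: bd_iff desc_def)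
    then show ?thesis using level_avg_eq[OF x] by simp
  qed simp
  then have "(\<Sum>w\<in>desc v k. (avg f w)\<^sup>2 * indicator (bd w) x) =
    (\<Sum>w\<in>desc v k. (level_avg f (lev v + k) x)\<^sup>2 * indicator (bd w) x)" by (intro sum.cong) auto
  also have "\<dots> = (level_avg f (lev v + k) x)\<^sup>2 * indicator (bd v) x"
    by (simp add: indicator_desc[of v x k] flip: sum_distrib_left)
  finally show ?thesis by (simp add: mult.commute)
qed

lemma nn_level_avg_sq:
  "(\<integral>\<^sup>+x. ennreal (indicator (bd v) x * (level_avg f (lev v + k) x)\<^sup>2) \<partial>\<mu>) =
    ennreal (\<Sum>w\<in>desc v k. mu w * (avg f w)\<^sup>2)"
proof -
  have "(\<integral>\<^sup>+x. ennreal (indicator (bd v) x * (level_avg f (lev v + k) x)\<^sup>2) \<partial>\<mu>) =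
    (\<integral>\<^sup>+x. ennreal (\<Sum>w\<in>desc v k. (avg f w)\<^sup>2 * indicator (bd w) x) \<partial>\<mu>)"
    by (intro nn_integral_cong) (simp add: indicator_level_avg_sq space_mu)
  also have "\<dots> = ennreal (\<integral>x. (\<Sum>w\<in>desc v k. (avg f w)\<^sup>2 * indicator (bd w) x) \<partial>\<mu>)"
    by (intro nn_integral_eq_integral Bochner_Integration.integrable_sum integrable_mult_right
        integrable_real_indicator AE_I2 sum_nonneg) (auto simp: emeasure_eq_measure)
  also have "(\<integral>x. (\<Sum>w\<in>desc v k. (avg f w)\<^sup>2 * indicator (bd w) x) \<partial>\<mu>) = (\<Sum>w\<in>desc v k. (avg f w)\<^sup>2 * mu w)"
    by (subst Bochner_Integration.integral_sum) (auto simp: mu_def emeasure_eq_measure)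
  finally show ?thesis by (simp add: mult.commute)
qed

text \<open>Fatou's lemma along the almost everywhere convergent subsequence; the integrals of the
  squared level averages over the branch are the sums that \<open>K\<close> bounds.\<close>

lemma square_bound:
  assumes f: "integrable \<mu> f" and K: "\<And>k. (\<Sum>w\<in>desc v k. mu w * (avg f w)\<^sup>2) \<le> K"
  shows "(\<integral>\<^sup>+x. ennreal (indicator (bd v) x * (f x)\<^sup>2) \<partial>\<mu>) \<le> ennreal K"
proof -
  obtain r where r: "strict_mono r" "AE x in \<mu>. (\<lambda>n. level_avg f (r n) x) \<longlonglongrightarrow> f x"
    using AE_subseq[OF f] by blast
  \<comment> \<open>Dropping the first \<open>lev v\<close> terms brings the levels to at least
    \<open>lev v\<close>, so that each one is \<open>q n\<close> below \<open>v\<close>.\<close>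
  define q where "q n = r (n + lev v) - lev v" for n
  have q: "r (n + lev v) = lev v + q n" for n
    using strict_mono_imp_increasing[OF r(1), of "n + lev v"] by (simp add: q_def)
  let ?u = "\<lambda>n x. ennreal (indicator (bd v) x * (level_avg f (lev v + q n) x)\<^sup>2)"
  have "(\<integral>\<^sup>+x. ennreal (indicator (bd v) x * (f x)\<^sup>2) \<partial>\<mu>) = (\<integral>\<^sup>+x. liminf (\<lambda>n. ?u n x) \<partial>\<mu>)"
  proof (rule nn_integral_cong_AE)
    show "AE x in \<mu>. ennreal (indicator (bd v) x * (f x)\<^sup>2) = liminf (\<lambda>n. ?u n x)"
      using r(2)
    proof eventually_elim
      fix x assume "(\<lambda>n. level_avg f (r n) x) \<longlonglongrightarrow> f x"
      then have "(\<lambda>n. level_avg f (r (n + lev v)) x) \<longlonglongrightarrow> f x" by (rule LIMSEQ_ignore_initial_segment)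
      then have "(\<lambda>n. ?u n x) \<longlonglongrightarrow> ennreal (indicator (bd v) x * (f x)\<^sup>2)"
        unfolding q by (intro tendsto_intros tendsto_ennrealI)
      then show "ennreal (indicator (bd v) x * (f x)\<^sup>2) = liminf (\<lambda>n. ?u n x)"
        by (intro lim_imp_Liminf[symmetric]) auto
    qed
  qed
  also have "\<dots> \<le> liminf (\<lambda>n. \<integral>\<^sup>+x. ?u n x \<partial>\<mu>)"
    by (rule nn_integral_liminf) (use borel_measurable_integrable[OF level_avg_integrable] in measurable)
  also have "\<dots> \<le> limsup (\<lambda>n. \<integral>\<^sup>+x. ?u n x \<partial>\<mu>)" by (rule Liminf_le_Limsup) simp
  also have "\<dots> \<le> ennreal K"
    by (rule Limsup_bounded) (auto simp: nn_level_avg_sq intro!: always_eventually ennreal_leI K)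
  finally show ?thesis .
qed

lemma variation_bound:
  assumes f: "integrable \<mu> f" and s: "summable (\<lambda>j. \<Sum>u\<in>desc v j. variation f u)"
  shows "(\<Sum>w\<in>desc v k. mu w * (avg f w)\<^sup>2) \<le> mu v * (avg f v)\<^sup>2 + (\<Sum>j. \<Sum>u\<in>desc v j. variation f u)"
proof -
  have "(\<Sum>j<k. \<Sum>u\<in>desc v j. variation f u) \<le> (\<Sum>j. \<Sum>u\<in>desc v j. variation f u)"
    using s by (rule sum_le_suminf) (auto intro!: sum_nonneg variation_nonneg)
  then show ?thesis unfolding variation_partial_sums[OF f] by simp
qed

text \<open>Bridge between the two domains, which are based on integrable and on square integrable
  functions: summable variation bounds the second moments of the level averages.\<close>

lemma square_integrableI:
  assumes f: "integrable \<mu> f" and s: "summable (\<lambda>j. \<Sum>u\<in>desc base j. variation f u)"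
  shows "square_integrable f"
proof -
  have "(\<integral>\<^sup>+x. ennreal ((f x)\<^sup>2) \<partial>\<mu>) = (\<integral>\<^sup>+x. ennreal (indicator (bd base) x * (f x)\<^sup>2) \<partial>\<mu>)"
    by (rule nn_integral_cong) (simp add: bd_base space_mu)
  also have "\<dots> \<le> ennreal (mu base * (avg f base)\<^sup>2 + (\<Sum>j. \<Sum>u\<in>desc base j. variation f u))"
    by (rule square_bound[OF f variation_bound[OF f s]])
  also have "\<dots> < \<infinity>" by simp
  finally have "(\<integral>\<^sup>+x. ennreal ((f x)\<^sup>2) \<partial>\<mu>) < \<infinity>" .
  moreover have [measurable]: "f \<in> borel_measurable \<mu>" using f by (rule borel_measurable_integrable)
  ultimately show ?thesis unfolding square_integrable_def
    by (intro conjI integrableI_nonneg) auto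
qed

text \<open>Jensen's inequality bounds the partial sums by the variance; \<open>square_bound\<close>
  shows that nothing is lost in the limit.\<close>

lemma variation_sums:
  assumes "square_integrable f"
  shows "(\<lambda>j. \<Sum>u\<in>desc v j. variation f u) sums var f v"
proof -
  have f: "integrable \<mu> f" and f2: "integrable \<mu> (\<lambda>x. (f x)\<^sup>2)"
    using assms square_integrable_integrable[OF assms] by (simp_all add: square_integrable_def)
  let ?F = "\<lambda>j. \<Sum>u\<in>desc v j. variation f u"
  have nn: "0 \<le> ?F j" for j by (intro sum_nonneg variation_nonneg)
  have ub: "(\<Sum>j<k. ?F j) \<le> var f v" for k
  proof -
    have "(\<Sum>w\<in>desc v k. mu w * (avg f w)\<^sup>2) \<le> (\<Sum>w\<in>desc v k. part_int (\<lambda>x. (f x)\<^sup>2) w)"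
      by (intro sum_mono jensen assms)
    also have "\<dots> = part_int (\<lambda>x. (f x)\<^sup>2) v" using part_int_desc[OF f2, of v k] by simp
    finally show ?thesis unfolding variation_partial_sums[OF f] by (simp add: var_def)
  qed
  have s: "summable ?F" by (rule summableI_nonneg_bounded[OF nn ub])
  have i: "integrable \<mu> (\<lambda>x. indicator (bd v) x * (f x)\<^sup>2)" using f2 by simp
  have "ennreal (part_int (\<lambda>x. (f x)\<^sup>2) v) = (\<integral>\<^sup>+x. ennreal (indicator (bd v) x * (f x)\<^sup>2) \<partial>\<mu>)"
    unfolding part_int_def by (rule nn_integral_eq_integral[symmetric, OF i]) simp
  also have "\<dots> \<le> ennreal (mu v * (avg f v)\<^sup>2 + suminf ?F)"
    by (rule square_bound[OF f variation_bound[OF f s]])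
  finally have "part_int (\<lambda>x. (f x)\<^sup>2) v \<le> mu v * (avg f v)\<^sup>2 + suminf ?F"
    by (subst (asm) ennreal_le_iff) (intro add_nonneg_nonneg suminf_nonneg[OF s nn], simp)
  then have "suminf ?F = var f v"
    using suminf_le_const[OF s ub] by (simp add: var_def)
  then show ?thesis using s by (simp add: sums_iff)
qed

lemma var_nonneg: "square_integrable f \<Longrightarrow> 0 \<le> var f v"
  using jensen by (simp add: var_def)

text \<open>The law of total variance for the partition of a branch by its children.\<close>

lemma var_split:
  assumes "square_integrable f"
  shows "var f v = variation f v + (\<Sum>w\<in>ch v. var f w)"
proof -
  have f: "integrable \<mu> f" and f2: "integrable \<mu> (\<lambda>x. (f x)\<^sup>2)"
    using assms square_integrable_integrable[OF assms] by (simp_all add: square_integrable_def)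
  show ?thesis using part_int_desc[OF f2, of v 1]
    by (simp add: var_def variation_eq[OF f] sum_subtractf desc_1)
qed

end

section \<open>The form of the standard process\<close>

locale ultra = end_measure E base \<mu>
  for E :: "'v \<Rightarrow> 'v \<Rightarrow> bool" and base :: 'v and \<mu> :: "'v tree_end measure" +
  fixes \<psi> :: "'v \<Rightarrow> real"
  assumes psi_pos [simp]: "0 < \<psi> v" and psi_dec: "w \<in> ch v \<Longrightarrow> \<psi> w < \<psi> v"
begin

text \<open>For an end \<open>x\<close> beyond \<open>v\<close>, the length of the interval of
  \<open>\<tau>\<close> on which the ball about \<open>x\<close> of radius \<open>1 / \<tau>\<close>
  is \<open>bd v\<close>.\<close>

definition kappa :: "'v \<Rightarrow> real" where
  "kappa v = (if v = base then 1 / \<psi> v else 1 / \<psi> v - 1 / \<psi> (par v))"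

definition variation_level :: "('v tree_end \<Rightarrow> real) \<Rightarrow> nat \<Rightarrow> real" where
  "variation_level f n = (\<Sum>v\<in>desc base n. variation f v / \<psi> v)"

definition var_level :: "('v tree_end \<Rightarrow> real) \<Rightarrow> nat \<Rightarrow> real" where
  "var_level f n = (\<Sum>v\<in>desc base n. kappa v * var f v)"

text \<open>The part of the jump kernel that level \<open>n\<close> contributes; unlike the integral
  over \<open>\<tau>\<close> it is visibly symmetric and measurable.\<close>

definition pair_kernel :: "nat \<Rightarrow> 'v tree_end \<Rightarrow> 'v tree_end \<Rightarrow> real" where
  "pair_kernel n x y = (\<Sum>v\<in>desc base n. kappa v / mu v * (indicator (bd v) x * indicator (bd v) y))"

lemma psi_ne [simp]: "\<psi> v \<noteq> 0"
  by (metis psi_pos less_irrefl)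

lemma psi_nonneg [simp]: "0 \<le> \<psi> v"
  by (simp add: less_imp_le)

lemma kappa_ch: "w \<in> ch v \<Longrightarrow> kappa w = 1 / \<psi> w - 1 / \<psi> v"
  by (simp add: kappa_def ch_iff)

lemma kappa_nonneg: "0 \<le> kappa v"
proof (cases "v = base")
  case False
  then show ?thesis using kappa_ch[OF par_ch] psi_dec[OF par_ch] by (simp add: frac_le less_imp_le)
qed (simp add: kappa_def)

lemma psi_anc: "u \<in> set (geo v) \<Longrightarrow> \<psi> v \<le> \<psi> u"
proof (induction v rule: tree_induct)
  case (child w v)
  then show ?case using psi_dec[OF child.hyps] anc_ch[OF child.hyps] by auto
qed simp

lemma variation_level_nonneg: "0 \<le> variation_level f n"
  unfolding variation_level_def by (intro sum_nonneg divide_nonneg_nonneg variation_nonneg psi_nonneg)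

lemma var_level_nonneg: "square_integrable f \<Longrightarrow> 0 \<le> var_level f n"
  unfolding var_level_def by (intro sum_nonneg mult_nonneg_nonneg kappa_nonneg var_nonneg)

text \<open>Summation by parts: by \<open>var_split\<close> the variance is passed on to the
  children, while \<open>kappa\<close> is the increment of \<open>1 / \<psi>\<close>. The sum on the
  left runs one level further because the weights \<open>kappa\<close> up to \<open>v\<close> add up
  to \<open>1 / \<psi> v\<close>.\<close>

lemma var_level_partial_sums:
  assumes f: "square_integrable f"
  shows "(\<Sum>n<Suc N. var_level f n) = (\<Sum>n<N. variation_level f n) + (\<Sum>v\<in>desc base N. var f v / \<psi> v)"
proof (induction N)
  case 0
  then show ?case by (simp add: var_level_def kappa_def)
next
  case (Suc N)
  have "(\<Sum>v\<in>desc base N. var f v / \<psi> v) = (\<Sum>v\<in>desc base N. variation f v / \<psi> v + (\<Sum>w\<in>ch v. var f w / \<psi> v))"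
    by (rule sum.cong[OF refl], subst var_split[OF f]) (simp add: add_divide_distrib sum_divide_distrib)
  also have "\<dots> = variation_level f N + (\<Sum>v\<in>desc base N. \<Sum>w\<in>ch v. var f w / \<psi> v)"
    by (simp add: variation_level_def sum.distrib)
  finally have 1: "(\<Sum>v\<in>desc base N. var f v / \<psi> v) = \<dots>" .
  have "var_level f (Suc N) = (\<Sum>v\<in>desc base N. \<Sum>w\<in>ch v. var f w / \<psi> w - var f w / \<psi> v)"
    unfolding var_level_def sum_desc_Suc
    by (intro sum.cong refl) (simp add: kappa_ch left_diff_distrib)
  then have 2: "var_level f (Suc N) = (\<Sum>v\<in>desc base (Suc N). var f v / \<psi> v)
      - (\<Sum>v\<in>desc base N. \<Sum>w\<in>ch v. var f w / \<psi> v)"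
    by (simp add: sum_subtractf sum_desc_Suc)
  show ?case unfolding sum.lessThan_Suc[of _ "Suc N"] Suc 1 2 by simp
qed

text \<open>The variance at \<open>v\<close> is the sum of the variations below, and dividing these
  by the smaller values of \<open>\<psi>\<close> further down only enlarges them.\<close>

lemma var_tail:
  assumes f: "square_integrable f" and s: "summable (variation_level f)"
  shows "(\<Sum>v\<in>desc base N. var f v / \<psi> v) \<le> (\<Sum>j. variation_level f (N + j))"
proof -
  have sh: "summable (\<lambda>j. variation_level f (N + j))"
    using summable_iff_shift[of "variation_level f" N] s by (simp add: add.commute)
  let ?c = "\<lambda>v j. \<Sum>u\<in>desc v j. variation f u / \<psi> u"
  have cn: "0 \<le> ?c v j" for v j
    by (intro sum_nonneg divide_nonneg_nonneg variation_nonneg psi_nonneg)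
  have add: "(\<Sum>v\<in>desc base N. ?c v j) = variation_level f (N + j)" for j
    unfolding variation_level_def by (rule sum_desc_add[symmetric])
  have sc: "summable (?c v)" if "v \<in> desc base N" for v
  proof (rule summable_comparison_test'[OF sh, where N = 0])
    fix j
    have "?c v j \<le> (\<Sum>v\<in>desc base N. ?c v j)" by (rule member_le_sum[OF that]) (auto intro: cn)
    then show "norm (?c v j) \<le> variation_level f (N + j)" using cn[of v j] add[of j] by simp
  qed
  have "var f v / \<psi> v \<le> suminf (?c v)" if v: "v \<in> desc base N" for v
  proof -
    have vs: "(\<lambda>j. (\<Sum>u\<in>desc v j. variation f u) / \<psi> v) sums (var f v / \<psi> v)"
      by (intro sums_divide variation_sums f)
    have "(\<Sum>u\<in>desc v j. variation f u) / \<psi> v \<le> ?c v j" for j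
      unfolding sum_divide_distrib
      by (intro sum_mono divide_left_mono variation_nonneg psi_anc mult_pos_pos psi_pos) (simp add: desc_def)
    then show ?thesis by (rule sums_le[OF _ vs summable_sums[OF sc[OF v]]])
  qed
  then have "(\<Sum>v\<in>desc base N. var f v / \<psi> v) \<le> (\<Sum>v\<in>desc base N. suminf (?c v))" by (rule sum_mono)
  also have "\<dots> = (\<Sum>j. \<Sum>v\<in>desc base N. ?c v j)" by (rule suminf_sum[symmetric]) (rule sc)
  finally show ?thesis by (simp only: add)
qed

text \<open>The same two-sided comparison as for the energies: the remainder is nonnegative and
  dominated by a tail.\<close>

lemma variation_var_level:
  assumes f: "square_integrable f"
  shows "summable (var_level f) \<longleftrightarrow> summable (variation_level f)"
    and "summable (variation_level f) \<Longrightarrow> suminf (var_level f) = suminf (variation_level f)"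
proof -
  let ?s = "variation_level f" and ?b = "var_level f"
  have lo: "(\<Sum>n<N. ?s n) \<le> (\<Sum>n<Suc N. ?b n)" for N
    unfolding var_level_partial_sums[OF f] using var_nonneg[OF f]
    by (simp add: sum_nonneg divide_nonneg_nonneg)
  have lo': "(\<Sum>n<N. ?s n) \<le> suminf ?b" if "summable ?b" for N
    by (rule order_trans[OF lo]) (rule sum_le_suminf[OF that], auto intro: var_level_nonneg[OF f])
  have s1: "summable ?s" if "summable ?b"
    by (rule summableI_nonneg_bounded[OF variation_level_nonneg lo'[OF that]])
  have up: "(\<Sum>n<N. ?b n) \<le> suminf ?s" if "summable ?s" for N
  proof -
    have "(\<Sum>n<N. ?b n) \<le> (\<Sum>n<Suc N. ?b n)" using var_level_nonneg[OF f] by simp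
    also have "\<dots> \<le> suminf ?s"
      unfolding var_level_partial_sums[OF f]
      using var_tail[OF f that, of N] suminf_split_initial_segment[OF that, of N] by (simp add: add.commute)
    finally show ?thesis .
  qed
  have s2: "summable ?b" if "summable ?s"
    by (rule summableI_nonneg_bounded[OF var_level_nonneg[OF f] up[OF that]])
  show "summable ?b \<longleftrightarrow> summable ?s" using s1 s2 by blast
  show "suminf ?b = suminf ?s" if "summable ?s"
    using suminf_le_const[OF s2[OF that] up[OF that]] suminf_le_const[OF that lo'[OF s2[OF that]]] by simp
qed

text \<open>Vertices of different levels never coincide, so meeting the range of the other ray means
  agreement at the same index. The indices of agreement form an initial segment, bounded as the ends
  differ.\<close>

lemma confluent_level:
  assumes x: "x \<in> ends E" and y: "y \<in> ends E" and ne: "x \<noteq> y"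
  obtains k where "confluent base x y = ray x k" "\<And>n. ray x n = ray y n \<longleftrightarrow> n \<le> k"
proof -
  obtain d where d: "ray x d \<noteq> ray y d" using ends_eqI[OF x y] ne by blast
  have down: "ray x n = ray y n" if "ray x k = ray y k" "n \<le> k" for n k
  proof -
    have "ray x n \<in> set (geo (ray x k))"
      using ray_anc[OF x, of "ray x n" k] bd_ray[OF x, of n] x that(2) by simp
    moreover have "ray y n \<in> set (geo (ray y k))"
      using ray_anc[OF y, of "ray y n" k] bd_ray[OF y, of n] y that(2) by simp
    ultimately show ?thesis
      using anc_unique[of "ray x n" "ray x k" "ray y n"] that(1) x y by simp
  qed
  have bound: "n \<le> d" if "ray x n = ray y n" for n
    using down[OF that, of d] d by (meson nat_le_linear)
  define k where "k = (GREATEST n. ray x n = ray y n)"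
  have k: "ray x k = ray y k"
    unfolding k_def by (rule GreatestI_nat[where k = 0 and b = d]) (use x y bound in auto)
  have "n \<le> k" if "ray x n = ray y n" for n
    unfolding k_def by (rule Greatest_le_nat[where b = d]) (use that bound in auto)
  then have iff: "ray x n = ray y n \<longleftrightarrow> n \<le> k" for n using down[OF k] by blast
  have "ray x n \<in> range (ray y) \<longleftrightarrow> ray x n = ray y n" for n
    using x y by (metis lev_ray rangeE rangeI)
  then have "confluent base x y = ray x k" by (simp add: confluent_def k_def)
  then show ?thesis using iff by (rule that)
qed

lemma psi_ray_mono: "x \<in> ends E \<Longrightarrow> i \<le> j \<Longrightarrow> \<psi> (ray x j) \<le> \<psi> (ray x i)"
  by (rule psi_anc) (simp add: ray_anc bd_ray)

text \<open>Positive distances from \<open>x\<close> are values of \<open>\<psi>\<close> along its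
  ray, so the ball changes only at these radii; for \<open>i = 0\<close> there is no upper
  limit.\<close>

lemma end_ball_eq:
  assumes x: "x \<in> ends E" and r: "\<psi> (ray x i) \<le> r" "i \<noteq> 0 \<Longrightarrow> r < \<psi> (ray x (i - 1))"
  shows "end_ball E base \<psi> x r = bd (ray x i)"
proof (intro set_eqI iffI)
  fix y assume "y \<in> end_ball E base \<psi> x r"
  then have y: "y \<in> ends E" "end_dist base \<psi> x y \<le> r" by (auto simp: end_ball_def)
  show "y \<in> bd (ray x i)"
  proof (cases "x = y")
    case True
    then show ?thesis using bd_ray x by auto
  next
    case False
    obtain k where k: "confluent base x y = ray x k" "\<And>n. ray x n = ray y n \<longleftrightarrow> n \<le> k"
      using confluent_level[OF x y(1) False] by blast
    have "i \<le> k"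
    proof (rule ccontr)
      assume "\<not> i \<le> k"
      then have "\<psi> (ray x (i - 1)) \<le> \<psi> (ray x k)" "i \<noteq> 0" using psi_ray_mono[OF x] by auto
      then show False using y(2) r(2) False k(1) by (simp add: end_dist_def)
    qed
    then have "ray x i = ray y i" using k by simp
    then show ?thesis using y x by (simp add: bd_iff)
  qed
next
  fix y assume a: "y \<in> bd (ray x i)"
  then have y: "y \<in> ends E" "ray y i = ray x i" using x by (auto simp: bd_iff)
  show "y \<in> end_ball E base \<psi> x r"
  proof (cases "x = y")
    case True
    have "0 \<le> r" using r(1) psi_nonneg[of "ray x i"] by linarith
    then show ?thesis using True y by (simp add: end_ball_def end_dist_def)
  next
    case False
    obtain k where k: "confluent base x y = ray x k" "\<And>n. ray x n = ray y n \<longleftrightarrow> n \<le> k"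
      using confluent_level[OF x y(1) False] by blast
    have "i \<le> k" using k(2)[of i] y(2) by simp
    then have "\<psi> (ray x k) \<le> r" using psi_ray_mono[OF x] r(1) order_trans by blast
    then show ?thesis using False y k by (simp add: end_ball_def end_dist_def)
  qed
qed

lemma kappa_ray:
  assumes x: "x \<in> ends E"
  shows "kappa (ray x i) = 1 / \<psi> (ray x i) - (if i = 0 then 0 else 1 / \<psi> (ray x (i - 1)))"
proof (cases i)
  case 0
  then show ?thesis using x by (simp add: kappa_def)
next
  case (Suc j)
  then show ?thesis using kappa_ch[OF ray_Suc[OF x, of j]] by simp
qed

text \<open>As a function of \<open>\<tau>\<close> the integrand is a step function that jumps at
  the reciprocals of \<open>\<psi>\<close> along the ray of \<open>x\<close>.\<close>

lemma jump_kernel_eq: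
  assumes x: "x \<in> ends E" and y: "y \<in> ends E" and ne: "x \<noteq> y"
    and k: "confluent base x y = ray x k"
  shows "jump_kernel E base \<psi> \<mu> x y = (\<Sum>i\<le>k. kappa (ray x i) / mu (ray x i))"
proof -
  define b where "b i = 1 / \<psi> (ray x i)" for i
  \<comment> \<open>The value \<open>0\<close> at \<open>i = 0\<close> is the left end of the range
    of integration.\<close>
  define b' where "b' i = (if i = 0 then 0 else b (i - 1))" for i
  have b_mono: "b i \<le> b j" if "i \<le> j" for i j
    unfolding b_def using psi_ray_mono[OF x that] by (simp add: frac_le)
  have b_pos: "0 < b i" for i by (simp add: b_def)
  have b'_le: "b' i \<le> b i" for i using b_mono b_pos[of i] by (auto simp: b'_def less_imp_le)
  have d: "1 / end_dist base \<psi> x y = b k" using ne k by (simp add: end_dist_def b_def)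
  let ?B = "\<lambda>\<tau>. 1 / measure \<mu> (end_ball E base \<psi> x (1 / \<tau>))"
  let ?S = "\<lambda>\<tau>. \<Sum>i\<le>k. indicator {b' i<..b i} \<tau> / mu (ray x i)"
  \<comment> \<open>The half-open intervals include the right end \<open>b k\<close>, which the
    range of integration omits; this single point is removed as a null set later.\<close>
  have pt: "indicator {0<..<b k} \<tau> * ?B \<tau> = ?S \<tau>" if t: "\<tau> \<noteq> b k" for \<tau>
  proof (cases "\<tau> \<in> {0<..<b k}")
    case False
    then have t': "\<tau> \<le> 0 \<or> b k < \<tau>" using t by auto
    have "indicator {b' i<..b i} \<tau> = (0 :: real)" if "i \<le> k" for i
    proof -
      have "0 \<le> b' i" using b_pos[of "i - 1"] by (simp add: b'_def)
      then show ?thesis using t' b_mono[OF that] by (auto split: split_indicator)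
    qed
    then show ?thesis using False by simp
  next
    case True
    define i where "i = (LEAST i. \<tau> \<le> b i)"
    have i: "\<tau> \<le> b i" unfolding i_def by (rule LeastI[where k = k]) (use True in simp)
    have ik: "i \<le> k" unfolding i_def by (rule Least_le) (use True in simp)
    have below: "b j < \<tau>" if "j < i" for j
      using not_less_Least[of j "\<lambda>i. \<tau> \<le> b i"] that by (simp add: i_def)
    have bi: "b' i < \<tau>" using below[of "i - 1"] True by (auto simp: b'_def)
    have other: "indicator {b' j<..b j} \<tau> = (0 :: real)" if "j \<noteq> i" for j
    proof (cases "j < i")
      case True
      then show ?thesis using below[OF True] by (simp add: indicator_def)
    next
      case False
      then have "b i \<le> b' j" using that b_mono[of i "j - 1"] by (auto simp: b'_def)
      then show ?thesis using i by (simp add: indicator_def)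
    qed
    have "?S \<tau> = (\<Sum>j\<in>{i}. indicator {b' j<..b j} \<tau> / mu (ray x j))"
      by (rule sum.mono_neutral_right) (use ik other in auto)
    also have "\<dots> = 1 / mu (ray x i)" using i bi by simp
    also have "mu (ray x i) = measure \<mu> (end_ball E base \<psi> x (1 / \<tau>))"
    proof -
      have "\<psi> (ray x i) \<le> 1 / \<tau>" using i True by (simp add: b_def field_simps)
      moreover have "1 / \<tau> < \<psi> (ray x (i - 1))" if "i \<noteq> 0"
        using bi that True by (simp add: b'_def b_def field_simps)
      ultimately show ?thesis by (simp add: end_ball_eq[OF x] mu_def)
    qed
    finally show ?thesis using True by simp
  qed
  have "jump_kernel E base \<psi> \<mu> x y = (\<integral>\<tau>. indicator {0<..<b k} \<tau> * ?B \<tau> \<partial>lborel)"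
    by (simp add: jump_kernel_def set_lebesgue_integral_def d)
  also have "\<dots> = (\<integral>\<tau>. ?S \<tau> \<partial>lborel)"
  proof -
    have e: "(\<lambda>\<tau>. indicator {0<..<b k} \<tau> * ?B \<tau>) = (\<lambda>\<tau>. if \<tau> = b k then 0 else ?S \<tau>)"
      using pt by (auto simp: fun_eq_iff)
    show ?thesis unfolding e
    proof (rule integral_cong_AE)
      show "AE \<tau> in lborel. (if \<tau> = b k then 0 else ?S \<tau>) = ?S \<tau>"
        using AE_lborel_singleton[of "b k"] by eventually_elim simp
    qed measurable
  qed
  also have "\<dots> = (\<Sum>i\<le>k. \<integral>\<tau>. indicator {b' i<..b i} \<tau> / mu (ray x i) \<partial>lborel)"
    by (rule Bochner_Integration.integral_sum) (use b'_le in \<open>auto simp: emeasure_lborel_Ioc\<close>)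
  also have "\<dots> = (\<Sum>i\<le>k. (b i - b' i) / mu (ray x i))"
    using b'_le by (intro sum.cong) (auto simp: measure_lborel_Ioc)
  also have "\<dots> = (\<Sum>i\<le>k. kappa (ray x i) / mu (ray x i))"
    by (intro sum.cong refl) (simp add: kappa_ray[OF x] b_def b'_def)
  finally show ?thesis .
qed

lemma pair_kernel_eq:
  assumes x: "x \<in> ends E" and y: "y \<in> ends E"
  shows "pair_kernel n x y = (if ray x n = ray y n then kappa (ray x n) / mu (ray x n) else 0)"
proof -
  have "pair_kernel n x y = (\<Sum>v\<in>desc base n. if v = ray x n then
      (if ray x n = ray y n then kappa (ray x n) / mu (ray x n) else 0) else 0)"
    unfolding pair_kernel_def
    by (rule sum.cong) (use x y in \<open>auto simp: desc_base bd_iff split: split_indicator\<close>)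
  then show ?thesis using x by (simp add: desc_base)
qed

lemma pair_kernel_sums:
  assumes x: "x \<in> ends E" and y: "y \<in> ends E" and ne: "x \<noteq> y"
  shows "(\<lambda>n. pair_kernel n x y) sums jump_kernel E base \<psi> \<mu> x y"
proof -
  obtain k where k: "confluent base x y = ray x k" "\<And>n. ray x n = ray y n \<longleftrightarrow> n \<le> k"
    using confluent_level[OF x y ne] by blast
  have "(\<lambda>n. pair_kernel n x y) sums (\<Sum>n\<le>k. pair_kernel n x y)"
    by (rule sums_finite) (auto simp: pair_kernel_eq[OF x y] k)
  also have "(\<Sum>n\<le>k. pair_kernel n x y) = jump_kernel E base \<psi> \<mu> x y"
    unfolding jump_kernel_eq[OF x y ne k(1)] by (intro sum.cong) (auto simp: pair_kernel_eq[OF x y] k)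
  finally show ?thesis .
qed

lemma pair_kernel_nonneg: "0 \<le> pair_kernel n x y"
  unfolding pair_kernel_def
  by (intro sum_nonneg mult_nonneg_nonneg divide_nonneg_nonneg kappa_nonneg) auto

text \<open>On the diagonal the factor \<open>f x - f y\<close> makes both sides \<open>0\<close>;
  elsewhere only finitely many levels contribute.\<close>

lemma integrand_sums:
  assumes x: "x \<in> ends E" and y: "y \<in> ends E"
  shows "(\<lambda>n. (f x - f y) * (h x - h y) * pair_kernel n x y) sums standard_integrand E base \<psi> \<mu> f h (x, y)"
proof (cases "x = y")
  case False
  then show ?thesis unfolding standard_integrand_def
    using sums_mult[OF pair_kernel_sums[OF x y False]] by simp
qed (simp add: standard_integrand_def)

lemma pair_kernel_measurable [measurable]:
  "(\<lambda>z. pair_kernel n (fst z) (snd z)) \<in> borel_measurable (\<mu> \<Otimes>\<^sub>M \<mu>)"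
  unfolding pair_kernel_def by measurable

lemma integrand_measurable:
  assumes [measurable]: "f \<in> borel_measurable \<mu>" "h \<in> borel_measurable \<mu>"
  shows "standard_integrand E base \<psi> \<mu> f h \<in> borel_measurable (\<mu> \<Otimes>\<^sub>M \<mu>)"
proof (rule borel_measurable_LIMSEQ_real)
  let ?u = "\<lambda>N z. \<Sum>n<N. (f (fst z) - f (snd z)) * (h (fst z) - h (snd z)) * pair_kernel n (fst z) (snd z)"
  show "?u N \<in> borel_measurable (\<mu> \<Otimes>\<^sub>M \<mu>)" for N by measurable
  fix z assume "z \<in> space (\<mu> \<Otimes>\<^sub>M \<mu>)"
  then have "fst z \<in> ends E" "snd z \<in> ends E" by (auto simp: space_pair_measure space_mu)
  then show "(\<lambda>N. ?u N z) \<longlonglongrightarrow> standard_integrand E base \<psi> \<mu> f h z"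
    using integrand_sums[of "fst z" "snd z" f h] by (simp add: sums_def)
qed

text \<open>Twice the variance as the mean squared difference of two independent copies, without
  normalisation.\<close>

lemma nn_pair_bd:
  assumes f: "square_integrable f"
  shows "(\<integral>\<^sup>+x. \<integral>\<^sup>+y. ennreal ((f x - f y)\<^sup>2 * (indicator (bd v) x * indicator (bd v) y)) \<partial>\<mu> \<partial>\<mu>)
    = ennreal (2 * mu v * var f v)"
proof -
  have i [simp]: "integrable \<mu> f" "integrable \<mu> (\<lambda>x. (f x)\<^sup>2)"
    using f square_integrable_integrable[OF f] by (simp_all add: square_integrable_def)
  let ?I = "part_int f v" and ?Q = "part_int (\<lambda>x. (f x)\<^sup>2) v"
  let ?i = "\<lambda>x. indicator (bd v) x :: real"
  have ii: "integrable \<mu> ?i" by (simp add: emeasure_eq_measure)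
  have inner: "(\<integral>\<^sup>+y. ennreal ((f x - f y)\<^sup>2 * (?i x * ?i y)) \<partial>\<mu>)
     = ennreal (mu v * (?i x * (f x)\<^sup>2) - 2 * ?I * (?i x * f x) + ?Q * ?i x)" for x
  proof -
    have e: "(f x - f y)\<^sup>2 * (?i x * ?i y) =
       (?i x * (f x)\<^sup>2) * ?i y - (2 * (?i x * f x)) * (?i y * f y) + ?i x * (?i y * (f y)\<^sup>2)" for y
      by (simp add: power2_eq_square algebra_simps)
    have "integrable \<mu> (\<lambda>y. (f x - f y)\<^sup>2 * (?i x * ?i y))"
      unfolding e by (intro Bochner_Integration.integrable_add
          Bochner_Integration.integrable_diff integrable_mult_right ii part_int_integrable i)
    then have "(\<integral>\<^sup>+y. ennreal ((f x - f y)\<^sup>2 * (?i x * ?i y)) \<partial>\<mu>) =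
       ennreal (\<integral>y. (f x - f y)\<^sup>2 * (?i x * ?i y) \<partial>\<mu>)"
      by (rule nn_integral_eq_integral) simp
    also have "(\<integral>y. (f x - f y)\<^sup>2 * (?i x * ?i y) \<partial>\<mu>)
      = (?i x * (f x)\<^sup>2) * mu v - (2 * (?i x * f x)) * ?I + ?i x * ?Q"
      unfolding e using ii by (simp add: part_int_def mu_def)
    finally show ?thesis by (simp add: mult.commute mult.left_commute)
  qed
  have "(\<integral>\<^sup>+x. \<integral>\<^sup>+y. ennreal ((f x - f y)\<^sup>2 * (?i x * ?i y)) \<partial>\<mu> \<partial>\<mu>)
    = (\<integral>\<^sup>+x. ennreal (mu v * (?i x * (f x)\<^sup>2) - 2 * ?I * (?i x * f x) + ?Q * ?i x) \<partial>\<mu>)"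
    unfolding inner ..
  also have "\<dots> = ennreal (\<integral>x. mu v * (?i x * (f x)\<^sup>2) - 2 * ?I * (?i x * f x) + ?Q * ?i x \<partial>\<mu>)"
  proof (rule nn_integral_eq_integral)
    \<comment> \<open>The inner integral is nonnegative on the branch: complete the square and apply
      \<open>jensen\<close>.\<close>
    have "0 \<le> mu v * (f x)\<^sup>2 - 2 * ?I * f x + ?Q" for x
    proof -
      have "mu v * (avg f v)\<^sup>2 \<le> ?Q" by (rule jensen[OF f])
      moreover have "mu v * (f x)\<^sup>2 - 2 * ?I * f x + mu v * (avg f v)\<^sup>2 = mu v * (f x - avg f v)\<^sup>2"
        unfolding mu_avg[symmetric] by (simp add: power2_eq_square algebra_simps)
      moreover have "0 \<le> mu v * (f x - avg f v)\<^sup>2" by simp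
      ultimately show ?thesis by linarith
    qed
    then show "AE x in \<mu>. 0 \<le> mu v * (?i x * (f x)\<^sup>2) - 2 * ?I * (?i x * f x) + ?Q * ?i x"
      by (intro AE_I2) (auto split: split_indicator)
  qed (intro Bochner_Integration.integrable_add Bochner_Integration.integrable_diff
      integrable_mult_right ii part_int_integrable i)
  also have "(\<integral>x. mu v * (?i x * (f x)\<^sup>2) - 2 * ?I * (?i x * f x) + ?Q * ?i x \<partial>\<mu>)
     = mu v * ?Q - 2 * ?I * ?I + ?Q * mu v"
    using ii by (simp add: part_int_def mu_def)
  also have "\<dots> = 2 * mu v * var f v"
    unfolding var_def mu_avg[symmetric] by (simp add: power2_eq_square algebra_simps)
  finally show ?thesis .
qed

text \<open>Levels are summed by monotone convergence; the factor \<open>mu v\<close> from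
  \<open>nn_pair_bd\<close> cancels the denominator in \<open>pair_kernel\<close>.\<close>

lemma nn_standard_integrand:
  assumes f: "square_integrable f"
  shows "(\<integral>\<^sup>+z. ennreal (standard_integrand E base \<psi> \<mu> f f z) \<partial>(\<mu> \<Otimes>\<^sub>M \<mu>)) = (\<Sum>n. ennreal (2 * var_level f n))"
proof -
  have [measurable]: "f \<in> borel_measurable \<mu>" using f by (simp add: square_integrable_def)
  let ?w = "\<lambda>v z. (f (fst z) - f (snd z))\<^sup>2 * (indicator (bd v) (fst z) * indicator (bd v) (snd z))"
  let ?u = "\<lambda>n z. \<Sum>v\<in>desc base n. kappa v / mu v * ?w v z"
  have c: "0 \<le> kappa v / mu v" for v by (intro divide_nonneg_nonneg kappa_nonneg mu_nonneg)
  have u_eq: "?u n z = (f (fst z) - f (snd z)) * (f (fst z) - f (snd z)) * pair_kernel n (fst z) (snd z)" for n z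
    by (simp add: pair_kernel_def sum_distrib_left power2_eq_square mult_ac)
  have u0: "0 \<le> ?u n z" for n z
    by (intro sum_nonneg mult_nonneg_nonneg c) auto
  have "(\<integral>\<^sup>+z. ennreal (standard_integrand E base \<psi> \<mu> f f z) \<partial>(\<mu> \<Otimes>\<^sub>M \<mu>)) =
    (\<integral>\<^sup>+z. (\<Sum>n. ennreal (?u n z)) \<partial>(\<mu> \<Otimes>\<^sub>M \<mu>))"
  proof (rule nn_integral_cong)
    fix z assume "z \<in> space (\<mu> \<Otimes>\<^sub>M \<mu>)"
    then have z: "fst z \<in> ends E" "snd z \<in> ends E" by (auto simp: space_pair_measure space_mu)
    have "(\<lambda>n. ?u n z) sums standard_integrand E base \<psi> \<mu> f f z"
      using integrand_sums[OF z, of f f] unfolding u_eq by simp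
    from suminf_ennreal_eq[OF u0 this]
    show "ennreal (standard_integrand E base \<psi> \<mu> f f z) = (\<Sum>n. ennreal (?u n z))" by simp
  qed
  also have "\<dots> = (\<Sum>n. \<integral>\<^sup>+z. ennreal (?u n z) \<partial>(\<mu> \<Otimes>\<^sub>M \<mu>))"
    by (rule nn_integral_suminf) measurable
  also have "(\<lambda>n. \<integral>\<^sup>+z. ennreal (?u n z) \<partial>(\<mu> \<Otimes>\<^sub>M \<mu>)) = (\<lambda>n. ennreal (2 * var_level f n))"
  proof
    fix n
    have w: "(\<integral>\<^sup>+z. ennreal (?w v z) \<partial>(\<mu> \<Otimes>\<^sub>M \<mu>)) = ennreal (2 * mu v * var f v)" for v
      using nn_pair_bd[OF f, of v] nn_integral_fst[of "\<lambda>z. ennreal (?w v z)" \<mu>] by simp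
    have "(\<integral>\<^sup>+z. ennreal (?u n z) \<partial>(\<mu> \<Otimes>\<^sub>M \<mu>)) =
      (\<integral>\<^sup>+z. (\<Sum>v\<in>desc base n. ennreal (kappa v / mu v) * ennreal (?w v z)) \<partial>(\<mu> \<Otimes>\<^sub>M \<mu>))"
    proof (rule nn_integral_cong)
      fix z
      have "(\<Sum>v\<in>desc base n. ennreal (kappa v / mu v) * ennreal (?w v z)) =
        (\<Sum>v\<in>desc base n. ennreal (kappa v / mu v * ?w v z))"
        by (intro sum.cong refl ennreal_mult'[symmetric] c)
      also have "\<dots> = ennreal (?u n z)"
        by (intro sum_ennreal mult_nonneg_nonneg c) auto
      finally show "ennreal (?u n z) = (\<Sum>v\<in>desc base n. ennreal (kappa v / mu v) * ennreal (?w v z))" ..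
    qed
    also have "\<dots> = (\<Sum>v\<in>desc base n. ennreal (kappa v / mu v) * ennreal (2 * mu v * var f v))"
      by (subst nn_integral_sum) (simp_all add: nn_integral_cmult w)
    also have "\<dots> = (\<Sum>v\<in>desc base n. ennreal (2 * (kappa v * var f v)))"
      using c by (intro sum.cong refl) (simp add: ennreal_mult'[symmetric] mult.left_commute)
    also have "\<dots> = ennreal (\<Sum>v\<in>desc base n. 2 * (kappa v * var f v))"
      by (intro sum_ennreal mult_nonneg_nonneg kappa_nonneg var_nonneg[OF f]) simp
    finally show "(\<integral>\<^sup>+z. ennreal (?u n z) \<partial>(\<mu> \<Otimes>\<^sub>M \<mu>)) = ennreal (2 * var_level f n)"
      by (simp add: var_level_def sum_distrib_left)
  qed
  finally show ?thesis .
qed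

lemma standard_integrand_nonneg:
  assumes "z \<in> space (\<mu> \<Otimes>\<^sub>M \<mu>)"
  shows "0 \<le> standard_integrand E base \<psi> \<mu> f f z"
proof -
  have z: "fst z \<in> ends E" "snd z \<in> ends E" using assms by (auto simp: space_pair_measure space_mu)
  show ?thesis
    using sums_le[OF _ sums_zero integrand_sums[OF z, of f f]] pair_kernel_nonneg by simp
qed

text \<open>The factor \<open>1 / 2\<close> offsets the \<open>2\<close> that comes from counting
  ordered pairs.\<close>

lemma standard_integral:
  assumes f: "square_integrable f"
  shows "integrable (\<mu> \<Otimes>\<^sub>M \<mu>) (standard_integrand E base \<psi> \<mu> f f) \<longleftrightarrow> summable (variation_level f)"
    and "summable (variation_level f) \<Longrightarrow>
      1 / 2 * (\<integral>z. standard_integrand E base \<psi> \<mu> f f z \<partial>(\<mu> \<Otimes>\<^sub>M \<mu>)) = suminf (variation_level f)"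
proof -
  let ?q = "standard_integrand E base \<psi> \<mu> f f" and ?b = "\<lambda>n. 2 * var_level f n"
  have b0: "0 \<le> ?b n" for n using var_level_nonneg[OF f] by simp
  have q0: "AE z in \<mu> \<Otimes>\<^sub>M \<mu>. 0 \<le> ?q z" by (rule AE_I2) (rule standard_integrand_nonneg)
  have qm: "?q \<in> borel_measurable (\<mu> \<Otimes>\<^sub>M \<mu>)"
    using f by (intro integrand_measurable) (auto simp: square_integrable_def)
  have sb: "summable ?b \<longleftrightarrow> summable (variation_level f)"
    using variation_var_level(1)[OF f] summable_cmult_iff[of 2 "var_level f"] by simp
  show iff: "integrable (\<mu> \<Otimes>\<^sub>M \<mu>) ?q \<longleftrightarrow> summable (variation_level f)"
  proof
    assume "integrable (\<mu> \<Otimes>\<^sub>M \<mu>) ?q"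
    then have "(\<integral>\<^sup>+z. ennreal (?q z) \<partial>(\<mu> \<Otimes>\<^sub>M \<mu>)) < \<infinity>"
      using nn_integral_eq_integral[OF _ q0] by simp
    then have "(\<Sum>n. ennreal (?b n)) \<noteq> top" unfolding nn_standard_integrand[OF f] by simp
    then have "summable ?b" by (rule summable_suminf_not_top[OF b0])
    then show "summable (variation_level f)" using sb by simp
  next
    assume "summable (variation_level f)"
    then have "summable ?b" using sb by simp
    then have "(\<Sum>n. ennreal (?b n)) = ennreal (suminf ?b)" by (rule suminf_ennreal2[OF b0])
    then show "integrable (\<mu> \<Otimes>\<^sub>M \<mu>) ?q"
      using nn_standard_integrand[OF f] by (intro integrableI_nonneg[OF qm q0]) simp
  qed
  assume s: "summable (variation_level f)"
  then have "summable ?b" using sb by simp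
  then have "(\<integral>\<^sup>+z. ennreal (?q z) \<partial>(\<mu> \<Otimes>\<^sub>M \<mu>)) = ennreal (suminf ?b)"
    unfolding nn_standard_integrand[OF f] by (rule suminf_ennreal2[OF b0])
  then have "(\<integral>z. ?q z \<partial>(\<mu> \<Otimes>\<^sub>M \<mu>)) = suminf ?b"
    using suminf_nonneg[OF \<open>summable ?b\<close> b0] by (simp add: integral_eq_nn_integral[OF qm q0])
  also have "\<dots> = 2 * suminf (variation_level f)"
    using variation_var_level[OF f] s by (simp add: suminf_mult)
  finally show "1 / 2 * (\<integral>z. ?q z \<partial>(\<mu> \<Otimes>\<^sub>M \<mu>)) = suminf (variation_level f)" by simp
qed

lemma standard_domain_iff:
  "f \<in> standard_domain E base \<psi> \<mu> \<longleftrightarrow> square_integrable f \<and> summable (variation_level f)"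
  using standard_integral(1)[of f] by (auto simp: standard_domain_def square_integrable_def)

lemma standard_integrand_add:
  "standard_integrand E base \<psi> \<mu> (\<lambda>x. f x + h x) (\<lambda>x. f x + h x) z =
    standard_integrand E base \<psi> \<mu> f f z + 2 * standard_integrand E base \<psi> \<mu> f h z +
    standard_integrand E base \<psi> \<mu> h h z"
  by (cases z) (simp add: standard_integrand_def algebra_simps)

lemma standard_integrand_diff_nonneg:
  assumes "z \<in> space (\<mu> \<Otimes>\<^sub>M \<mu>)"
  shows "2 * \<bar>standard_integrand E base \<psi> \<mu> f h z\<bar> \<le>
    standard_integrand E base \<psi> \<mu> f f z + standard_integrand E base \<psi> \<mu> h h z"
proof -
  have "standard_integrand E base \<psi> \<mu> (\<lambda>x. f x - h x) (\<lambda>x. f x - h x) z =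
    standard_integrand E base \<psi> \<mu> f f z - 2 * standard_integrand E base \<psi> \<mu> f h z +
    standard_integrand E base \<psi> \<mu> h h z"
    by (cases z) (simp add: standard_integrand_def algebra_simps)
  then show ?thesis
    using standard_integrand_nonneg[OF assms, of "\<lambda>x. f x + h x"] standard_integrand_add[of f h z]
      standard_integrand_nonneg[OF assms, of "\<lambda>x. f x - h x"] by linarith
qed

text \<open>The mixed integrand is dominated by the diagonal ones, so all terms in the expansion of
  the square are integrable. The values are put in terms of \<open>variation_level\<close> to be
  compared with the tree form.\<close>

lemma standard_polarization:
  assumes f: "f \<in> standard_domain E base \<psi> \<mu>" and h: "h \<in> standard_domain E base \<psi> \<mu>"
  shows "(\<lambda>x. f x + h x) \<in> standard_domain E base \<psi> \<mu>"
    and "1 / 2 * (\<integral>z. standard_integrand E base \<psi> \<mu> f h z \<partial>(\<mu> \<Otimes>\<^sub>M \<mu>)) =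
      (suminf (variation_level (\<lambda>x. f x + h x)) - suminf (variation_level f) - suminf (variation_level h)) / 2"
proof -
  let ?q = "standard_integrand E base \<psi> \<mu>" and ?s = "\<lambda>x. f x + h x"
  have fi: "integrable (\<mu> \<Otimes>\<^sub>M \<mu>) (?q f f)" and hi: "integrable (\<mu> \<Otimes>\<^sub>M \<mu>) (?q h h)"
    and [measurable]: "f \<in> borel_measurable \<mu>" "h \<in> borel_measurable \<mu>"
    and f2: "integrable \<mu> (\<lambda>x. (f x)\<^sup>2)" "integrable \<mu> (\<lambda>x. (h x)\<^sup>2)"
    using f h by (auto simp: standard_domain_def)
  have fh: "integrable (\<mu> \<Otimes>\<^sub>M \<mu>) (?q f h)"
  proof (rule Bochner_Integration.integrable_bound[OF Bochner_Integration.integrable_add[OF fi hi]])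
    show "?q f h \<in> borel_measurable (\<mu> \<Otimes>\<^sub>M \<mu>)" by (rule integrand_measurable) measurable
    show "AE z in \<mu> \<Otimes>\<^sub>M \<mu>. norm (?q f h z) \<le> norm (?q f f z + ?q h h z)"
    proof (rule AE_I2)
      fix z assume "z \<in> space (\<mu> \<Otimes>\<^sub>M \<mu>)"
      from standard_integrand_diff_nonneg[OF this, of f h]
      show "norm (?q f h z) \<le> norm (?q f f z + ?q h h z)" by simp
    qed
  qed
  have s_eq: "?q ?s ?s = (\<lambda>z. ?q f f z + 2 * ?q f h z + ?q h h z)"
    by (rule ext) (rule standard_integrand_add)
  have si: "integrable (\<mu> \<Otimes>\<^sub>M \<mu>) (?q ?s ?s)" unfolding s_eq using fi fh hi by simp
  have "integrable \<mu> (\<lambda>x. (?s x)\<^sup>2)"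
  proof (rule Bochner_Integration.integrable_bound[where f = "\<lambda>x. 2 * (f x)\<^sup>2 + 2 * (h x)\<^sup>2"])
    show "AE x in \<mu>. norm ((?s x)\<^sup>2) \<le> norm (2 * (f x)\<^sup>2 + 2 * (h x)\<^sup>2)"
    proof (rule AE_I2)
      fix x
      have "0 \<le> (f x - h x)\<^sup>2" by simp
      moreover have "(f x - h x)\<^sup>2 = 2 * (f x)\<^sup>2 + 2 * (h x)\<^sup>2 - (?s x)\<^sup>2"
        by (simp add: power2_eq_square algebra_simps)
      ultimately show "norm ((?s x)\<^sup>2) \<le> norm (2 * (f x)\<^sup>2 + 2 * (h x)\<^sup>2)" by simp
    qed
  qed (use f2 in \<open>simp, measurable\<close>)
  then show s: "?s \<in> standard_domain E base \<psi> \<mu>" using si by (simp add: standard_domain_def)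
  have int: "1 / 2 * (\<integral>z. ?q r r z \<partial>(\<mu> \<Otimes>\<^sub>M \<mu>)) = suminf (variation_level r)"
    if "r \<in> standard_domain E base \<psi> \<mu>" for r
    using that standard_integral(2)[of r] unfolding standard_domain_iff by blast
  have "(\<integral>z. ?q ?s ?s z \<partial>(\<mu> \<Otimes>\<^sub>M \<mu>)) = (\<integral>z. ?q f f z \<partial>(\<mu> \<Otimes>\<^sub>M \<mu>)) + 2 * (\<integral>z. ?q f h z \<partial>(\<mu> \<Otimes>\<^sub>M \<mu>))
      + (\<integral>z. ?q h h z \<partial>(\<mu> \<Otimes>\<^sub>M \<mu>))"
    unfolding s_eq using fi fh hi by simp
  then show "1 / 2 * (\<integral>z. ?q f h z \<partial>(\<mu> \<Otimes>\<^sub>M \<mu>)) =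
      (suminf (variation_level ?s) - suminf (variation_level f) - suminf (variation_level h)) / 2"
    unfolding int[OF s, symmetric] int[OF f, symmetric] int[OF h, symmetric]
    by (simp add: add_divide_distrib diff_divide_distrib)
qed

end

section \<open>The boundary process is a standard process\<close>

locale matched = green_potential E base p g + end_measure E base \<mu>
  for E :: "'v \<Rightarrow> 'v \<Rightarrow> bool" and base :: 'v and p g and \<mu> :: "'v tree_end measure" +
  assumes mu_flow: "measure \<mu> (bd v) = flow v"
begin

sublocale ultra E base \<mu> g
  by unfold_locales (simp_all add: g_dec)

lemma mu_eq_flow: "mu v = flow v"
  by (simp add: mu_def mu_flow)

text \<open>The Martin kernel, the density of harmonic measure from \<open>u\<close> with respect to
  that from the root; it is a combination of indicators of the branches along the geodesic to
  \<open>u\<close>.\<close>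

definition martin :: "'v \<Rightarrow> 'v tree_end \<Rightarrow> real" where
  "martin u x = g u * (\<Sum>s\<in>set (geo u). kap s / mu s * indicator (bd s) x)"

lemma martin_nonneg: "0 \<le> martin u x"
  unfolding martin_def
  by (intro mult_nonneg_nonneg sum_nonneg divide_nonneg_nonneg less_imp_le[OF kap_pos] g_nonneg mu_nonneg) simp

lemma martin_measurable [measurable]: "martin u \<in> borel_measurable \<mu>"
  unfolding martin_def by measurable

lemma martin_integral:
  assumes "integrable \<mu> f"
  shows "integrable \<mu> (\<lambda>x. martin u x * f x)" "(\<integral>x. martin u x * f x \<partial>\<mu>) = ext (avg f) u"
proof -
  have e: "martin u x * f x = (\<Sum>s\<in>set (geo u). g u * (kap s / mu s) * (indicator (bd s) x * f x))" for x
    by (simp add: martin_def sum_distrib_left sum_distrib_right mult_ac)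
  show "integrable \<mu> (\<lambda>x. martin u x * f x)"
    unfolding e using assms by (intro Bochner_Integration.integrable_sum integrable_mult_right part_int_integrable)
  have "(\<integral>x. martin u x * f x \<partial>\<mu>) = (\<Sum>s\<in>set (geo u). g u * (kap s / mu s) * part_int f s)"
    unfolding e part_int_def using assms
    by (subst Bochner_Integration.integral_sum) (auto intro!: integrable_mult_right part_int_integrable)
  then show "(\<integral>x. martin u x * f x \<partial>\<mu>) = ext (avg f) u"
    by (simp add: ext_def avg_def sum_distrib_left mult.assoc)
qed

lemma avg_indicator_bd: "avg (indicator (bd w)) s = cell w s"
proof -
  have "part_int (indicator (bd w)) s = measure \<mu> (bd w \<inter> bd s)"
    unfolding part_int_def indicator_inter_arith[symmetric] by (simp add: Int_commute)
  also have "\<dots> = mu s * cell w s"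
    using anc_antisym[of w s] unfolding bd_inter_cases[of w s] mu_eq_flow cell_def by (auto simp: mu_flow)
  finally show ?thesis by (simp add: avg_def)
qed

text \<open>Both measures give the branch at \<open>w\<close> the mass
  \<open>ext (cell w) u\<close>.\<close>

lemma limit_law_density: "limit_law E base p u = density \<mu> (\<lambda>x. ennreal (martin u x))"
proof (rule end_measure_eqI)
  interpret L: prob_space "limit_law E base p u" by (rule prob_space_limit_law)
  show "emeasure (limit_law E base p u) (ends E) \<noteq> \<infinity>" by simp
  fix w
  have i: "integrable \<mu> (indicator (bd w) :: _ \<Rightarrow> real)" by (simp add: emeasure_eq_measure)
  have "emeasure (density \<mu> (\<lambda>x. ennreal (martin u x))) (bd w) =
    (\<integral>\<^sup>+x. ennreal (martin u x * indicator (bd w) x) \<partial>\<mu>)"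
    by (subst emeasure_density) (auto intro!: nn_integral_cong split: split_indicator)
  also have "\<dots> = ennreal (\<integral>x. martin u x * indicator (bd w) x \<partial>\<mu>)"
    using martin_integral(1)[OF i] by (intro nn_integral_eq_integral AE_I2) (auto simp: martin_nonneg)
  also have "\<dots> = ennreal (ext (cell w) u)"
    unfolding martin_integral(2)[OF i] avg_indicator_bd ..
  also have "\<dots> = emeasure (limit_law E base p u) (bd w)"
    by (simp add: L.emeasure_eq_measure limit_law_bd)
  finally show "emeasure (limit_law E base p u) (bd w) = emeasure (density \<mu> (\<lambda>x. ennreal (martin u x))) (bd w)"
    by simp
qed (simp_all add: sets_mu)

lemma limit_law_base: "limit_law E base p base = \<mu>"
proof (rule end_measure_eqI)
  interpret L: prob_space "limit_law E base p base" by (rule prob_space_limit_law)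
  show "emeasure (limit_law E base p base) (ends E) \<noteq> \<infinity>" by simp
  show "emeasure (limit_law E base p base) (bd w) = emeasure \<mu> (bd w)" for w
    by (simp add: L.emeasure_eq_measure emeasure_eq_measure limit_law_base_bd mu_flow)
qed (simp_all add: sets_mu)

lemma harmonic_ext_eq: "integrable \<mu> f \<Longrightarrow> harmonic_ext E base p f u = ext (avg f) u"
  unfolding harmonic_ext_def limit_law_density
  by (subst integral_density) (simp_all add: martin_nonneg martin_integral(2))

lemma additive_avg: "integrable \<mu> f \<Longrightarrow> additive (avg f)"
  using sum_mu_avg[of f] by (simp add: additive_def mu_eq_flow)

text \<open>Here the computations on the tree and on the boundary meet, with \<open>avg f\<close> in
  the role of \<open>A\<close>.\<close>

lemma spectral_variation_level: "spectral_level (avg f) = variation_level f"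
  by (simp add: spectral_level_def[abs_def] variation_level_def[abs_def] spread_def variation_def mu_eq_flow)

text \<open>The weights \<open>1 / g u\<close> are bounded below by
  \<open>1 / g base\<close>.\<close>

lemma summable_variation:
  assumes "summable (variation_level f)"
  shows "summable (\<lambda>j. \<Sum>u\<in>desc base j. variation f u)"
proof (rule summable_comparison_test'[OF summable_mult[OF assms, of "g base"], where N = 0])
  fix j
  have "variation f u \<le> g base * (variation f u / g u)" for u
    using psi_anc[of base u] variation_nonneg[of f u] by (simp add: field_simps mult_right_mono)
  then have "(\<Sum>u\<in>desc base j. variation f u) \<le> g base * variation_level f j"
    unfolding variation_level_def sum_distrib_left by (rule sum_mono)
  moreover have "0 \<le> (\<Sum>u\<in>desc base j. variation f u)" by (intro sum_nonneg variation_nonneg)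
  ultimately show "norm (\<Sum>u\<in>desc base j. variation f u) \<le> g base * variation_level f j" by simp
qed

lemma boundary_domain_iff:
  "f \<in> boundary_domain E base p \<longleftrightarrow> integrable \<mu> f \<and> summable (variation_level f)"
proof -
  have "tree_form_term E base p (harmonic_ext E base p f) (harmonic_ext E base p f) summable_on (- {base})
      \<longleftrightarrow> summable (variation_level f)" if f: "integrable \<mu> f"
  proof -
    have "harmonic_ext E base p f = ext (avg f)" using harmonic_ext_eq[OF f] by auto
    then show ?thesis using tree_form_ext(1)[OF additive_avg[OF f]] spectral_variation_level by simp
  qed
  then show ?thesis unfolding boundary_domain_def limit_law_base Let_def by blast
qed

lemma boundary_standard_domain: "boundary_domain E base p = standard_domain E base g \<mu>"
proof (rule set_eqI)
  fix f
  show "f \<in> boundary_domain E base p \<longleftrightarrow> f \<in> standard_domain E base g \<mu>"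
    unfolding boundary_domain_iff standard_domain_iff
    using square_integrableI[of f] summable_variation[of f] square_integrable_integrable[of f] by blast
qed

lemma boundary_form_diag:
  assumes "f \<in> boundary_domain E base p"
  shows "tree_form E base p (harmonic_ext E base p f) (harmonic_ext E base p f) = suminf (variation_level f)"
proof -
  have f: "integrable \<mu> f" "summable (variation_level f)" using assms by (auto simp: boundary_domain_iff)
  have "harmonic_ext E base p f = ext (avg f)" using harmonic_ext_eq[OF f(1)] by auto
  then show ?thesis using tree_form_ext(2)[OF additive_avg[OF f(1)]] spectral_variation_level f(2) by simp
qed

lemma same_form_boundary_standard: "same_form (boundary_form E base p) (standard_form E base g \<mu>)"
  unfolding same_form_def boundary_form_def standard_form_def fst_conv snd_conv
proof (intro conjI ballI boundary_standard_domain)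
  fix f h assume fh: "f \<in> boundary_domain E base p" "h \<in> boundary_domain E base p"
  let ?s = "\<lambda>x. f x + h x"
  have s: "?s \<in> boundary_domain E base p"
    using standard_polarization(1) fh boundary_standard_domain by simp
  have i: "integrable \<mu> f" "integrable \<mu> h" using fh by (auto simp: boundary_domain_iff)
  let ?H = "harmonic_ext E base p"
  let ?t = "tree_form_term E base p"
  have H: "?H ?s = (\<lambda>u. ?H f u + ?H h u)"
    using i by (auto simp: harmonic_ext_eq ext_def avg_add distrib_left sum.distrib)
  \<comment> \<open>A mixed term has no sign; writing it by diagonal terms gives its unconditional
    summability together with its value.\<close>
  have t: "?t (?H f) (?H h) = (\<lambda>v. 1 / 2 * (?t (?H ?s) (?H ?s) v
      + (- 1 * ?t (?H f) (?H f) v + - 1 * ?t (?H h) (?H h) v)))"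
    unfolding H by (rule ext) (simp add: tree_form_term_def algebra_simps)
  have sum: "(?t (?H r) (?H r) has_sum suminf (variation_level r)) (- {base})"
    if "r \<in> boundary_domain E base p" for r
  proof -
    have "?t (?H r) (?H r) summable_on (- {base})"
      using that by (simp add: boundary_domain_def Let_def)
    from has_sum_infsum[OF this] show ?thesis
      using boundary_form_diag[OF that] by (simp add: tree_form_def)
  qed
  have "(?t (?H f) (?H h) has_sum 1 / 2 * (suminf (variation_level ?s)
      + (- 1 * suminf (variation_level f) + - 1 * suminf (variation_level h)))) (- {base})"
    unfolding t by (intro has_sum_cmult_right has_sum_add sum s fh)
  then have "tree_form E base p (?H f) (?H h) =
      (suminf (variation_level ?s) - suminf (variation_level f) - suminf (variation_level h)) / 2"
    by (simp add: tree_form_def infsumI)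
  then show "tree_form E base p (?H f) (?H h) =
      1 / 2 * (\<integral>z. standard_integrand E base g \<mu> f h z \<partial>(\<mu> \<Otimes>\<^sub>M \<mu>))"
    using standard_polarization(2)[of f h] fh boundary_standard_domain by simp
qed

end

section \<open>Existence and uniqueness\<close>

context end_measure
begin

text \<open>An eigenfunction of every standard form, supported in the branch at \<open>v\<close>.\<close>

definition wavelet :: "'v \<Rightarrow> 'v \<Rightarrow> 'v tree_end \<Rightarrow> real" where
  "wavelet v w x = indicator (bd w) x - mu w / mu v * indicator (bd v) x"

lemma indicator_integrable [simp]: "integrable \<mu> (indicator (bd v) :: _ \<Rightarrow> real)"
  by (simp add: emeasure_eq_measure)

lemma wavelet_square_integrable: "square_integrable (wavelet v w)"
proof -
  have [measurable]: "wavelet v w \<in> borel_measurable \<mu>" unfolding wavelet_def[abs_def] by measurable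
  have "integrable \<mu> (\<lambda>x. (wavelet v w x)\<^sup>2)"
  proof (rule integrable_const_bound[where B = "(1 + \<bar>mu w / mu v\<bar>)\<^sup>2"])
    show "AE x in \<mu>. norm ((wavelet v w x)\<^sup>2) \<le> (1 + \<bar>mu w / mu v\<bar>)\<^sup>2"
    proof (rule AE_I2)
      fix x
      have "\<bar>i - r * j\<bar> \<le> 1 + \<bar>r\<bar>" if "i \<in> {0, 1}" "j \<in> {0, 1}" for i j r :: real
        using that by auto
      then have "\<bar>wavelet v w x\<bar> \<le> 1 + \<bar>mu w / mu v\<bar>"
        unfolding wavelet_def by (metis indicator_simps insertI1 insertI2)
      then show "norm ((wavelet v w x)\<^sup>2) \<le> (1 + \<bar>mu w / mu v\<bar>)\<^sup>2"
        by (simp add: abs_le_square_iff[symmetric])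
    qed
  qed measurable
  then show ?thesis by (simp add: square_integrable_def)
qed

lemma part_int_indicator: "part_int (indicator (bd w)) u = measure \<mu> (bd w \<inter> bd u)"
  unfolding part_int_def indicator_inter_arith[symmetric] by (simp add: Int_commute)

lemma part_int_wavelet:
  "part_int (wavelet v w) u = measure \<mu> (bd w \<inter> bd u) - mu w / mu v * measure \<mu> (bd v \<inter> bd u)"
proof -
  have "integrable \<mu> (\<lambda>x. mu w / mu v * indicator (bd v) x)" by (rule integrable_mult_right) simp
  then show ?thesis
    unfolding wavelet_def[abs_def]
    by (simp only: part_int_diff[OF indicator_integrable] part_int_cmult part_int_indicator)
qed

text \<open>A branch not strictly below \<open>v\<close> either contains \<open>bd v\<close>, on
  which the wavelet has integral \<open>0\<close>, or is disjoint from it.\<close>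

lemma avg_wavelet_zero:
  assumes w: "w \<in> ch v" and u: "v \<in> set (geo u) \<Longrightarrow> u = v"
  shows "avg (wavelet v w) u = 0"
proof (cases "u \<in> set (geo v)")
  case True
  then have "u \<in> set (geo w)" using anc_ch[OF w] by simp
  then have "bd w \<inter> bd u = bd w" "bd v \<inter> bd u = bd v" using bd_anc_mono True by blast+
  then show ?thesis by (simp add: avg_def part_int_wavelet) (simp add: mu_def[symmetric])
next
  case False
  then have nv: "v \<notin> set (geo u)" using u by auto
  then have v0: "bd v \<inter> bd u = {}" using False bd_inter_cases[of v u] by simp
  then have "bd w \<inter> bd u = {}" using bd_anc_mono[OF anc_in_ch[OF w]] by blast
  then show ?thesis using v0 by (simp add: avg_def part_int_wavelet)
qed

lemma avg_wavelet_below: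
  assumes w: "w \<in> ch v" and u: "v \<in> set (geo u)" "u \<noteq> v"
  shows "avg (wavelet v w) u = of_bool (w \<in> set (geo u)) - mu w / mu v"
proof -
  have v: "bd v \<inter> bd u = bd u" using bd_anc_mono[OF u(1)] by blast
  show ?thesis
  proof (cases "w \<in> set (geo u)")
    case True
    then have "bd w \<inter> bd u = bd u" using bd_anc_mono by blast
    then show ?thesis using v True
      by (simp add: avg_def part_int_wavelet diff_divide_distrib flip: mu_def)
  next
    case False
    have "u \<notin> set (geo w)" using False anc_ch[OF w] anc_antisym[of u v] u by auto
    then have "bd w \<inter> bd u = {}" using False bd_inter_cases[of w u] by simp
    then show ?thesis using v False by (simp add: avg_def part_int_wavelet flip: mu_def)
  qed
qed

text \<open>Away from \<open>v\<close> the average over a child equals that over \<open>u\<close>: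
  both vanish, or both belong to vertices strictly below \<open>v\<close>, where the wavelet is
  constant on each branch.\<close>

lemma variation_wavelet_zero:
  assumes w: "w \<in> ch v" and u: "u \<noteq> v"
  shows "variation (wavelet v w) u = 0"
proof -
  have "avg (wavelet v w) c = avg (wavelet v w) u" if c: "c \<in> ch u" for c
  proof (cases "v \<in> set (geo u)")
    case True
    have "c \<noteq> v" using ch_notin_geo[OF c] True by blast
    moreover have "c \<noteq> w" using par_ch c w u by (auto simp: ch_iff)
    moreover have "v \<in> set (geo c)" using True anc_ch[OF c] by simp
    ultimately show ?thesis
      using anc_ch[OF c] True u by (auto simp: avg_wavelet_below[OF w])
  next
    case False
    then have "avg (wavelet v w) c = 0" using anc_ch[OF c] by (intro avg_wavelet_zero[OF w]) auto
    moreover have "avg (wavelet v w) u = 0" using False by (intro avg_wavelet_zero[OF w]) auto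
    ultimately show ?thesis by simp
  qed
  then show ?thesis by (simp add: variation_def)
qed

text \<open>A second child of \<open>v\<close> has positive mass, so \<open>mu w < mu v\<close> and
  the averages over \<open>w\<close> and \<open>v\<close> differ.\<close>

lemma variation_wavelet_pos:
  assumes w: "w \<in> ch v"
  shows "0 < variation (wavelet v w) v"
proof -
  obtain w' where w': "w' \<in> ch v" "w' \<noteq> w"
    using ch_card[of v] w by (metis card_2_iff' card_le_Suc0_iff_eq ch_finite not_less_eq_eq numeral_2_eq_2)
  have "mu w < mu w + mu w'" by simp
  also have "\<dots> = (\<Sum>c\<in>{w, w'}. mu c)" using w' by simp
  also have "\<dots> \<le> (\<Sum>c\<in>ch v. mu c)" using w w' by (intro sum_mono2) auto
  also have "\<dots> = mu v" by (rule mu_children)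
  finally have lt: "mu w < mu v" .
  have "avg (wavelet v w) v = 0" by (rule avg_wavelet_zero[OF w]) simp
  moreover have "avg (wavelet v w) w = 1 - mu w / mu v"
    using avg_wavelet_below[OF w anc_in_ch[OF w]] ch_ne[OF w] by simp
  ultimately have "0 < mu w * (avg (wavelet v w) w - avg (wavelet v w) v)\<^sup>2"
    using lt by simp
  also have "\<dots> \<le> variation (wavelet v w) v"
    unfolding variation_def using w by (intro member_le_sum) auto
  finally show ?thesis .
qed

end

context ultra
begin

lemma variation_level_wavelet:
  assumes w: "w \<in> ch v"
  shows "variation_level (wavelet v w) sums (variation (wavelet v w) v / \<psi> v)"
proof -
  have "variation_level (wavelet v w) n = (\<Sum>u\<in>desc base n. if u = v then variation (wavelet v w) v / \<psi> v else 0)" for n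
    unfolding variation_level_def by (rule sum.cong) (auto simp: variation_wavelet_zero[OF w])
  then have "variation_level (wavelet v w) = (\<lambda>n. if n = lev v then variation (wavelet v w) v / \<psi> v else 0)"
    by (auto simp: desc_base)
  then show ?thesis using sums_single[of "lev v" "\<lambda>_. variation (wavelet v w) v / \<psi> v"] by simp
qed

lemma wavelet_form:
  assumes w: "w \<in> ch v"
  shows "wavelet v w \<in> fst (standard_form E base \<psi> \<mu>)"
    and "snd (standard_form E base \<psi> \<mu>) (wavelet v w) (wavelet v w) = variation (wavelet v w) v / \<psi> v"
proof -
  note s = variation_level_wavelet[OF w]
  show "wavelet v w \<in> fst (standard_form E base \<psi> \<mu>)"
    using sums_summable[OF s] wavelet_square_integrable by (simp add: standard_form_def standard_domain_iff)
  show "snd (standard_form E base \<psi> \<mu>) (wavelet v w) (wavelet v w) = variation (wavelet v w) v / \<psi> v"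
    using standard_integral(2)[OF wavelet_square_integrable sums_summable[OF s]] sums_unique[OF s]
    by (simp add: standard_form_def)
qed

end

text \<open>On the wavelet the form is its \<open>variation\<close> at \<open>v\<close>, which
  depends on \<open>\<mu>\<close> alone, divided by \<open>\<psi> v\<close>.\<close>

lemma standard_form_determines:
  assumes "ultra E base \<mu> \<psi>" "ultra E base \<mu> \<psi>'"
    and "same_form B (standard_form E base \<psi> \<mu>)" "same_form B (standard_form E base \<psi>' \<mu>)"
  shows "\<psi> v = \<psi>' v"
proof -
  interpret A: ultra E base \<mu> \<psi> by fact
  interpret A': ultra E base \<mu> \<psi>' by fact
  obtain w where w: "w \<in> A.ch v" using A.ch_nonempty by blast
  let ?f = "A.wavelet v w"
  have "snd B ?f ?f = A.variation ?f v / \<psi> v" "snd B ?f ?f = A.variation ?f v / \<psi>' v"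
    using assms(3,4) A.wavelet_form[OF w] A'.wavelet_form[OF w] unfolding same_form_def by auto
  then show ?thesis using A.variation_wavelet_pos[OF w] A.psi_pos[of v] A'.psi_pos[of v]
    by (simp add: field_simps)
qed

section \<open>The Green function as a potential\<close>

context tree_walk
begin

text \<open>Strict decrease comes from the maximum principle in the branch at \<open>w\<close>,
  where the Green function is harmonic: if the parent did not have the larger value, the branch
  would contain a positive maximum.\<close>

lemma green_potentialI:
  assumes tr: "transient p"
    and vanish: "\<And>\<epsilon>. 0 < \<epsilon> \<Longrightarrow> \<exists>S. finite S \<and> (\<forall>v. v \<notin> S \<longrightarrow> Green p v base < \<epsilon>)"
  shows "green_potential E base p (\<lambda>v. Green p v base)"
proof -
  let ?g = "\<lambda>v. Green p v base"
  have s: "summable (\<lambda>n. n_step p n u base)" for u using tr by (simp add: transient_def)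
  have nn: "0 \<le> n_step p n u v" for n u v by (simp add: n_step_eq iter_nonneg)
  have pos: "0 < ?g v" for v
    unfolding Green_def using n_step_base_pos[of v] nn by (intro suminf_pos2[OF s]) auto
  have lap: "?g u - step ?g u = of_bool (u = base)" for u
  proof -
    have "step ?g u = (\<Sum>n. \<Sum>w\<in>nbr u. p u w * n_step p n w base)"
      unfolding step_def Green_def
      by (subst suminf_sum) (auto intro!: summable_mult s simp: suminf_mult[OF s])
    also have "\<dots> = (\<Sum>n. n_step p (Suc n) u base)" by (simp add: infsum_p)
    also have "\<dots> = ?g u - n_step p 0 u base"
      unfolding Green_def by (rule suminf_split_head[OF s])
    finally show ?thesis by simp
  qed
  have fin: "finite {v. \<epsilon> \<le> ?g v}" if \<epsilon>: "0 < \<epsilon>" for \<epsilon>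
  proof -
    obtain S where S: "finite S" "\<forall>v. v \<notin> S \<longrightarrow> ?g v < \<epsilon>" using vanish[OF \<epsilon>] by blast
    have "{v. \<epsilon> \<le> ?g v} \<subseteq> S" using S(2) by force
    then show ?thesis using S(1) finite_subset by blast
  qed
  have dec: "?g w < ?g v" if w: "w \<in> ch v" for w v
  proof (rule ccontr)
    assume "\<not> ?g w < ?g v"
    moreover have "step ?g x = ?g x" if "w \<in> set (geo x)" for x
    proof -
      have "x \<noteq> base" using that w by (auto simp: ch_iff)
      then show ?thesis using lap[of x] by simp
    qed
    ultimately show False
      using max_principle[of ?g w w] fin pos[of w] par_of_ch[OF w] by auto
  qed
  show ?thesis by unfold_locales (fact pos dec fin lap)+
qed

end

section \<open>Ultra-metric elements vanish at infinity\<close>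

context rooted_tree
begin

text \<open>A vertex with infinitely many elements of \<open>S\<close> below it has such a child,
  because it has finitely many children; descending through these vertices gives the ray.\<close>

lemma konig:
  assumes inf: "infinite S"
  shows "\<exists>s\<in>rays. \<forall>n. \<exists>v\<in>S. s n \<in> set (geo v)"
proof -
  define big where "big u \<longleftrightarrow> infinite {v \<in> S. u \<in> set (geo v)}" for u
  have base: "big base" using inf by (simp add: big_def)
  have child: "\<exists>c. big c \<and> c \<in> ch u" if "big u" for u
  proof (rule ccontr)
    assume no: "\<nexists>c. big c \<and> c \<in> ch u"
    have "{v \<in> S. u \<in> set (geo v)} \<subseteq> insert u (\<Union>c\<in>ch u. {v \<in> S. c \<in> set (geo v)})"
    proof
      fix v assume v: "v \<in> {v \<in> S. u \<in> set (geo v)}"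
      show "v \<in> insert u (\<Union>c\<in>ch u. {v \<in> S. c \<in> set (geo v)})"
      proof (cases "v = u")
        case False
        obtain k where "v \<in> desc u k" using descI v by blast
        with False obtain j where "v \<in> desc u (1 + j)" by (cases k) auto
        then obtain c where "c \<in> ch u" "v \<in> desc c j" unfolding desc_add by (auto simp: desc_1)
        then show ?thesis using v by (auto simp: desc_def)
      qed simp
    qed
    moreover have "finite (\<Union>c\<in>ch u. {v \<in> S. c \<in> set (geo v)})" using no by (auto simp: big_def)
    ultimately have "finite {v \<in> S. u \<in> set (geo v)}" by (meson finite.insertI finite_subset)
    then show False using that by (simp add: big_def)
  qed
  \<comment> \<open>The predicate used for the choice mentions \<open>n\<close> just to make the
    sequence start at the root.\<close>
  obtain s where s: "s 0 = base" "\<And>n. big (s n)" "\<And>n. s (Suc n) \<in> ch (s n)"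
    using dependent_nat_choice[of "\<lambda>n u. big u \<and> (n = 0 \<longrightarrow> u = base)" "\<lambda>_ u c. c \<in> ch u"] base child
    by (metis nat.distinct(1))
  have "\<exists>v\<in>S. s n \<in> set (geo v)" for n
    using s(2)[of n] infinite_imp_nonempty[of "{v \<in> S. s n \<in> set (geo v)}"] by (auto simp: big_def)
  then show ?thesis using s by (auto simp: rays_def)
qed

text \<open>The definition asks for decay along single rays. An infinite superlevel set would yield
  a ray on which, by monotonicity, \<open>\<phi>\<close> stays at least
  \<open>\<epsilon>\<close>.\<close>

lemma ultrametric_finite:
  assumes u: "ultrametric_element E base \<phi>" and \<epsilon>: "0 < \<epsilon>"
  shows "finite {v. \<epsilon> \<le> \<phi> v}"
proof (rule ccontr)
  assume "infinite {v. \<epsilon> \<le> \<phi> v}"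
  then obtain s where s: "s \<in> rays" "\<And>n. \<exists>v\<in>{v. \<epsilon> \<le> \<phi> v}. s n \<in> set (geo v)" using konig by blast
  have mono: "\<phi> v \<le> \<phi> w" if "w \<in> set (geo v)" for v w
    using that
  proof (induction v rule: tree_induct)
    case (child x v)
    have "\<phi> v < \<phi> x" using u child.hyps by (auto simp: ultrametric_element_def ch_iff)
    then show ?case using child anc_ch[OF child.hyps] by auto
  qed simp
  have "\<epsilon> \<le> \<phi> (s n)" for n using s(2)[of n] mono order_trans by blast
  moreover have "(\<lambda>n. \<phi> (s n)) \<longlonglongrightarrow> 0"
    using u rays_is_ray[OF s(1)] by (simp add: ultrametric_element_def)
  ultimately have "\<epsilon> \<le> 0" by (intro LIMSEQ_le_const) auto
  then show False using \<epsilon> by simp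
qed

end

section \<open>The walk with prescribed conductances\<close>

locale standard_data = end_measure E base \<mu>
  for E :: "'v \<Rightarrow> 'v \<Rightarrow> bool" and base :: 'v and \<mu> :: "'v tree_end measure" +
  fixes \<phi> :: "'v \<Rightarrow> real"
  assumes ultrametric: "ultrametric_element E base \<phi>"
begin

lemma phi_pos: "0 < \<phi> v"
  using ultrametric by (simp add: ultrametric_element_def)

lemma phi_dec: "w \<in> ch v \<Longrightarrow> \<phi> w < \<phi> v"
  using ultrametric by (auto simp: ultrametric_element_def ch_iff)

text \<open>Forced by the normalisation at the root: the conductances
  \<open>mu w / (C * (\<phi> base - \<phi> w))\<close> of its edges must add up to
  \<open>m base = 1\<close>.\<close>

definition C :: real where
  "C = (\<Sum>w\<in>ch base. mu w / (\<phi> base - \<phi> w))"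

text \<open>The flow identity \<open>a(w) * (g(v) - g(w)) = mu w\<close> with
  \<open>g = C * \<phi>\<close>, solved for the conductance.\<close>

definition cond :: "'v \<Rightarrow> real" where
  "cond v = mu v / (C * (\<phi> (par v) - \<phi> v))"

definition mass :: "'v \<Rightarrow> real" where
  "mass u = (\<Sum>w\<in>ch u. cond w) + (if u = base then 0 else cond u)"

definition walk_p :: "'v \<Rightarrow> 'v \<Rightarrow> real" where
  "walk_p u v = (if v \<in> ch u then cond v / mass u else if u \<in> ch v then cond u / mass u else 0)"

lemma C_pos: "0 < C"
  unfolding C_def using ch_nonempty phi_dec by (intro sum_pos) auto

lemma cond_ch: "w \<in> ch v \<Longrightarrow> cond w * (C * (\<phi> v - \<phi> w)) = mu w"
  using phi_dec[of w v] C_pos by (simp add: cond_def ch_iff)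

lemma cond_pos: "w \<in> ch v \<Longrightarrow> 0 < cond w"
  using phi_dec[of w v] C_pos by (simp add: cond_def ch_iff)

lemma mass_pos: "0 < mass u"
proof -
  have "0 < (\<Sum>w\<in>ch u. cond w)" using ch_nonempty cond_pos by (intro sum_pos) auto
  moreover have "0 \<le> (if u = base then 0 else cond u)" using cond_pos[OF par_ch] by (auto simp: less_imp_le)
  ultimately show ?thesis unfolding mass_def by linarith
qed

lemma mass_base: "mass base = 1"
proof -
  have "mass base = (\<Sum>w\<in>ch base. mu w / (\<phi> base - \<phi> w) / C)"
    unfolding mass_def by (simp, intro sum.cong refl) (simp add: cond_def ch_iff)
  also have "\<dots> = C / C" unfolding sum_divide_distrib[symmetric] C_def ..
  finally show ?thesis using C_pos by simp
qed

lemma not_both_ch: "v \<in> ch u \<Longrightarrow> u \<notin> ch v"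
  using lev_ch[of v u] lev_ch[of u v] by auto

lemma walk_p_walk: "nearest_neighbour_walk E walk_p"
  unfolding nearest_neighbour_walk_def
proof (intro conjI allI)
  fix u v
  have "0 < cond v / mass u" if "v \<in> ch u" using cond_pos[OF that] mass_pos by simp
  moreover have "0 < cond u / mass u" if "u \<in> ch v" using cond_pos[OF that] mass_pos by simp
  ultimately show "0 < walk_p u v \<longleftrightarrow> E u v" "0 \<le> walk_p u v"
    by (auto simp: walk_p_def E_iff less_imp_le)
next
  fix u
  let ?N = "{v. E u v}"
  have fin: "finite ?N" using loc_fin by (simp add: locally_finite_def)
  have "(walk_p u has_sum sum (walk_p u) ?N) ?N" using fin by (rule has_sum_finite)
  moreover have "sum (walk_p u) ?N = 1"
  proof -
    have N: "?N = (if u = base then ch u else insert (par u) (ch u))"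
      by (auto simp: E_iff ch_iff)
    have "par u \<notin> ch u" if "u \<noteq> base" using not_both_ch[OF par_ch[OF that]] .
    then have "sum (walk_p u) ?N = (\<Sum>w\<in>ch u. cond w / mass u) + (if u = base then 0 else cond u / mass u)"
      unfolding N by (auto simp: walk_p_def par_ch)
    also have "\<dots> = (sum cond (ch u) + (if u = base then 0 else cond u)) / mass u"
      by (simp add: add_divide_distrib sum_divide_distrib)
    also have "\<dots> = mass u / mass u" unfolding mass_def ..
    finally show ?thesis using mass_pos[of u] by simp
  qed
  ultimately have "(walk_p u has_sum 1) ?N" by simp
  moreover have "walk_p u v = 0" if "\<not> E u v" for v using that by (auto simp: walk_p_def E_iff)
  ultimately show "(walk_p u has_sum 1) UNIV"
    by (subst has_sum_cong_neutral[where T = ?N and g = "walk_p u"]) auto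
qed

sublocale W: tree_walk E base walk_p
  by unfold_locales (rule walk_p_walk)

text \<open>By detailed balance both functions have the same ratio across each edge, and
  \<open>mass_base\<close> makes them agree at the root.\<close>

lemma m_mass: "W.m v = mass v"
proof (induction v rule: tree_induct)
  case root
  then show ?case by (simp add: mass_base)
next
  case (child v w)
  have "W.m w = mass v * (walk_p v w / walk_p w v)" using W.m_ch[OF child.hyps] child.IH by simp
  moreover have "walk_p v w = cond w / mass v" "walk_p w v = cond w / mass w"
    using child.hyps not_both_ch[OF child.hyps] by (simp_all add: walk_p_def)
  ultimately show ?case
    using cond_pos[OF child.hyps] mass_pos[of v] by simp
qed

lemma a_cond: "w \<in> ch v \<Longrightarrow> W.a w = cond w"
proof -
  assume w: "w \<in> ch v"
  have "walk_p v w = cond w / mass v" using w by (simp add: walk_p_def)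
  then show ?thesis using W.a_ch(2)[OF w] mass_pos[of v] by (simp add: m_mass)
qed

text \<open>In divergence form the flow of \<open>C * \<phi>\<close> along every edge is the mass of
  the branch below it; additivity of \<open>mu\<close> is the node law, and the total mass
  \<open>1\<close> is the source at the root.\<close>

lemma walk_green: "green_potential E base walk_p (\<lambda>v. C * \<phi> v)"
proof
  show "0 < C * \<phi> v" for v using C_pos phi_pos by simp
  show "C * \<phi> w < C * \<phi> v" if "w \<in> ch v" for w v using C_pos phi_dec[OF that] by simp
  show "finite {v. \<epsilon> \<le> C * \<phi> v}" if "0 < \<epsilon>" for \<epsilon>
    using ultrametric_finite[OF ultrametric, of "\<epsilon> / C"] that C_pos by (simp add: field_simps)
  show "C * \<phi> u - W.step (\<lambda>v. C * \<phi> v) u = of_bool (u = base)" for u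
  proof -
    have "(\<Sum>w\<in>ch u. W.a w * (C * \<phi> u - C * \<phi> w)) = (\<Sum>w\<in>ch u. mu w)"
      using cond_ch by (intro sum.cong refl) (simp add: a_cond right_diff_distrib)
    also have "\<dots> = mu u" by (rule mu_children)
    finally have 1: "(\<Sum>w\<in>ch u. W.a w * (C * \<phi> u - C * \<phi> w)) = mu u" .
    have 2: "W.a u * (C * \<phi> (par u) - C * \<phi> u) = mu u" if "u \<noteq> base"
      using cond_ch[OF par_ch[OF that]] a_cond[OF par_ch[OF that]] by (simp add: right_diff_distrib)
    have "W.m u * (C * \<phi> u - W.step (\<lambda>v. C * \<phi> v) u) = of_bool (u = base)"
      using 2 W.m_laplace[of u "\<lambda>v. C * \<phi> v"] 1 by (cases "u = base") (simp_all add: mu_base)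
    then have "mass u * (C * \<phi> u - W.step (\<lambda>v. C * \<phi> v) u) = of_bool (u = base)"
      unfolding m_mass .
    then show ?thesis using mass_pos[of u] by (cases "u = base") (auto simp: mass_base)
  qed
qed

sublocale W: green_potential E base walk_p "\<lambda>v. C * \<phi> v"
  by (rule walk_green)

lemma walk_flow: "W.flow v = mu v"
proof (cases "v = base")
  case False
  then show ?thesis using W.flow_ch[OF par_ch[OF False]] cond_ch[OF par_ch[OF False]] a_cond[OF par_ch[OF False]]
    by (simp add: right_diff_distrib)
qed (simp add: mu_base)

sublocale W: matched E base walk_p "\<lambda>v. C * \<phi> v" \<mu>
  by unfold_locales (simp add: walk_flow mu_def)

text \<open>The conditions of the theorem as a predicate, so that existence and uniqueness can be
  separate statements.\<close>

definition realises :: "real \<Rightarrow> ('v \<Rightarrow> 'v \<Rightarrow> real) \<Rightarrow> bool" where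
  "realises c p \<longleftrightarrow> 0 < c \<and> nearest_neighbour_walk E p \<and> transient p \<and>
     (\<forall>v. v \<noteq> base \<longrightarrow> hit_prob p v (parent E base v) < 1) \<and>
     (\<forall>\<epsilon>>0. \<exists>S. finite S \<and> (\<forall>v. v \<notin> S \<longrightarrow> Green p v base < \<epsilon>)) \<and>
     \<mu> = limit_law E base p base \<and>
     same_form (boundary_form E base p) (standard_form E base (\<lambda>v. c * \<phi> v) \<mu>)"

lemma realises_walk: "realises C walk_p"
  unfolding realises_def
proof (intro conjI allI impI)
  show "hit_prob walk_p v (par v) < 1" if "v \<noteq> base" for v
    by (rule W.hit_prob_par[OF par_ch[OF that]])
  show "\<exists>S. finite S \<and> (\<forall>v. v \<notin> S \<longrightarrow> Green walk_p v base < \<epsilon>)" if "0 < \<epsilon>" for \<epsilon>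
    using W.g_vanish[OF that] by (intro exI[of _ "{v. \<epsilon> \<le> C * \<phi> v}"]) (auto simp: W.Green_base)
  show "\<mu> = limit_law E base walk_p base" by (rule W.limit_law_base[symmetric])
qed (rule C_pos walk_p_walk W.transient W.same_form_boundary_standard)+

lemma realises_unique:
  assumes "realises c p"
  shows "c = C \<and> p = walk_p"
proof -
  have r: "0 < c" "nearest_neighbour_walk E p" "transient p"
    "\<And>\<epsilon>. 0 < \<epsilon> \<Longrightarrow> \<exists>S. finite S \<and> (\<forall>v. v \<notin> S \<longrightarrow> Green p v base < \<epsilon>)"
    "\<mu> = limit_law E base p base"
    "same_form (boundary_form E base p) (standard_form E base (\<lambda>v. c * \<phi> v) \<mu>)"
    using assms unfolding realises_def by blast+
  interpret P: tree_walk E base p by unfold_locales (rule r(2))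
  interpret P: green_potential E base p "\<lambda>v. Green p v base" by (rule P.green_potentialI[OF r(3,4)])
  \<comment> \<open>Since \<open>\<mu>\<close> is the limit law, its branch masses are the flow of
    this walk's Green function.\<close>
  interpret P: matched E base p "\<lambda>v. Green p v base" \<mu>
    by unfold_locales (subst r(5), rule P.limit_law_base_bd)
  have "ultra E base \<mu> (\<lambda>v. c * \<phi> v)"
    by unfold_locales (use r(1) phi_pos phi_dec in auto)
  \<comment> \<open>The boundary form is standard for the Green function of the walk and, by
    assumption, for \<open>c * \<phi>\<close>; the two must agree.\<close>
  from standard_form_determines[OF P.ultra_axioms this P.same_form_boundary_standard r(6)]
  have g: "Green p v base = c * \<phi> v" for v .
  have a: "P.a w * (c * (\<phi> v - \<phi> w)) = mu w" if "w \<in> ch v" for w v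
    using P.flow_ch[OF that] P.mu_eq_flow[of w] by (simp add: g right_diff_distrib)
  have a': "P.a w = mu w / (\<phi> v - \<phi> w) / c" if "w \<in> ch v" for w v
    using a[OF that] r(1) phi_dec[OF that] by (simp add: field_simps)
  \<comment> \<open>The total conductance at the root is \<open>1\<close> for every walk; this
    determines \<open>c\<close>.\<close>
  have "1 = (\<Sum>w\<in>ch base. P.a w)" using P.m_eq_sum[of base] by simp
  also have "\<dots> = (\<Sum>w\<in>ch base. mu w / (\<phi> base - \<phi> w) / c)" by (intro sum.cong refl a')
  also have "\<dots> = C / c" unfolding C_def sum_divide_distrib ..
  finally have c: "c = C" using r(1) by simp
  have ac: "P.a w = cond w" if "w \<in> ch v" for w v
    using a'[OF that] that by (simp add: c cond_def ch_iff)
  have m: "P.m u = mass u" for u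
    unfolding P.m_eq_sum mass_def using ac par_ch by auto
  \<comment> \<open>With conductances and reversible measure known, detailed balance returns the
    transition probabilities.\<close>
  have "p u v = walk_p u v" for u v
  proof -
    consider "v \<in> ch u" | "u \<in> ch v" | "v \<notin> ch u" "u \<notin> ch v" by blast
    then show ?thesis
    proof cases
      case 1
      then show ?thesis using P.a_ch(2)[OF 1] ac[OF 1] mass_pos[of u] by (simp add: m walk_p_def)
    next
      case 2
      then show ?thesis using P.a_ch(1)[OF 2] ac[OF 2] mass_pos[of u] not_both_ch[OF 2]
        by (simp add: m walk_p_def)
    next
      case 3
      then show ?thesis using P.p_zero[of v u] by (simp add: walk_p_def P.nbr_def E_iff)
    qed
  qed
  then show ?thesis using c by blast
qed

end

theorem theorem7p5:
  fixes E :: "'v \<Rightarrow> 'v \<Rightarrow> bool" and base :: 'v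
    and \<phi> :: "'v \<Rightarrow> real" and \<mu> :: "'v tree_end measure"
  assumes "is_tree E" and "locally_finite E"
    and "\<And>u. finite (children E base u) \<and> 2 \<le> card (children E base u)"
    and "ultrametric_element E base \<phi>"
    and "prob_space \<mu>" and "sets \<mu> = sets (end_borel E base)" and "fully_supported E base \<mu>"
  shows "\<exists>!Cp. case Cp of (C, p) \<Rightarrow>
     0 < C \<and> nearest_neighbour_walk E p \<and> transient p \<and>
     (\<forall>v. v \<noteq> base \<longrightarrow> hit_prob p v (parent E base v) < 1) \<and>
     (\<forall>\<epsilon>>0. \<exists>S. finite S \<and> (\<forall>v. v \<notin> S \<longrightarrow> Green p v base < \<epsilon>)) \<and>
     \<mu> = limit_law E base p base \<and>
     same_form (boundary_form E base p) (standard_form E base (\<lambda>v. C * \<phi> v) \<mu>)"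
proof -
  have tree: "rooted_tree E base" by (rule rooted_tree.intro[OF assms(1-3)])
  interpret T: rooted_tree E base by (rule tree)
  interpret prob_space \<mu> by (rule assms(5))
  have "0 < emeasure \<mu> (T.bd v)" for v
    using assms(7) T.bd_open[of v] T.bd_nonempty[of v] unfolding fully_supported_def by blast
  then have pos: "0 < measure \<mu> (T.bd v)" for v
    by (simp add: emeasure_eq_measure)
  interpret D: standard_data E base \<mu> \<phi>
    by (intro standard_data.intro end_measure.intro tree end_measure_axioms.intro
        standard_data_axioms.intro assms(4,5,6) pos)
  have "\<exists>!Cp. case Cp of (c, p) \<Rightarrow> D.realises c p"
  proof (rule ex1I[of _ "(D.C, D.walk_p)"])
    show "case (D.C, D.walk_p) of (c, p) \<Rightarrow> D.realises c p" using D.realises_walk by simp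
    fix Cp assume "case Cp of (c, p) \<Rightarrow> D.realises c p"
    then show "Cp = (D.C, D.walk_p)" using D.realises_unique by (cases Cp) simp
  qed
  then show ?thesis unfolding D.realises_def .
qed

end
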